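(* Let $K:\mathbb{R}\to\mathbb{R}\cup\{\infty\}$ be a function which may be infinite only at $t=0$ and which satisfies: (I)(a) $K\in L^1_{loc}(\mathbb{R})$, $K$ is symmetric around zero, and $K(t)>0$ for all $t\neq 0$; (I)(b) $K(t)\to 0$ as $t\to\infty$ and $K$ is eventually decreasing; (I)(c) the improper integral $\mathcal{K}_{\cos}(\omega)=\int_0^\infty K(t)\cos(\omega t)\,dt$ is positive for all $\omega\neq 0$. Let $V$ be the weak solution of the generalized Langevin equation $$m\dot V(t)=-\beta\int_{-\infty}^t K(t-s)V(s)\,ds+\sqrt{\beta}\,F(t),\qquad m,\beta>0,$$ and let $X(t)=\langle V,1_{[0,t]}\rangle$ be the associated position process. (a) (Diffusive regime) If $K\in L^1(0,\infty)$ and there exists $\beta_0>0$ such that $t^{\beta_0}K(t)\in L^1(0,\infty)$, then, with $\gamma_0=\min\{\beta_0,2\}$, $$\Big|\frac{\mathbb{E}[X(t)^2]}{t}-\frac{2}{\beta\mathcal{K}_{\cos}(0)}\Big|=O(t^{-\gamma_0/2}),\qquad t\to\infty.$$ (b) (Subdiffusive regime) If there exist $\alpha\in(0,1)$, $C_\alpha>0$ and $\beta_\alpha>0$ such that $K(t)\sim t^{-\alpha}$ and $|t^\alpha K(t)-C_\alpha|=O(t^{-\beta_\alpha})$ as $t\to\infty$, then, with $\eta=\min\{\alpha,1-\alpha,\alpha\beta_\alpha\}$, $$\Big|\frac{\mathbb{E}[X(t)^2]}{t^\alpha}-\frac{2\sin(\alpha\pi)}{\alpha\pi\beta C_\alpha}\Big|=O(t^{-\eta/2}),\qquad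 t\to\infty.$$
   Context: Notation: $f(t)\sim g(t)$ as $t\to\infty$ means $f(t)/g(t)\to c$ for some constant $c\in(0,\infty)$ (not necessarily $1$). $\mathcal{K}_{\cos}(\omega)=\int_0^\infty K(t)\cos(t\omega)\,dt$ and $\mathcal{K}_{\sin}(\omega)=\int_0^\infty K(t)\sin(t\omega)\,dt$ are improper integrals; in part (a) $\mathcal{K}_{\cos}(0)=\int_0^\infty K(t)\,dt$. "Eventually decreasing" means decreasing on $[A,\infty)$ for some $A$. $m>0$ and $\beta>0$ are constants. Fourier conventions: $\widehat\varphi(\omega)=\int_{\mathbb{R}}e^{it\omega}\varphi(t)\,dt$. $\mathcal{S}$ is the Schwartz space, $\mathcal{S}'$ the tempered distributions, $\mathcal{F}[g]$ the Fourier transform of $g\in\mathcal{S}'$, defined by $\langle\mathcal{F}[g],\varphi\rangle=\langle g,\widehat\varphi\rangle$. Operator with spectral measure $\nu$: let $\nu$ be a non-negative measure on $\mathbb{R}$, absolutely continuous with respect to Lebesgue measure, with $\int_{\mathbb{R}}(1+x^2)^{-k}\nu(dx)<\infty$ for some integer $k$. The operator $V$ associated with $\nu$ is a linear map from $\mathrm{Dom}(V)$ to square-integrable complex-valued Gaussian random variables, where $\mathrm{Dom}(V)$ is the set of $g\in\mathcal{S}'$ such that $\mathcal{F}[g]$ is a complex-valued function belonging to $L^2(\nu)$, and $$\mathbb{E}\big[\langle V,g_1\rangle\overline{\langle V,g_2\rangle}\big]=\int_{\mathbb{R}}\mathcal{F}[g_1](\omega)\overline{\mathcal{F}[g_2](\omega)}\,\nu(d\omega),\qquad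 g_1,g_2\in\mathrm{Dom}(V).$$ Weak solution: let $K^+(t)=K(t)1_{\{t\ge0\}}$ and $\widetilde f(x)=f(-x)$, so $\widetilde{K^+*\widetilde\varphi}(t)=\int_{\mathbb{R}}K^+(u)\varphi(t+u)\,du$. The noise $F$ is the stationary random distribution on $\mathcal{S}$ with $\mathbb{E}[\langle F,\varphi_1\rangle\overline{\langle F,\varphi_2\rangle}]=\int_{\mathbb{R}}K(t)(\varphi_1*\varphi_2^{*})(t)\,dt$, $\varphi_2^*(t)=\overline{\varphi_2(-t)}$. $V$ is a weak solution of the equation if (a) $K^+*\varphi\in\mathrm{Dom}(V)$ for every $\varphi\in\mathcal{S}$, and (b) for all $\varphi,\psi\in\mathcal{S}$, $\mathbb{E}\big[\langle V,-m\varphi'+\beta\widetilde{K^+*\widetilde\varphi}\rangle\overline{\langle V,-m\psi'+\beta\widetilde{K^+*\widetilde\psi}\rangle}\big]=\mathbb{E}\big[\langle\sqrt\beta F,\varphi\rangle\overline{\langle\sqrt\beta F,\psi\rangle}\big]$. It is known from earlier work that in both regimes (a) and (b) the weak solution is the operator with spectral measure $\nu(d\omega)=\widehat r(\omega)\,d\omega$, $$\widehat r(\omega)=\frac{1}{2\pi}\,\frac{2\beta\mathcal{K}_{\cos}(\omega)}{[\beta\mathcal{K}_{\cos}(\omega)]^2+[m\omega-\beta\mathcal{K}_{\sin}(\omega)]^2},$$ so that $\mathbb{E}[X(t)^2]=\int_{\mathbb{R}}|\widehat{1_{[0,t]}}(\omega)|^2\,\widehat r(\omega)\,d\omega$. 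*)

theory Defs
  imports "HOL-Probability.Probability" "HOL-Library.Landau_Symbols"
begin

section \<open>Schwartz functions and tempered distributions on the real line\<close>

definition vderiv :: "(real \<Rightarrow> complex) \<Rightarrow> real \<Rightarrow> complex" where
  "vderiv f = (\<lambda>x. vector_derivative f (at x))"

definition schwartz :: "(real \<Rightarrow> complex) set" where
  "schwartz = {f. (\<forall>k x. (vderiv ^^ k) f differentiable (at x)) \<and>
                  (\<forall>j k. bounded (range (\<lambda>x. x ^ j *\<^sub>R (vderiv ^^ k) f x)))}"

definition schwartz_seminorm :: "nat \<Rightarrow> nat \<Rightarrow> (real \<Rightarrow> complex) \<Rightarrow> real" where
  "schwartz_seminorm j k f = (SUP x. norm (x ^ j *\<^sub>R (vderiv ^^ k) f x))"

text \<open>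
  Continuity of a seminorm \<open>p\<close> on the Schwartz space, whose topology is generated by
  the seminorms above. A linear map is continuous iff the norm of its value is dominated in
  this way.
\<close>
definition schwartz_dominated :: "((real \<Rightarrow> complex) \<Rightarrow> real) \<Rightarrow> bool" where
  "schwartz_dominated p \<longleftrightarrow>
     (\<exists>C N. \<forall>\<phi>\<in>schwartz. p \<phi> \<le> C * (\<Sum>j\<le>N. \<Sum>k\<le>N. schwartz_seminorm j k \<phi>))"

text \<open>
  A functional on Schwartz functions is extended by \<open>undefined\<close> to all functions
  (\<^const>\<open>extensional\<close>), so that equality of tempered distributions is equality in HOL.
\<close>
definition tempered :: "((real \<Rightarrow> complex) \<Rightarrow> complex) set" where
  "tempered = {T \<in> extensional schwartz.
     (\<forall>\<phi>\<in>schwartz. \<forall>\<psi>\<in>schwartz. \<forall>a b. T (\<lambda>x. a * \<phi> x + b * \<psi> x) = a * T \<phi> + b * T \<psi>) \<and>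
     schwartz_dominated (\<lambda>\<phi>. cmod (T \<phi>))}"

definition fun_dist :: "(real \<Rightarrow> complex) \<Rightarrow> (real \<Rightarrow> complex) \<Rightarrow> complex" where
  "fun_dist f = (\<lambda>\<phi>\<in>schwartz. LINT x|lebesgue. f x * \<phi> x)"

definition dist_lincomb ::
  "complex \<Rightarrow> ((real \<Rightarrow> complex) \<Rightarrow> complex) \<Rightarrow> complex \<Rightarrow> ((real \<Rightarrow> complex) \<Rightarrow> complex)
     \<Rightarrow> (real \<Rightarrow> complex) \<Rightarrow> complex" where
  "dist_lincomb a S b T = (\<lambda>\<phi>\<in>schwartz. a * S \<phi> + b * T \<phi>)"

definition fourier :: "(real \<Rightarrow> complex) \<Rightarrow> real \<Rightarrow> complex" where
  "fourier \<phi> \<omega> = (LINT t|lebesgue. cis (t * \<omega>) * \<phi> t)"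

definition dist_fourier :: "((real \<Rightarrow> complex) \<Rightarrow> complex) \<Rightarrow> (real \<Rightarrow> complex) \<Rightarrow> complex" where
  "dist_fourier T = (\<lambda>\<phi>\<in>schwartz. T (fourier \<phi>))"

text \<open>
  The distribution \<open>T\<close> is the function \<open>h\<close>. The integrability clause is needed because the
  Bochner integral of a non-integrable function is 0. The function \<open>h\<close> is determined up to
  Lebesgue null sets.
\<close>
definition represented_by :: "((real \<Rightarrow> complex) \<Rightarrow> complex) \<Rightarrow> (real \<Rightarrow> complex) \<Rightarrow> bool" where
  "represented_by T h \<longleftrightarrow> h \<in> borel_measurable borel \<and>
     (\<forall>\<phi>\<in>schwartz. integrable lborel (\<lambda>x. h x * \<phi> x) \<and> T \<phi> = (LINT x|lborel. h x * \<phi> x))"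

definition convol :: "(real \<Rightarrow> complex) \<Rightarrow> (real \<Rightarrow> complex) \<Rightarrow> real \<Rightarrow> complex" where
  "convol f g t = (LINT s|lebesgue. f s * g (t - s))"

definition reflect :: "(real \<Rightarrow> complex) \<Rightarrow> real \<Rightarrow> complex" where
  "reflect f x = f (- x)"


section \<open>Operators with a spectral measure\<close>

text \<open>Degenerate (almost surely constant) variables count as Gaussian.\<close>
definition gaussian_rv :: "'w measure \<Rightarrow> ('w \<Rightarrow> real) \<Rightarrow> bool" where
  "gaussian_rv M X \<longleftrightarrow> X \<in> borel_measurable M \<and>
     ((\<exists>\<mu> \<sigma>. 0 < \<sigma> \<and> distributed M lborel X (normal_density \<mu> \<sigma>)) \<or>
      (\<exists>c. AE w in M. X w = c))"

definition complex_gaussian_rv :: "'w measure \<Rightarrow> ('w \<Rightarrow> complex) \<Rightarrow> bool" where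
  "complex_gaussian_rv M Z \<longleftrightarrow> (\<forall>a b. gaussian_rv M (\<lambda>w. a * Re (Z w) + b * Im (Z w)))"

definition square_integrable :: "'w measure \<Rightarrow> ('w \<Rightarrow> complex) \<Rightarrow> bool" where
  "square_integrable M Z \<longleftrightarrow> Z \<in> borel_measurable M \<and> integrable M (\<lambda>w. (cmod (Z w))\<^sup>2)"

definition tempered_spectral_measure :: "real measure \<Rightarrow> bool" where
  "tempered_spectral_measure \<nu> \<longleftrightarrow> sets \<nu> = sets borel \<and> absolutely_continuous lborel \<nu> \<and>
     (\<exists>k::int. integrable \<nu> (\<lambda>x. (1 + x\<^sup>2) powi (- k)))"

definition spectral_dom :: "real measure \<Rightarrow> ((real \<Rightarrow> complex) \<Rightarrow> complex) set" where
  "spectral_dom \<nu> =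
     {g \<in> tempered. \<exists>h. represented_by (dist_fourier g) h \<and> square_integrable \<nu> h}"

text \<open>
  In the covariance identity it does not matter which representatives \<open>h\<^sub>1\<close>, \<open>h\<^sub>2\<close> of the
  Fourier transforms are used, since \<open>\<nu>\<close> is absolutely continuous.
\<close>
definition spectral_operator ::
  "'w measure \<Rightarrow> real measure \<Rightarrow> (((real \<Rightarrow> complex) \<Rightarrow> complex) \<Rightarrow> 'w \<Rightarrow> complex) \<Rightarrow> bool" where
  "spectral_operator M \<nu> V \<longleftrightarrow>
     tempered_spectral_measure \<nu> \<and>
     (\<forall>g\<in>spectral_dom \<nu>. square_integrable M (V g) \<and> complex_gaussian_rv M (V g)) \<and>
     (\<forall>g\<^sub>1\<in>spectral_dom \<nu>. \<forall>g\<^sub>2\<in>spectral_dom \<nu>. \<forall>a b.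
        AE w in M. V (dist_lincomb a g\<^sub>1 b g\<^sub>2) w = a * V g\<^sub>1 w + b * V g\<^sub>2 w) \<and>
     (\<forall>g\<^sub>1\<in>spectral_dom \<nu>. \<forall>g\<^sub>2\<in>spectral_dom \<nu>. \<forall>h\<^sub>1 h\<^sub>2.
        represented_by (dist_fourier g\<^sub>1) h\<^sub>1 \<longrightarrow> represented_by (dist_fourier g\<^sub>2) h\<^sub>2 \<longrightarrow>
        (LINT w|M. V g\<^sub>1 w * cnj (V g\<^sub>2 w)) = (LINT \<omega>|\<nu>. h\<^sub>1 \<omega> * cnj (h\<^sub>2 \<omega>)))"


section \<open>The noise and the weak solution\<close>

text \<open>Stationarity is meant in the wide sense: the covariance is translation invariant.\<close>
definition stationary_random_distribution ::
  "'w measure \<Rightarrow> ((real \<Rightarrow> complex) \<Rightarrow> 'w \<Rightarrow> complex) \<Rightarrow> bool" where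
  "stationary_random_distribution M F \<longleftrightarrow>
     (\<forall>\<phi>\<in>schwartz. square_integrable M (F \<phi>)) \<and>
     (\<forall>\<phi>\<in>schwartz. \<forall>\<psi>\<in>schwartz. \<forall>a b.
        AE w in M. F (\<lambda>x. a * \<phi> x + b * \<psi> x) w = a * F \<phi> w + b * F \<psi> w) \<and>
     schwartz_dominated (\<lambda>\<phi>. sqrt (LINT w|M. (cmod (F \<phi> w))\<^sup>2)) \<and>
     (\<forall>\<phi>\<in>schwartz. \<forall>\<psi>\<in>schwartz. \<forall>h.
        (LINT w|M. F (\<lambda>x. \<phi> (x - h)) w * cnj (F (\<lambda>x. \<psi> (x - h)) w)) =
        (LINT w|M. F \<phi> w * cnj (F \<psi> w)))"

definition gle_noise ::
  "'w measure \<Rightarrow> (real \<Rightarrow> real) \<Rightarrow> ((real \<Rightarrow> complex) \<Rightarrow> 'w \<Rightarrow> complex) \<Rightarrow> bool" where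
  "gle_noise M K F \<longleftrightarrow> stationary_random_distribution M F \<and>
     (\<forall>\<phi>\<in>schwartz. \<forall>\<psi>\<in>schwartz.
        (LINT w|M. F \<phi> w * cnj (F \<psi> w)) =
        (LINT t|lebesgue. of_real (K t) * convol \<phi> (\<lambda>s. cnj (\<psi> (- s))) t))"

definition causal_part :: "(real \<Rightarrow> real) \<Rightarrow> real \<Rightarrow> complex" where
  "causal_part K t = (if 0 \<le> t then of_real (K t) else 0)"

text \<open>
  The test function against which \<open>V\<close> is evaluated is
  \<open>t \<mapsto> -m \<phi>'(t) + \<beta> \<integral> K\<^sup>+(u) \<phi>(t + u) du\<close>.
\<close>
definition gle_test ::
  "real \<Rightarrow> real \<Rightarrow> (real \<Rightarrow> real) \<Rightarrow> (real \<Rightarrow> complex) \<Rightarrow> real \<Rightarrow> complex" where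
  "gle_test m \<beta> K \<phi> t =
     - of_real m * vderiv \<phi> t
     + of_real \<beta> * reflect (convol (causal_part K) (reflect \<phi>)) t"

definition gle_weak_solution ::
  "'w measure \<Rightarrow> real \<Rightarrow> real \<Rightarrow> (real \<Rightarrow> real) \<Rightarrow> ((real \<Rightarrow> complex) \<Rightarrow> 'w \<Rightarrow> complex)
     \<Rightarrow> (((real \<Rightarrow> complex) \<Rightarrow> complex) \<Rightarrow> 'w \<Rightarrow> complex) \<Rightarrow> bool" where
  "gle_weak_solution M m \<beta> K F V \<longleftrightarrow>
     (\<exists>\<nu>. spectral_operator M \<nu> V \<and>
        (\<forall>\<phi>\<in>schwartz. fun_dist (convol (causal_part K) \<phi>) \<in> spectral_dom \<nu>) \<and>
        (\<forall>\<phi>\<in>schwartz. \<forall>\<psi>\<in>schwartz.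
           (LINT w|M. V (fun_dist (gle_test m \<beta> K \<phi>)) w * cnj (V (fun_dist (gle_test m \<beta> K \<psi>)) w)) =
           (LINT w|M. (of_real (sqrt \<beta>) * F \<phi> w) * cnj (of_real (sqrt \<beta>) * F \<psi> w))))"

text \<open>
  The operator is complex-valued and only its covariances \<open>E[Z\<^sub>1 * cnj Z\<^sub>2]\<close> are prescribed, so
  the second moment of the position process is the expectation of its squared modulus.
\<close>
definition position_process ::
  "(((real \<Rightarrow> complex) \<Rightarrow> complex) \<Rightarrow> 'w \<Rightarrow> complex) \<Rightarrow> real \<Rightarrow> 'w \<Rightarrow> complex" where
  "position_process V t = V (fun_dist (indicator {0..t}))"


section \<open>The memory kernel\<close>

text \<open>
  The kernel may take the value \<open>\<infinity>\<close> at the origin; integrals do not see that point, so the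
  real-valued version (with value 0 there) is used in them.
\<close>
definition real_kernel :: "(real \<Rightarrow> ereal) \<Rightarrow> real \<Rightarrow> real" where
  "real_kernel K t = real_of_ereal (K t)"

definition locally_integrable :: "(real \<Rightarrow> real) \<Rightarrow> bool" where
  "locally_integrable f \<longleftrightarrow> (\<forall>S. compact S \<longrightarrow> f absolutely_integrable_on S)"

definition has_improper_integral :: "(real \<Rightarrow> real) \<Rightarrow> real \<Rightarrow> bool" where
  "has_improper_integral f I \<longleftrightarrow>
     (\<forall>T\<ge>0. f integrable_on {0..T}) \<and> ((\<lambda>T. integral {0..T} f) \<longlongrightarrow> I) at_top"

definition improper_integral :: "(real \<Rightarrow> real) \<Rightarrow> real" where
  "improper_integral f = (THE I. has_improper_integral f I)"

definition Kcos :: "(real \<Rightarrow> real) \<Rightarrow> real \<Rightarrow> real" where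
  "Kcos K \<omega> = improper_integral (\<lambda>t. K t * cos (t * \<omega>))"

text \<open>
  The relation \<open>f(t) \<sim> g(t)\<close> in the sense that the ratio has some finite positive limit;
  \<^const>\<open>asymp_equiv\<close> would require the limit to be 1.
\<close>
definition asymp_proportional :: "(real \<Rightarrow> real) \<Rightarrow> (real \<Rightarrow> real) \<Rightarrow> bool" where
  "asymp_proportional f g \<longleftrightarrow> (\<exists>c>0. ((\<lambda>t. f t / g t) \<longlongrightarrow> c) at_top)"

definition gle_kernel :: "(real \<Rightarrow> ereal) \<Rightarrow> bool" where
  "gle_kernel K \<longleftrightarrow>
     (\<forall>t. K t \<noteq> -\<infinity> \<and> (t \<noteq> 0 \<longrightarrow> K t \<noteq> \<infinity>)) \<and>
     locally_integrable (real_kernel K) \<and>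
     (\<forall>t. K (- t) = K t) \<and>
     (\<forall>t. t \<noteq> 0 \<longrightarrow> 0 < K t) \<and>
     (K \<longlongrightarrow> 0) at_top \<and>
     (\<exists>A. antimono_on {A..} K) \<and>
     (\<forall>\<omega>. \<omega> \<noteq> 0 \<longrightarrow>
        (\<exists>I>0. has_improper_integral (\<lambda>t. real_kernel K t * cos (t * \<omega>)) I))"

end

theory Submission
  imports Defs "HOL-Real_Asymp.Real_Asymp"
begin

text \<open>
  Write \<open>L\<close> for the Fourier transform of \<open>K\<^sup>+\<close>. It exists off the origin as an improper integral, since
  \<open>K\<close> is eventually decreasing. Testing the weak equation against the translates of one Gaussian
  determines the characteristic function of the finite measure \<open>|\<beta> L - i m \<omega>|\<^sup>2 e^(-\<omega>\<^sup>2) \<nu>(d\<omega>)\<close>, so by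
  Levy's uniqueness theorem \<open>\<nu>\<close> has the density \<open>r = Re (1 / (\<beta> L - i m \<omega>)) / \<pi>\<close>, and
  \<open>E |X(t)|\<^sup>2 = \<integral> 2 (1 - cos t\<omega>) \<omega>^(-2) r(\<omega>) d\<omega>\<close>.

  If \<open>|r(\<omega>) - c |\<omega>|^(1 - a)| \<le> C |\<omega>|^(1 - a + d)\<close> with \<open>0 < d < a\<close>, then the substitution \<open>\<omega> \<mapsto> \<omega> / t\<close> shows
  that \<open>E |X(t)|\<^sup>2 / t^a\<close> converges with rate \<open>t^(-d)\<close>; here \<open>a = 1\<close> in the diffusive regime and
  \<open>a = \<alpha>\<close> in the subdiffusive one. The expansion of \<open>r\<close> follows from one of \<open>L\<close> at the origin, given by
  the moments of \<open>K\<close> in the first case and by comparison with the kernel \<open>C\<^sub>\<alpha> t^(-\<alpha>)\<close> in the second. For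
  \<open>\<beta>\<^sub>0 \<ge> 2\<close> the rate \<open>1 / t\<close> requires the quadratic estimate \<open>|r(\<omega>) - c| \<le> C \<omega>\<^sup>2\<close>, because the linear one
  loses a logarithm.
\<close>

section \<open>Schwartz functions\<close>

text \<open>The spectral measure is only known to exist, and \<open>K\<close> need be neither
  integrable nor square integrable, so identities for \<open>L\<close> are reached through
  integrable truncations. The passage to the limit rests on a bound
  \<open>C (1 + |\<omega>|^(-p))\<close> with \<open>p < 1\<close>, uniform in the truncation: it is
  integrable near the origin. Gaussians serve as tests because the transform of the translate by
  \<open>h\<close> is a fixed Gaussian times \<open>e^(i h \<omega>)\<close>; the covariance for the
  translates by \<open>h\<close> and 0 is then a characteristic function at \<open>h\<close>. The
  weight \<open>2 (1 - cos t\<omega>) \<omega>^(-2)\<close> makes an error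
  \<open>|\<omega>|^(1 - a + d)\<close> integrable at infinity only for \<open>d < a\<close>. The
  halved exponents of the theorem respect this, except in the borderline case
  \<open>d = a = 1\<close>. The subdiffusive constant is the product of a cosine from
  \<open>Re (1 / L)\<close> and a sine from the integral of \<open>1 - cos\<close>. Both come from
  the one number \<open>\<integral> t^(-\<alpha>) e^(i t) dt\<close>, so its modulus cancels and the
  double angle yields \<open>sin (\<alpha> \<pi>)\<close>.\<close>

lemma schwartz_coinduct:
  assumes "f \<in> P"
    and diff: "\<And>g x. g \<in> P \<Longrightarrow> g differentiable (at x)"
    and deriv: "\<And>g. g \<in> P \<Longrightarrow> vderiv g \<in> P"
    and bdd: "\<And>g j. g \<in> P \<Longrightarrow> bounded (range (\<lambda>x. x ^ j *\<^sub>R g x))"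
  shows "f \<in> schwartz"
proof -
  \<comment> \<open>Iterated derivatives rarely have a usable closed form; a class \<open>P\<close>
    preserved by \<open>vderiv\<close> contains them all, and only bounds of order 0 remain to be
    checked.\<close>
  have "(vderiv ^^ k) f \<in> P" for k
    by (induction k) (simp_all add: assms(1) deriv)
  then show ?thesis
    by (simp add: schwartz_def diff bdd)
qed

lemma schwartzD:
  assumes "f \<in> schwartz"
  shows "(vderiv ^^ k) f differentiable (at x)" "bounded (range (\<lambda>x. x ^ j *\<^sub>R (vderiv ^^ k) f x))"
  using assms by (auto simp: schwartz_def)

lemma schwartz_differentiable: "f \<in> schwartz \<Longrightarrow> f differentiable (at x)"
  using schwartzD(1)[of f 0] by simp

lemma schwartz_bounded: "f \<in> schwartz \<Longrightarrow> bounded (range (\<lambda>x. x ^ j *\<^sub>R f x))"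
  using schwartzD(2)[of f j 0] by simp

lemma schwartz_vderiv:
  assumes "f \<in> schwartz"
  shows "vderiv f \<in> schwartz"
proof -
  have *: "(vderiv ^^ k) (vderiv f) = (vderiv ^^ Suc k) f" for k
    by (simp add: funpow_swap1)
  show ?thesis
    unfolding schwartz_def mem_Collect_eq *
    using schwartzD[OF assms] by (intro conjI allI)
qed

lemma schwartz_has_vderiv: "f \<in> schwartz \<Longrightarrow> (f has_vector_derivative vderiv f x) (at x)"
  unfolding vderiv_def using schwartz_differentiable vector_derivative_works by blast

lemma vderiv_eqI: "(\<And>x. (f has_vector_derivative g x) (at x)) \<Longrightarrow> vderiv f = g"
  unfolding vderiv_def by (auto intro!: vector_derivative_at)

lemma has_vector_derivative_differentiable:
  "(f has_vector_derivative D) (at x) \<Longrightarrow> f differentiable (at x)"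
  using differentiableI_vector by blast

lemma schwartz_add:
  assumes "f \<in> schwartz" "g \<in> schwartz"
  shows "(\<lambda>x. f x + g x) \<in> schwartz"
proof (rule schwartz_coinduct[of _ "{(\<lambda>x. f x + g x) |f g. f \<in> schwartz \<and> g \<in> schwartz}"])
  fix u and j :: nat
  assume "u \<in> {(\<lambda>x. f x + g x) |f g. f \<in> schwartz \<and> g \<in> schwartz}"
  then obtain f g where u: "u = (\<lambda>x. f x + g x)" and fg: "f \<in> schwartz" "g \<in> schwartz"
    by blast
  have d: "(u has_vector_derivative vderiv f x + vderiv g x) (at x)" for x
    unfolding u by (intro has_vector_derivative_add schwartz_has_vderiv fg)
  show "u differentiable (at x)" for x
    by (rule has_vector_derivative_differentiable[OF d])
  show "vderiv u \<in> {(\<lambda>x. f x + g x) |f g. f \<in> schwartz \<and> g \<in> schwartz}"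
    unfolding vderiv_eqI[OF d] mem_Collect_eq
    by (rule exI[of _ "vderiv f"], rule exI[of _ "vderiv g"]) (simp add: fg schwartz_vderiv)
  show "bounded (range (\<lambda>x. x ^ j *\<^sub>R u x))"
    unfolding u scaleR_add_right by (rule bounded_plus_comp[OF fg[THEN schwartz_bounded]])
qed (use assms in auto)

lemma schwartz_cmult:
  assumes "f \<in> schwartz"
  shows "(\<lambda>x. c * f x) \<in> schwartz"
proof (rule schwartz_coinduct[of _ "{(\<lambda>x. c * f x) |f. f \<in> schwartz}"])
  fix u and j :: nat
  assume "u \<in> {(\<lambda>x. c * f x) |f. f \<in> schwartz}"
  then obtain f where u: "u = (\<lambda>x. c * f x)" and f: "f \<in> schwartz"
    by blast
  have d: "(u has_vector_derivative c * vderiv f x) (at x)" for x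
    unfolding u by (intro has_vector_derivative_mult_right schwartz_has_vderiv f)
  show "u differentiable (at x)" for x
    by (rule has_vector_derivative_differentiable[OF d])
  show "vderiv u \<in> {(\<lambda>x. c * f x) |f. f \<in> schwartz}"
    unfolding vderiv_eqI[OF d] mem_Collect_eq
    by (rule exI[of _ "vderiv f"]) (simp add: f schwartz_vderiv)
  obtain B where B: "\<And>x. cmod (x ^ j *\<^sub>R f x) \<le> B"
    using schwartz_bounded[OF f, of j] by (auto simp: bounded_iff)
  show "bounded (range (\<lambda>x. x ^ j *\<^sub>R u x))"
    unfolding bounded_iff
  proof (intro exI[of _ "cmod c * B"] ballI, clarify)
    fix x
    show "cmod (x ^ j *\<^sub>R u x) \<le> cmod c * B"
      using mult_left_mono[OF B[of x], of "cmod c"] by (simp add: u norm_mult mult_ac)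
  qed
qed (use assms in auto)

text \<open>The product rule produces \<open>x f' + f\<close>, which leaves the functions of the
  form \<open>x f\<close>; a second Schwartz summand \<open>g\<close> closes the class.\<close>

lemma schwartz_mult_x:
  assumes "f \<in> schwartz"
  shows "(\<lambda>x. of_real x * f x) \<in> schwartz"
proof (rule schwartz_coinduct[of _ "{(\<lambda>x. of_real x * f x + g x) |f g. f \<in> schwartz \<and> g \<in> schwartz}"])
  have "(\<lambda>x. 0) \<in> schwartz"
    using schwartz_cmult[OF assms, of 0] by simp
  then show "(\<lambda>x. of_real x * f x) \<in> {(\<lambda>x. of_real x * f x + g x) |f g. f \<in> schwartz \<and> g \<in> schwartz}"
    using assms by force
  fix u and j :: nat
  assume "u \<in> {(\<lambda>x. of_real x * f x + g x) |f g. f \<in> schwartz \<and> g \<in> schwartz}"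
  then obtain f g where u: "u = (\<lambda>x. of_real x * f x + g x)" and fg: "f \<in> schwartz" "g \<in> schwartz"
    by blast
  have d: "(u has_vector_derivative (of_real x * vderiv f x + (f x + vderiv g x))) (at x)" for x
    unfolding u
  proof -
    have "((\<lambda>x. complex_of_real x) has_vector_derivative 1) (at x)"
      using has_vector_derivative_of_real[OF DERIV_ident, where 'a=complex] by simp
    from has_vector_derivative_add[OF has_vector_derivative_mult[OF this schwartz_has_vderiv[OF fg(1)]] schwartz_has_vderiv[OF fg(2)]]
    show "((\<lambda>x. of_real x * f x + g x) has_vector_derivative
        (of_real x * vderiv f x + (f x + vderiv g x))) (at x)"
      by (simp add: add_ac)
  qed
  show "u differentiable (at x)" for x
    by (rule has_vector_derivative_differentiable[OF d])
  show "vderiv u \<in> {(\<lambda>x. of_real x * f x + g x) |f g. f \<in> schwartz \<and> g \<in> schwartz}"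
    unfolding vderiv_eqI[OF d] mem_Collect_eq
    by (rule exI[of _ "vderiv f"], rule exI[of _ "\<lambda>x. f x + vderiv g x"])
       (simp add: fg schwartz_vderiv schwartz_add)
  have "(\<lambda>x. x ^ j *\<^sub>R u x) = (\<lambda>x. x ^ Suc j *\<^sub>R f x + x ^ j *\<^sub>R g x)"
    unfolding u scaleR_add_right by (simp only: scaleR_conv_of_real power_Suc2 of_real_mult mult.assoc)
  then show "bounded (range (\<lambda>x. x ^ j *\<^sub>R u x))"
    using bounded_plus_comp[OF schwartz_bounded[OF fg(1), of "Suc j"] schwartz_bounded[OF fg(2), of j]]
    by (simp only:)
qed

lemma schwartz_continuous_on: "f \<in> schwartz \<Longrightarrow> continuous_on S f"
  by (rule differentiable_imp_continuous_on)
     (auto simp: differentiable_on_def intro: differentiable_at_withinI schwartz_differentiable)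

lemma schwartz_borel_measurable: "f \<in> schwartz \<Longrightarrow> f \<in> borel_measurable borel"
  by (rule borel_measurable_continuous_onI[OF schwartz_continuous_on])

section \<open>Quadratic decay as a criterion for integrability\<close>

lemma integrable_inverse_quad: "integrable lborel (\<lambda>x::real. inverse (1 + x\<^sup>2))"
  using integrable_inverse_1_plus_square by (simp add: set_integrable_def)

text \<open>\<open>1 / (1 + x^2)\<close> is the standard majorant: it is integrable, vanishes at
  both ends, and bounds its own convolution square up to a factor
  (\<open>quad_convolution\<close>).\<close>

definition quad_decay :: "(real \<Rightarrow> complex) \<Rightarrow> real \<Rightarrow> bool" where
  "quad_decay f B \<longleftrightarrow> (\<forall>x. cmod (f x) \<le> B * inverse (1 + x\<^sup>2))"

lemma schwartz_quad_decay:
  assumes "f \<in> schwartz"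
  shows "\<exists>B. quad_decay f B"
proof -
  obtain B0 B2 where B: "\<And>x. cmod (f x) \<le> B0" "\<And>x. cmod (x ^ 2 *\<^sub>R f x) \<le> B2"
    using schwartz_bounded[OF assms, of 0] schwartz_bounded[OF assms, of 2]
    by (auto simp: bounded_iff)
  have "cmod (f x) \<le> (B0 + B2) * inverse (1 + x\<^sup>2)" for x
  proof -
    have "(1 + x\<^sup>2) * cmod (f x) \<le> B0 + B2"
      using B(1)[of x] B(2)[of x] by (simp add: algebra_simps)
    moreover have "0 < 1 + x\<^sup>2" by (simp add: add_pos_nonneg)
    ultimately show ?thesis by (simp add: field_simps)
  qed
  then show ?thesis
    unfolding quad_decay_def by blast
qed

lemma quad_decay_integrable:
  assumes "quad_decay f B" and [measurable]: "f \<in> borel_measurable borel"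
  shows "integrable lborel f"
proof (rule Bochner_Integration.integrable_bound)
  show "integrable lborel (\<lambda>x. B * inverse (1 + x\<^sup>2))"
    by (intro integrable_mult_right integrable_inverse_quad)
  show "AE x in lborel. norm (f x) \<le> norm (B * inverse (1 + x\<^sup>2))"
    using assms(1) unfolding quad_decay_def by (smt (verit) AE_I2 real_norm_def)
qed simp

lemma schwartz_integrable: "f \<in> schwartz \<Longrightarrow> integrable lborel f"
  using quad_decay_integrable schwartz_quad_decay schwartz_borel_measurable by blast

section \<open>The Fourier transform of integrable functions\<close>

lemma borel_measurable_cis [measurable]: "cis \<in> borel_measurable borel"
  by (rule borel_measurable_continuous_onI) (rule continuous_on_cis[OF continuous_on_id])

text \<open>\<open>fourier\<close> integrates over the completed measure. This version over
  \<open>lborel\<close> agrees with it on Borel functions, and Fubini applies to it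
  directly.\<close>

definition ft :: "(real \<Rightarrow> complex) \<Rightarrow> real \<Rightarrow> complex" where
  "ft f \<omega> = (LINT t|lborel. cis (t * \<omega>) * f t)"

lemma fourier_eq_ft:
  assumes [measurable]: "f \<in> borel_measurable borel"
  shows "fourier f = ft f"
proof
  fix \<omega>
  have "(\<lambda>t. cis (t * \<omega>) * f t) \<in> borel_measurable lborel"
    by measurable
  then show "fourier f \<omega> = ft f \<omega>"
    unfolding fourier_def ft_def by (rule integral_completion)
qed

lemma integrable_cis_mult:
  assumes "integrable lborel f"
  shows "integrable lborel (\<lambda>t. cis (t * \<omega>) * f t)"
  by (rule Bochner_Integration.integrable_bound[OF assms])
     (use assms in \<open>auto simp: norm_mult\<close>)

lemma ft_measurable [measurable]:
  assumes [measurable]: "f \<in> borel_measurable borel"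
  shows "ft f \<in> borel_measurable borel"
  unfolding ft_def by measurable

lemma norm_ft_le: "cmod (ft f \<omega>) \<le> (LINT t|lborel. cmod (f t))"
  unfolding ft_def by (rule order_trans[OF integral_norm_bound]) (simp add: norm_mult)

text \<open>Fubini for \<open>f x * g t * cis (t * x)\<close>, whose kernel is symmetric in the two
  variables. The distributional transform is defined by duality; this identity connects it with the
  transform of functions.\<close>

lemma ft_multiplication_formula:
  assumes f: "integrable lborel f" and g: "integrable lborel g"
  shows "integrable lborel (\<lambda>x. f x * ft g x)" "integrable lborel (\<lambda>x. ft f x * g x)"
    and "(LINT x|lborel. f x * ft g x) = (LINT x|lborel. ft f x * g x)"
proof -
  have [measurable]: "f \<in> borel_measurable borel" "g \<in> borel_measurable borel"
    using f g by auto
  show "integrable lborel (\<lambda>x. f x * ft g x)" 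
    by (rule Bochner_Integration.integrable_bound[of _ "\<lambda>x. (LINT t|lborel. cmod (g t)) *\<^sub>R f x"])
       (use f norm_ft_le[of g] in \<open>auto simp: norm_mult intro!: AE_I2 intro: order_trans[OF _ abs_ge_self] mult_mono simp: mult.commute\<close>)
  show "integrable lborel (\<lambda>x. ft f x * g x)" 
    by (rule Bochner_Integration.integrable_bound[of _ "\<lambda>x. (LINT t|lborel. cmod (f t)) *\<^sub>R g x"])
       (use g norm_ft_le[of f] in \<open>auto simp: norm_mult intro!: AE_I2 intro: order_trans[OF _ abs_ge_self] mult_mono simp: mult.commute\<close>)
  have fg: "integrable (lborel \<Otimes>\<^sub>M lborel) (\<lambda>(x, t). f x * g t)"
    by (rule lborel_pair.Fubini_integrable)
       (use f g in \<open>auto simp: norm_mult intro!: AE_I2 integrable_mult_left integrable_mult_right\<close>)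
  have "integrable (lborel \<Otimes>\<^sub>M lborel) (\<lambda>(x, t). f x * (cis (t * x) * g t))"
    by (rule Bochner_Integration.integrable_bound[OF fg]) (auto simp: norm_mult)
  from lborel_pair.Fubini_integral[OF this]
  have "(LINT t|lborel. LINT x|lborel. f x * (cis (t * x) * g t)) = (LINT x|lborel. LINT t|lborel. f x * (cis (t * x) * g t))"
    by simp
  also have "(\<lambda>t. LINT x|lborel. f x * (cis (t * x) * g t)) = (\<lambda>t. ft f t * g t)"
    unfolding ft_def by (subst integral_mult_left_zero[symmetric]) (simp add: mult_ac)
  finally show "(LINT x|lborel. f x * ft g x) = (LINT x|lborel. ft f x * g x)"
    by (simp add: ft_def)
qed

section \<open>The Fourier transform\<close>

lemma norm_cis_diff_le: "cmod (cis a - cis b) \<le> \<bar>a - b\<bar>"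
proof -
  have "cis a - cis b = cis b * (cis (a - b) - 1)"
    by (simp add: cis_mult algebra_simps)
  then have "cmod (cis a - cis b) = cmod (cis (a - b) - 1)"
    by (simp add: norm_mult)
  also have "\<dots> \<le> \<bar>a - b\<bar>"
    using iexp_approx1[of "a - b" 0] by (simp add: cis_conv_exp)
  finally show ?thesis .
qed

lemma has_vector_derivative_cis:
  "((\<lambda>t. cis (c * t)) has_vector_derivative \<i> * of_real c * cis (c * t)) (at t)"
proof -
  have "((\<lambda>t. c * t) has_vector_derivative c) (at t)"
    by (auto intro!: derivative_eq_intros simp flip: has_real_derivative_iff_has_vector_derivative)
  moreover have "(cis has_vector_derivative \<i> * cis (c * t)) (at (c * t))"
    using has_vector_derivative_iexp[of "c * t" UNIV] by (simp add: cis_conv_exp[abs_def])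
  ultimately have "((\<lambda>t. cis (c * t)) has_vector_derivative (c *\<^sub>R (\<i> * cis (c * t)))) (at t)"
    using vector_diff_chain_at[of "\<lambda>t. c * t" c t cis "\<i> * cis (c * t)"] by (simp add: comp_def)
  then show ?thesis
    by (simp add: scaleR_conv_of_real mult_ac)
qed

text \<open>Differentiation under the integral sign. \<open>e\<close> is the first-order Taylor
  remainder of \<open>cis (t * y)\<close> at \<open>y = \<omega>\<close>; divided by
  \<open>|y - \<omega>|\<close> it tends to 0 and stays below \<open>2 |t|\<close>, so
  \<open>2 |t f t|\<close> dominates.\<close>

lemma ft_has_vector_derivative:
  assumes f: "integrable lborel f" and tf: "integrable lborel (\<lambda>t. of_real t * f t)"
  shows "(ft f has_vector_derivative ft (\<lambda>t. \<i> * (of_real t * f t)) \<omega>) (at \<omega>)"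
proof -
  define D where "D = ft (\<lambda>t. \<i> * (of_real t * f t)) \<omega>"
  define e where "e y t = cis (t * y) - cis (t * \<omega>) - of_real (y - \<omega>) * (\<i> * of_real t * cis (t * \<omega>))" for y t
  have [measurable]: "f \<in> borel_measurable borel"
    using f by auto
  have e_meas [measurable]: "(\<lambda>t. e y t) \<in> borel_measurable borel" for y
    unfolding e_def by measurable
  have e_le: "cmod (e y t) \<le> 2 * \<bar>t\<bar> * \<bar>y - \<omega>\<bar>" for y t
  proof -
    have "cmod (e y t) \<le> cmod (cis (t * y) - cis (t * \<omega>)) + cmod (of_real (y - \<omega>) * (\<i> * of_real t * cis (t * \<omega>)))"
      unfolding e_def by (rule norm_triangle_ineq4)
    also have "\<dots> \<le> \<bar>t * y - t * \<omega>\<bar> + \<bar>y - \<omega>\<bar> * \<bar>t\<bar>"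
      using norm_cis_diff_le[of "t * y" "t * \<omega>"] by (simp add: norm_mult del: of_real_diff)
    also have "\<bar>t * y - t * \<omega>\<bar> = \<bar>t\<bar> * \<bar>y - \<omega>\<bar>"
      by (simp add: abs_mult[symmetric] right_diff_distrib)
    finally show ?thesis by (simp add: mult_ac)
  qed
  have abs_int: "integrable lborel (\<lambda>t. \<bar>t\<bar> * cmod (f t))"
    using integrable_norm[OF tf] by (simp add: norm_mult)
  have eq: "ft f y - ft f \<omega> - (y - \<omega>) *\<^sub>R D = (LINT t|lborel. e y t * f t)" for y
  proof -
    have "ft f y - ft f \<omega> - (y - \<omega>) *\<^sub>R D =
      (LINT t|lborel. cis (t * y) * f t - cis (t * \<omega>) * f t -
         of_real (y - \<omega>) * (cis (t * \<omega>) * (\<i> * (of_real t * f t))))"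
      unfolding D_def ft_def scaleR_conv_of_real
      by (subst Bochner_Integration.integral_diff Bochner_Integration.integral_mult_right_zero |
          intro Bochner_Integration.integrable_diff integrable_cis_mult integrable_mult_right f tf)+ simp
    also have "\<dots> = (LINT t|lborel. e y t * f t)"
      by (simp add: e_def algebra_simps)
    finally show ?thesis .
  qed
  have "((\<lambda>y. norm (ft f y - ft f \<omega> - (y - \<omega>) *\<^sub>R D) / norm (y - \<omega>)) \<longlongrightarrow> 0) (at \<omega>)"
    unfolding tendsto_at_iff_sequentially
  proof (intro allI impI)
    fix X :: "nat \<Rightarrow> real"
    assume X: "\<forall>i. X i \<in> UNIV - {\<omega>}" "X \<longlonglongrightarrow> \<omega>"
    have "(\<lambda>i. LINT t|lborel. cmod (e (X i) t) / \<bar>X i - \<omega>\<bar> * cmod (f t)) \<longlonglongrightarrow> (LINT t::real|lborel. 0)"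
    proof (rule integral_dominated_convergence)
      show "integrable lborel (\<lambda>t. 2 * (\<bar>t\<bar> * cmod (f t)))"
        by (intro integrable_mult_right abs_int)
      show "AE t in lborel. (\<lambda>i. cmod (e (X i) t) / \<bar>X i - \<omega>\<bar> * cmod (f t)) \<longlonglongrightarrow> 0"
      proof (rule AE_I2)
        fix t :: real
        have "((\<lambda>y. cis (t * y)) has_derivative (\<lambda>h. h *\<^sub>R (\<i> * of_real t * cis (t * \<omega>)))) (at \<omega>)"
          using has_vector_derivative_cis[of t \<omega>] by (simp add: has_vector_derivative_def)
        then have "((\<lambda>y. cmod (e y t) / \<bar>y - \<omega>\<bar>) \<longlongrightarrow> 0) (at \<omega>)"
          by (simp add: has_derivative_iff_norm e_def scaleR_conv_of_real)
        then have "(\<lambda>i. cmod (e (X i) t) / \<bar>X i - \<omega>\<bar>) \<longlonglongrightarrow> 0"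
          unfolding tendsto_at_iff_sequentially comp_def using X by blast
        then show "(\<lambda>i. cmod (e (X i) t) / \<bar>X i - \<omega>\<bar> * cmod (f t)) \<longlonglongrightarrow> 0"
          by (rule tendsto_mult_left_zero)
      qed
      show "AE t in lborel. norm (cmod (e (X i) t) / \<bar>X i - \<omega>\<bar> * cmod (f t)) \<le> 2 * (\<bar>t\<bar> * cmod (f t))" for i
      proof (rule AE_I2)
        fix t
        have "cmod (e (X i) t) / \<bar>X i - \<omega>\<bar> \<le> 2 * \<bar>t\<bar>"
          using e_le[of "X i" t] X(1) by (simp add: divide_le_eq)
        from mult_right_mono[OF this, of "cmod (f t)"]
        show "norm (cmod (e (X i) t) / \<bar>X i - \<omega>\<bar> * cmod (f t)) \<le> 2 * (\<bar>t\<bar> * cmod (f t))"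
          by (simp add: mult_ac)
      qed
    qed simp_all
    then have lim: "(\<lambda>i. LINT t|lborel. cmod (e (X i) t) / \<bar>X i - \<omega>\<bar> * cmod (f t)) \<longlonglongrightarrow> 0"
      by simp
    show "((\<lambda>y. norm (ft f y - ft f \<omega> - (y - \<omega>) *\<^sub>R D) / norm (y - \<omega>)) \<circ> X) \<longlonglongrightarrow> 0"
      unfolding comp_def
    proof (rule Lim_null_comparison[OF always_eventually lim], rule allI)
      fix i
      have "norm (LINT t|lborel. e (X i) t * f t) \<le> (LINT t|lborel. cmod (e (X i) t) * cmod (f t))"
        using integral_norm_bound[of lborel "\<lambda>t. e (X i) t * f t"] by (simp add: norm_mult)
      then have "norm (LINT t|lborel. e (X i) t * f t) / \<bar>X i - \<omega>\<bar>
          \<le> (LINT t|lborel. cmod (e (X i) t) * cmod (f t)) / \<bar>X i - \<omega>\<bar>"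
        by (intro divide_right_mono) auto
      also have "\<dots> = (LINT t|lborel. cmod (e (X i) t) / \<bar>X i - \<omega>\<bar> * cmod (f t))"
        by (subst integral_divide_zero[symmetric]) simp
      finally show "norm (norm (ft f (X i) - ft f \<omega> - (X i - \<omega>) *\<^sub>R D) / norm (X i - \<omega>))
          \<le> (LINT t|lborel. cmod (e (X i) t) / \<bar>X i - \<omega>\<bar> * cmod (f t))"
        unfolding eq by simp
    qed
  qed
  then show ?thesis
    unfolding has_vector_derivative_def has_derivative_iff_norm D_def
    by (simp add: bounded_linear_scaleR_left)
qed

lemma quad_decay_tendsto_0:
  assumes "quad_decay f B"
  shows "(f \<longlongrightarrow> 0) at_top" "(f \<longlongrightarrow> 0) at_bot"
proof -
  have *: "eventually (\<lambda>x. norm (f x) \<le> B * inverse (1 + x\<^sup>2)) F" for F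
    using assms by (simp add: quad_decay_def)
  have "((\<lambda>x::real. B * inverse (1 + x\<^sup>2)) \<longlongrightarrow> 0) at_top"
    by real_asymp
  from Lim_null_comparison[OF * this] show "(f \<longlongrightarrow> 0) at_top" .
  have "((\<lambda>x::real. B * inverse (1 + x\<^sup>2)) \<longlongrightarrow> 0) at_bot"
    by real_asymp
  from Lim_null_comparison[OF * this] show "(f \<longlongrightarrow> 0) at_bot" .
qed

text \<open>The integrand \<open>?f\<close> is the exact derivative of
  \<open>cis (t * \<omega>) * g t\<close>, which vanishes at both ends, so its integral is 0. The
  minus sign reflects the convention \<open>e^(i t \<omega>)\<close>.\<close>

lemma ft_vderiv:
  assumes "g \<in> schwartz"
  shows "ft (vderiv g) \<omega> = - \<i> * of_real \<omega> * ft g \<omega>"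
proof -
  let ?F = "\<lambda>t. cis (t * \<omega>) * g t"
  let ?f = "\<lambda>t. cis (t * \<omega>) * vderiv g t + \<i> * of_real \<omega> * (cis (t * \<omega>) * g t)"
  note g' = schwartz_vderiv[OF assms]
  have int: "integrable lborel ?f"
    by (intro Bochner_Integration.integrable_add integrable_mult_right integrable_cis_mult
        schwartz_integrable assms g')
  obtain B where "quad_decay g B"
    using schwartz_quad_decay[OF assms] by blast
  then have "quad_decay ?F B"
    by (simp add: quad_decay_def norm_mult)
  note lim = quad_decay_tendsto_0[OF this]
  have "(LBINT t=-\<infinity>..\<infinity>. ?f t) = 0 - 0"
  proof (rule interval_integral_FTC_integrable)
    fix t
    have "((\<lambda>t. cis (t * \<omega>)) has_vector_derivative \<i> * of_real \<omega> * cis (t * \<omega>)) (at t)"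
      using has_vector_derivative_cis[of \<omega> t] by (simp add: mult.commute[of \<omega>])
    from has_vector_derivative_mult[OF this schwartz_has_vderiv[OF assms]]
    show "(?F has_vector_derivative ?f t) (at t)"
      by (simp add: mult.assoc)
    have "continuous_on UNIV ?f"
      by (intro continuous_intros schwartz_continuous_on assms g')
    then show "isCont ?f t"
      by (simp add: continuous_on_eq_continuous_at)
  next
    show "set_integrable lborel (einterval (- \<infinity>) \<infinity>) ?f"
      using int by (simp add: set_integrable_def)
    show "((?F \<circ> real_of_ereal) \<longlongrightarrow> 0) (at_right (- \<infinity>))" "((?F \<circ> real_of_ereal) \<longlongrightarrow> 0) (at_left \<infinity>)"
      unfolding ereal_tendsto_simps using lim by auto
  qed simp
  then have "(LINT t|lborel. ?f t) = 0"
    by (simp add: interval_lebesgue_integral_def set_lebesgue_integral_def)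
  then have "ft (vderiv g) \<omega> + \<i> * of_real \<omega> * ft g \<omega> = 0"
    unfolding ft_def
    by (subst (asm) Bochner_Integration.integral_add)
       (simp_all add: integrable_cis_mult schwartz_integrable assms g')
  then show ?thesis
    by (simp add: eq_neg_iff_add_eq_0)
qed

lemma ft_cmult: "ft (\<lambda>t. c * f t) \<omega> = c * ft f \<omega>"
proof -
  have "ft (\<lambda>t. c * f t) \<omega> = (LINT t|lborel. c * (cis (t * \<omega>) * f t))"
    unfolding ft_def by (simp add: mult_ac)
  then show ?thesis
    by (simp add: ft_def)
qed

text \<open>Differentiating the transform multiplies the argument by \<open>\<i> t\<close>, which
  stays in the class. Decay is gained by induction on the power: one factor \<open>x\<close> in
  front of the transform is traded for a derivative under it.\<close>

lemma ft_schwartz: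
  assumes "f \<in> schwartz"
  shows "ft f \<in> schwartz"
proof (rule schwartz_coinduct[of _ "ft ` schwartz"])
  fix u and j :: nat assume "u \<in> ft ` schwartz"
  then obtain g where u: "u = ft g" and g: "g \<in> schwartz" by blast
  have d: "(u has_vector_derivative ft (\<lambda>t. \<i> * (of_real t * g t)) x) (at x)" for x
    unfolding u by (intro ft_has_vector_derivative schwartz_integrable schwartz_mult_x g)
  show "u differentiable (at x)" for x
    by (rule has_vector_derivative_differentiable[OF d])
  show "vderiv u \<in> ft ` schwartz"
    unfolding vderiv_eqI[OF d] by (intro imageI schwartz_cmult schwartz_mult_x g)
  have "\<exists>B. \<forall>x. cmod (x ^ j *\<^sub>R ft g x) \<le> B" if "g \<in> schwartz" for g
    using that
  proof (induction j arbitrary: g)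
    case 0
    then show ?case
      using norm_ft_le[of g] by auto
  next
    case (Suc j)
    have "\<i> * (- \<i> * of_real x * ft g x) = x *\<^sub>R ft g x" for x
      by (simp add: scaleR_conv_of_real mult.assoc[symmetric])
    then have "x ^ Suc j *\<^sub>R ft g x = x ^ j *\<^sub>R ft (\<lambda>t. \<i> * vderiv g t) x" for x
      unfolding ft_cmult ft_vderiv[OF Suc.prems] by (simp add: mult.commute)
    then show ?case
      using Suc.IH[OF schwartz_cmult[OF schwartz_vderiv[OF Suc.prems]]] by simp
  qed
  then show "bounded (range (\<lambda>x. x ^ j *\<^sub>R u x))"
    unfolding bounded_iff u using g by blast
qed (use assms in auto)

lemma fourier_schwartz: "f \<in> schwartz \<Longrightarrow> fourier f = ft f" "f \<in> schwartz \<Longrightarrow> fourier f \<in> schwartz"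
  by (simp_all add: fourier_eq_ft schwartz_borel_measurable ft_schwartz)

subsection \<open>Gaussian test functions\<close>

text \<open>Centre \<open>h\<close> and frequency \<open>c\<close>: the transform exchanges
  translation and modulation, so in the cases needed it stays in this family up to the factor
  \<open>sqrt (2 pi)\<close>.\<close>

definition gaussian :: "real \<Rightarrow> real \<Rightarrow> real \<Rightarrow> complex" where
  "gaussian h c x = of_real (exp (- (x - h)\<^sup>2 / 2)) * cis (c * x)"

lemma gaussian_measurable [measurable]: "gaussian h c \<in> borel_measurable borel"
  unfolding gaussian_def by measurable

lemma gaussian_has_vector_derivative:
  "(gaussian h c has_vector_derivative (of_real (h - x) + \<i> * of_real c) * gaussian h c x) (at x)"
proof -
  have "((\<lambda>x. exp (- (x - h)\<^sup>2 / 2)) has_real_derivative (h - x) * exp (- (x - h)\<^sup>2 / 2)) (at x)"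
    by (auto intro!: derivative_eq_intros simp: field_simps)
  from has_vector_derivative_mult[OF has_vector_derivative_of_real[OF this] has_vector_derivative_cis[of c x]]
  show ?thesis
    unfolding gaussian_def by (simp add: algebra_simps)
qed

lemma power_le_fact_exp:
  assumes "0 \<le> (y::real)"
  shows "y ^ n \<le> fact n * exp y"
proof -
  have "(\<Sum>i\<in>{n}. y ^ i /\<^sub>R fact i) \<le> (\<Sum>i. y ^ i /\<^sub>R fact i)"
    by (rule sum_le_suminf[OF summable_exp_generic]) (use assms in auto)
  then have "y ^ n /\<^sub>R fact n \<le> exp y"
    by (simp add: exp_def)
  then show ?thesis
    by (simp add: field_simps)
qed

text \<open>Completing the square bounds the shifted Gaussian by
  \<open>exp (h^2 / 2) exp (- x^2 / 4)\<close>, and the exponential series at \<open>x^2 / 4\<close>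
  absorbs the power. Passing from exponent \<open>n\<close> to \<open>2 n\<close> makes it a power
  of \<open>x^2\<close>.\<close>

lemma power_mult_exp_bounded: "\<exists>B. \<forall>x. \<bar>x\<bar> ^ n * exp (- (x - h)\<^sup>2 / 2) \<le> (B::real)"
proof -
  have b: "\<bar>x\<bar> ^ n * exp (- (x - h)\<^sup>2 / 2) \<le> exp (h\<^sup>2 / 2) * (1 + 4 ^ n * fact n)" for x :: real
  proof -
    have 1: "exp (- (x - h)\<^sup>2 / 2) \<le> exp (h\<^sup>2 / 2) * exp (- (x\<^sup>2 / 4))"
    proof -
      have "0 \<le> (x - 2 * h)\<^sup>2" by simp
      then have "- (x - h)\<^sup>2 / 2 \<le> h\<^sup>2 / 2 + - (x\<^sup>2 / 4)"
        by (simp add: power2_eq_square field_simps)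
      then show ?thesis
        unfolding exp_add[symmetric] by simp
    qed
    have "(x\<^sup>2 / 4) ^ n \<le> fact n * exp (x\<^sup>2 / 4)"
      by (rule power_le_fact_exp) simp
    then have "(x\<^sup>2) ^ n \<le> 4 ^ n * fact n * exp (x\<^sup>2 / 4)"
      by (simp add: power_divide field_simps)
    moreover have "\<bar>x\<bar> ^ (2 * n) = (x\<^sup>2) ^ n"
      by (simp add: power_mult)
    ultimately have "\<bar>x\<bar> ^ (2 * n) \<le> 4 ^ n * fact n * exp (x\<^sup>2 / 4)"
      by simp
    moreover have "\<bar>x\<bar> ^ n \<le> 1 + \<bar>x\<bar> ^ (2 * n)"
    proof (cases "\<bar>x\<bar> \<le> 1")
      case True
      then show ?thesis by (simp add: power_le_one add_increasing2)
    next
      case False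
      then have "\<bar>x\<bar> ^ n \<le> \<bar>x\<bar> ^ (2 * n)" by (intro power_increasing) auto
      then show ?thesis by simp
    qed
    moreover have "1 \<le> exp (x\<^sup>2 / 4)" by simp
    ultimately have "\<bar>x\<bar> ^ n \<le> (1 + 4 ^ n * fact n) * exp (x\<^sup>2 / 4)"
      unfolding distrib_right mult_1 by linarith
    then have "\<bar>x\<bar> ^ n * exp (- (x\<^sup>2 / 4)) \<le> 1 + 4 ^ n * fact n"
      by (simp add: exp_minus field_simps)
    then have "exp (h\<^sup>2 / 2) * (\<bar>x\<bar> ^ n * exp (- (x\<^sup>2 / 4))) \<le> exp (h\<^sup>2 / 2) * (1 + 4 ^ n * fact n)"
      by (intro mult_left_mono) auto
    moreover have "\<bar>x\<bar> ^ n * exp (- (x - h)\<^sup>2 / 2) \<le> \<bar>x\<bar> ^ n * (exp (h\<^sup>2 / 2) * exp (- (x\<^sup>2 / 4)))"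
      by (intro mult_left_mono 1) auto
    ultimately show ?thesis by (simp only: mult.left_commute[of "\<bar>x\<bar> ^ n"])
  qed
  then show ?thesis by blast
qed

lemma norm_gaussian: "cmod (gaussian h c x) = exp (- (x - h)\<^sup>2 / 2)"
  by (simp add: gaussian_def norm_mult)

lemma poly_gaussian_bounded: "\<exists>B. \<forall>x. cmod (x ^ j *\<^sub>R (poly p (of_real x) * gaussian h c x)) \<le> B"
proof (induction p arbitrary: j)
  case 0
  then show ?case by auto
next
  case (pCons a p)
  obtain B1 where B1: "\<And>x. cmod (x ^ Suc j *\<^sub>R (poly p (of_real x) * gaussian h c x)) \<le> B1"
    using pCons.IH[of "Suc j"] by blast
  obtain B2 where B2: "\<And>x. \<bar>x\<bar> ^ j * exp (- (x - h)\<^sup>2 / 2) \<le> B2"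
    using power_mult_exp_bounded by blast
  have "cmod (x ^ j *\<^sub>R (poly (pCons a p) (of_real x) * gaussian h c x)) \<le> cmod a * B2 + B1" for x
  proof -
    have eq: "x ^ j *\<^sub>R (poly (pCons a p) (of_real x) * gaussian h c x) =
        x ^ j *\<^sub>R (a * gaussian h c x) + x ^ Suc j *\<^sub>R (poly p (of_real x) * gaussian h c x)"
      by (simp add: scaleR_conv_of_real distrib_left distrib_right mult_ac)
    have "cmod (x ^ j *\<^sub>R (a * gaussian h c x)) = cmod a * (\<bar>x\<bar> ^ j * exp (- (x - h)\<^sup>2 / 2))"
      by (simp add: norm_mult norm_gaussian norm_power power_abs)
    also have "\<dots> \<le> cmod a * B2"
      by (intro mult_left_mono B2) auto
    finally show ?thesis
      unfolding eq using B1[of x] norm_triangle_ineq order_trans add_mono by (meson)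
  qed
  then show ?case by blast
qed

lemma gaussian_schwartz: "gaussian h c \<in> schwartz"
proof (rule schwartz_coinduct[of _ "range (\<lambda>p x. poly p (of_real x) * gaussian h c x)"])
  show "gaussian h c \<in> range (\<lambda>p x. poly p (of_real x) * gaussian h c x)"
    by (rule range_eqI[of _ _ 1]) simp
  fix u and j :: nat assume "u \<in> range (\<lambda>p x. poly p (of_real x) * gaussian h c x)"
  then obtain p where u: "u = (\<lambda>x. poly p (of_real x) * gaussian h c x)" by blast
  \<comment> \<open>The linear factor \<open>h + \<i> c - x\<close> is the logarithmic derivative of
    the Gaussian.\<close>
  let ?q = "pderiv p + p * [:of_real h + \<i> * of_real c, -1:]"
  have d: "(u has_vector_derivative (poly ?q (of_real x) * gaussian h c x)) (at x)" for x
  proof -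
    have "((\<lambda>x. poly p (complex_of_real x)) has_vector_derivative poly (pderiv p) (of_real x)) (at x)"
      by (rule has_vector_derivative_real_field) (rule poly_DERIV)
    from has_vector_derivative_mult[OF this gaussian_has_vector_derivative[of h c x]]
    show ?thesis
      unfolding u by (simp add: algebra_simps)
  qed
  show "u differentiable (at x)" for x
    by (rule has_vector_derivative_differentiable[OF d])
  show "vderiv u \<in> range (\<lambda>p x. poly p (of_real x) * gaussian h c x)"
    unfolding vderiv_eqI[OF d] by (rule rangeI)
  show "bounded (range (\<lambda>x. x ^ j *\<^sub>R u x))"
    unfolding bounded_iff u using poly_gaussian_bounded by simp
qed

text \<open>Up to the factor \<open>sqrt (2 pi)\<close> this is the characteristic function of the
  standard normal distribution.\<close>

lemma ft_gaussian_0: "ft (gaussian 0 0) \<omega> = of_real (sqrt (2 * pi) * exp (- \<omega>\<^sup>2 / 2))"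
proof -
  have "complex_of_real (exp (- \<omega>\<^sup>2 / 2)) = (LINT x|std_normal_distribution. iexp (\<omega> * x))"
    using fun_cong[OF char_std_normal_distribution, of \<omega>] by (simp add: char_def)
  also have "\<dots> = (LINT x|lborel. std_normal_density x *\<^sub>R iexp (\<omega> * x))"
    by (subst integral_density) auto
  also have "\<dots> = (LINT x|lborel. of_real (1 / sqrt (2 * pi)) * (cis (x * \<omega>) * gaussian 0 0 x))"
    by (intro Bochner_Integration.integral_cong)
       (auto simp: gaussian_def std_normal_density_def cis_conv_exp scaleR_conv_of_real mult_ac)
  also have "\<dots> = of_real (1 / sqrt (2 * pi)) * ft (gaussian 0 0) \<omega>"
    by (simp add: ft_def)
  finally show ?thesis
    by (simp add: field_simps)
qed

lemma ft_gaussian_shift: "ft (gaussian h 0) \<omega> = of_real (sqrt (2 * pi)) * gaussian 0 h \<omega>"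
proof -
  have "ft (gaussian h 0) \<omega> = (LINT t|lborel. cis ((h + 1 * t) * \<omega>) * gaussian h 0 (h + 1 * t))"
    unfolding ft_def by (subst lborel_integral_real_affine[of 1 _ h]) auto
  also have "\<dots> = (LINT t|lborel. cis (h * \<omega>) * (cis (t * \<omega>) * gaussian 0 0 t))"
    by (simp add: gaussian_def cis_mult distrib_right mult.assoc[symmetric])
  also have "\<dots> = cis (h * \<omega>) * ft (gaussian 0 0) \<omega>"
    by (simp add: ft_def)
  finally show ?thesis
    by (simp add: ft_gaussian_0 gaussian_def mult_ac)
qed

lemma ft_gaussian_modulated: "ft (gaussian 0 c) x = of_real (sqrt (2 * pi)) * gaussian (- c) 0 x"
proof -
  have "ft (gaussian 0 c) x = ft (gaussian 0 0) (x + c)"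
    unfolding ft_def
    by (intro Bochner_Integration.integral_cong) (auto simp: gaussian_def cis_mult algebra_simps)
  then show ?thesis
    by (simp add: ft_gaussian_0 gaussian_def)
qed

subsection \<open>Bounded functions as tempered distributions\<close>

lemma schwartz_seminorm_ge: "f \<in> schwartz \<Longrightarrow> norm (x ^ j *\<^sub>R (vderiv ^^ k) f x) \<le> schwartz_seminorm j k f"
  unfolding schwartz_seminorm_def
  by (rule cSUP_upper) (use schwartzD(2)[of f j k] in \<open>auto simp: bounded_iff bdd_above_def\<close>)

lemma schwartz_seminorm_nonneg: "f \<in> schwartz \<Longrightarrow> 0 \<le> schwartz_seminorm j k f"
  using schwartz_seminorm_ge norm_ge_zero order_trans by blast

lemma integrable_bounded_mult_schwartz:
  assumes [measurable]: "f \<in> borel_measurable borel" and B: "\<And>x. cmod (f x) \<le> B" and "\<phi> \<in> schwartz"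
  shows "integrable lborel (\<lambda>x. f x * \<phi> x)"
proof (rule Bochner_Integration.integrable_bound)
  note [measurable] = schwartz_borel_measurable[OF assms(3)]
  show "(\<lambda>x. f x * \<phi> x) \<in> borel_measurable lborel" by measurable
  show "integrable lborel (\<lambda>x. of_real B * \<phi> x)"
    by (intro integrable_mult_right schwartz_integrable assms)
  show "AE x in lborel. norm (f x * \<phi> x) \<le> norm (of_real B * \<phi> x)"
    using order_trans[OF B abs_ge_self] by (auto simp: norm_mult intro!: mult_right_mono)
qed

lemma fun_dist_eq:
  assumes [measurable]: "f \<in> borel_measurable borel" and "\<phi> \<in> schwartz"
  shows "fun_dist f \<phi> = (LINT x|lborel. f x * \<phi> x)"
proof -
  note [measurable] = schwartz_borel_measurable[OF assms(2)]
  have "(\<lambda>x. f x * \<phi> x) \<in> borel_measurable lborel" by measurable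
  then show ?thesis
    using assms(2) by (simp add: fun_dist_def integral_completion)
qed

lemma fun_dist_tempered:
  assumes [measurable]: "f \<in> borel_measurable borel" and B: "\<And>x. cmod (f x) \<le> B"
  shows "fun_dist f \<in> tempered"
  unfolding tempered_def
proof (intro CollectI conjI ballI allI)
  show "fun_dist f \<in> extensional schwartz"
    by (simp add: fun_dist_def)
  note int = integrable_bounded_mult_schwartz[OF assms]
  show "fun_dist f (\<lambda>x. a * \<phi> x + b * \<psi> x) = a * fun_dist f \<phi> + b * fun_dist f \<psi>"
    if "\<phi> \<in> schwartz" "\<psi> \<in> schwartz" for \<phi> \<psi> a b
  proof -
    have "fun_dist f (\<lambda>x. a * \<phi> x + b * \<psi> x) = (LINT x|lborel. a * (f x * \<phi> x) + b * (f x * \<psi> x))"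
      by (simp add: fun_dist_eq schwartz_add schwartz_cmult that algebra_simps)
    then show ?thesis
      using int that by (simp add: fun_dist_eq)
  qed
  \<comment> \<open>The mass of the majorant. The seminorms with \<open>j = 0\<close> and
    \<open>j = 2\<close>, \<open>k = 0\<close>, bound \<open>(1 + x^2) |\<phi> x|\<close>, hence the
    order 2 below.\<close>
  let ?J = "LINT x::real|lborel. inverse (1 + x\<^sup>2)"
  show "schwartz_dominated (\<lambda>\<phi>. cmod (fun_dist f \<phi>))"
    unfolding schwartz_dominated_def
  proof (intro exI[of _ "B * ?J"] exI[of _ 2] ballI)
    fix \<phi> assume \<phi>: "\<phi> \<in> schwartz"
    let ?S = "schwartz_seminorm 0 0 \<phi> + schwartz_seminorm 2 0 \<phi>"
    have B0: "0 \<le> B" using B[of 0] norm_ge_zero order_trans by blast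
    have J0: "0 \<le> ?J" by (rule Bochner_Integration.integral_nonneg) simp
    have "cmod (f x * \<phi> x) \<le> B * ?S * inverse (1 + x\<^sup>2)" for x
    proof -
      have "(1 + x\<^sup>2) * cmod (\<phi> x) \<le> ?S"
        using schwartz_seminorm_ge[OF \<phi>, of x 0 0] schwartz_seminorm_ge[OF \<phi>, of x 2 0]
        by (simp add: algebra_simps)
      moreover have "0 < 1 + x\<^sup>2" by (simp add: add_pos_nonneg)
      ultimately have "cmod (\<phi> x) \<le> ?S * inverse (1 + x\<^sup>2)" by (simp add: field_simps)
      from mult_mono[OF B this B0 norm_ge_zero] show ?thesis
        by (simp add: norm_mult mult.assoc)
    qed
    then have "cmod (fun_dist f \<phi>) \<le> (LINT x|lborel. B * ?S * inverse (1 + x\<^sup>2))"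
      unfolding fun_dist_eq[OF assms(1) \<phi>]
      by (intro order_trans[OF integral_norm_bound] integral_mono integrable_norm int \<phi>
          integrable_mult_right integrable_inverse_quad)
    also have "\<dots> = B * ?J * ?S" by simp
    also have "\<dots> \<le> B * ?J * (\<Sum>j\<le>2. \<Sum>k\<le>2. schwartz_seminorm j k \<phi>)"
    proof (intro mult_left_mono mult_nonneg_nonneg B0 J0)
      show "?S \<le> (\<Sum>j\<le>2. \<Sum>k\<le>2. schwartz_seminorm j k \<phi>)"
        using schwartz_seminorm_nonneg[OF \<phi>]
        by (simp add: eval_nat_numeral add_nonneg_nonneg algebra_simps)
    qed
    finally show "cmod (fun_dist f \<phi>) \<le> B * ?J * (\<Sum>j\<le>2. \<Sum>k\<le>2. schwartz_seminorm j k \<phi>)" .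
  qed
qed

lemma represented_by_fourier_iff:
  assumes "f \<in> borel_measurable borel"
  shows "represented_by (dist_fourier (fun_dist f)) h \<longleftrightarrow> h \<in> borel_measurable borel \<and>
     (\<forall>\<phi>\<in>schwartz. integrable lborel (\<lambda>x. h x * \<phi> x) \<and>
        (LINT x|lborel. f x * ft \<phi> x) = (LINT x|lborel. h x * \<phi> x))"
  using assms by (auto simp: represented_by_def dist_fourier_def fourier_schwartz ft_schwartz fun_dist_eq)

lemma represented_by_ft:
  assumes f: "integrable lborel f"
  shows "represented_by (dist_fourier (fun_dist f)) (ft f)"
proof -
  have [measurable]: "f \<in> borel_measurable borel"
    using f by auto
  show ?thesis
    using ft_multiplication_formula[OF f schwartz_integrable]
    by (auto simp: represented_by_fourier_iff)
qed

subsection \<open>Uniqueness of the Fourier transform\<close>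

lemma nn_integral_eq_integral_real:
  fixes p :: "'a \<Rightarrow> real"
  assumes "integrable M p" "\<And>x. 0 \<le> p x"
  shows "(\<integral>\<^sup>+x. ennreal (p x) \<partial>M) = ennreal (LINT x|M. p x)"
  using assms by (intro nn_integral_eq_integral) auto

text \<open>Divided by the common mass, both sides are probability measures with the same
  characteristic function, so Levy's theorem applies. The reference measures may be infinite; only
  the weighted ones have to be finite.\<close>

lemma density_eqI_char:
  fixes p q :: "real \<Rightarrow> real" and \<mu> \<nu> :: "real measure"
  assumes \<mu>: "sets \<mu> = sets borel" and \<nu>: "sets \<nu> = sets borel"
    and p: "integrable \<mu> p" "\<And>x. 0 \<le> p x" and q: "integrable \<nu> q" "\<And>x. 0 \<le> q x"
    and eq: "\<And>t. (LINT x|\<mu>. of_real (p x) * cis (t * x)) = (LINT x|\<nu>. of_real (q x) * cis (t * x))"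
  shows "density \<mu> (\<lambda>x. ennreal (p x)) = density \<nu> (\<lambda>x. ennreal (q x))"
proof -
  note [measurable_cong] = \<mu> \<nu>
  have [measurable]: "p \<in> borel_measurable \<mu>" "q \<in> borel_measurable \<nu>"
    using p(1) q(1) by auto
  have [measurable]: "p \<in> borel_measurable borel" "q \<in> borel_measurable borel"
    using p(1) q(1) measurable_cong_sets[OF \<mu> refl] measurable_cong_sets[OF \<nu> refl] by blast+
  define Z where "Z = (LINT x|\<mu>. p x)"
  \<comment> \<open>The characteristic functions at 0 are the total masses.\<close>
  have "complex_of_real (LINT x|\<mu>. p x) = complex_of_real (LINT x|\<nu>. q x)"
    using eq[of 0] by simp
  then have Z: "Z = (LINT x|\<nu>. q x)"
    by (simp add: Z_def)
  have "0 \<le> Z"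
    unfolding Z_def by (rule Bochner_Integration.integral_nonneg) (rule p)
  then consider "Z = 0" | "0 < Z" by linarith
  then show ?thesis
  proof cases
    case 1
    \<comment> \<open>Without mass nothing can be normalised, but then both weights vanish almost
      everywhere.\<close>
    have "AE x in \<mu>. p x = 0" "AE x in \<nu>. q x = 0"
      using integral_nonneg_eq_0_iff_AE[OF p(1)] integral_nonneg_eq_0_iff_AE[OF q(1)] p(2) q(2) 1 Z Z_def by auto
    then have "AE x in \<mu>. ennreal (p x) * indicator A x = 0" "AE x in \<nu>. ennreal (q x) * indicator A x = 0" for A
      by (auto elim: AE_mp)
    then have "(\<integral>\<^sup>+x\<in>A. ennreal (p x) \<partial>\<mu>) = (\<integral>\<^sup>+x\<in>A. ennreal (q x) \<partial>\<nu>)" for A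
      by (simp only: nn_integral_cong_AE[of "\<lambda>x. ennreal (p x) * indicator A x" "\<lambda>_. 0" \<mu>]
          nn_integral_cong_AE[of "\<lambda>x. ennreal (q x) * indicator A x" "\<lambda>_. 0" \<nu>] nn_integral_const mult_zero_left)
    then show ?thesis
      by (intro measure_eqI) (auto simp: \<mu> \<nu> emeasure_density)
  next
    case 2
    have dist: "real_distribution (density M (\<lambda>x. ennreal (r x / Z)))"
      if M: "sets M = sets borel" and r: "integrable M r" "\<And>x. 0 \<le> r x" and I: "Z = (LINT x|M. r x)" for M r
    proof -
      have [measurable]: "r \<in> borel_measurable M" using r by auto
      have "emeasure (density M (\<lambda>x. ennreal (r x / Z))) (space (density M (\<lambda>x. ennreal (r x / Z))))
          = (\<integral>\<^sup>+x. ennreal (r x / Z) \<partial>M)"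
        by (simp add: emeasure_density cong: nn_integral_cong)
      also have "\<dots> = ennreal (LINT x|M. r x / Z)"
        using r 2 by (intro nn_integral_eq_integral_real) auto
      also have "\<dots> = 1"
        using I 2 by simp
      finally show ?thesis
        unfolding real_distribution_def real_distribution_axioms_def
        using M by (auto intro!: prob_spaceI simp: sets_eq_imp_space_eq[OF M])
    qed
    have char: "char (density M (\<lambda>x. ennreal (r x / Z))) t = (LINT x|M. of_real (r x) * cis (t * x)) / of_real Z"
      if M: "sets M = sets borel" and r: "integrable M r" "\<And>x. 0 \<le> r x" for M r t
    proof -
      note [measurable_cong] = M
      have [measurable]: "r \<in> borel_measurable M" using r by auto
      have "char (density M (\<lambda>x. ennreal (r x / Z))) t = (LINT x|M. (r x / Z) *\<^sub>R iexp (t * x))"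
        unfolding char_def using r 2 by (subst integral_density) auto
      also have "\<dots> = (LINT x|M. (of_real (r x) * cis (t * x)) / of_real Z)"
        by (simp add: cis_conv_exp scaleR_conv_of_real)
      finally show ?thesis by simp
    qed
    have "density \<mu> (\<lambda>x. ennreal (p x / Z)) = density \<nu> (\<lambda>x. ennreal (q x / Z))"
      by (rule Levy_uniqueness[OF dist[OF \<mu> p Z_def] dist[OF \<nu> q Z]])
         (simp add: fun_eq_iff char[OF \<mu> p] char[OF \<nu> q] eq)
    then have "density (density \<mu> (\<lambda>x. ennreal (p x / Z))) (\<lambda>_. ennreal Z)
        = density (density \<nu> (\<lambda>x. ennreal (q x / Z))) (\<lambda>_. ennreal Z)"
      by simp
    then show ?thesis
      using 2 p(2) q(2) by (simp add: density_density_eq ennreal_mult[symmetric])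
  qed
qed

text \<open>The positive and negative parts of \<open>v\<close> have the same characteristic
  function, hence define the same measure, and their densities agree almost everywhere.\<close>

lemma real_ft_eq_0:
  fixes v :: "real \<Rightarrow> real"
  assumes v: "integrable lborel v" and 0: "\<And>\<omega>. ft (\<lambda>t. of_real (v t)) \<omega> = 0"
  shows "AE x in lborel. v x = 0"
proof -
  have [measurable]: "v \<in> borel_measurable borel" using v by auto
  have p: "integrable lborel (\<lambda>x. max (v x) 0)" and q: "integrable lborel (\<lambda>x. max (- v x) 0)"
    using v by auto
  have "density lborel (\<lambda>x. ennreal (max (v x) 0)) = density lborel (\<lambda>x. ennreal (max (- v x) 0))"
  proof (rule density_eqI_char)
    fix t
    have ip: "integrable lborel (\<lambda>x. complex_of_real (max (v x) 0) * cis (t * x))"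
      and iq: "integrable lborel (\<lambda>x. complex_of_real (max (- v x) 0) * cis (t * x))"
      using integrable_cis_mult[OF integrable_of_real[OF p, where 'a=complex], of t]
        integrable_cis_mult[OF integrable_of_real[OF q, where 'a=complex], of t]
      by (simp_all add: mult.commute)
    have "(LINT x|lborel. complex_of_real (max (v x) 0) * cis (t * x)) - (LINT x|lborel. complex_of_real (max (- v x) 0) * cis (t * x))
      = (LINT x|lborel. cis (x * t) * of_real (v x))"
      by (subst Bochner_Integration.integral_diff[OF ip iq, symmetric])
         (auto intro!: Bochner_Integration.integral_cong simp: max_def mult.commute)
    then show "(LINT x|lborel. complex_of_real (max (v x) 0) * cis (t * x)) = (LINT x|lborel. complex_of_real (max (- v x) 0) * cis (t * x))"
      using 0[of t] by (simp add: ft_def)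
  qed (use p q in auto)
  then have "AE x in lborel. ennreal (max (v x) 0) = ennreal (max (- v x) 0)"
    by (subst sigma_finite_measure.density_unique_iff[OF lborel.sigma_finite_measure_axioms, symmetric]) auto
  then show ?thesis
    by eventually_elim (auto simp: max_def split: if_splits)
qed

text \<open>The transform of \<open>cnj u\<close> is the conjugate of that of \<open>u\<close> at
  \<open>- \<omega>\<close> and vanishes as well, which separates the real part of \<open>u\<close>
  from the imaginary one.\<close>

lemma ft_eq_0:
  assumes u: "integrable lborel u" and 0: "\<And>\<omega>. ft u \<omega> = 0"
  shows "AE x in lborel. u x = 0"
proof -
  have c: "ft (\<lambda>t. cnj (u t)) \<omega> = 0" for \<omega>
  proof -
    have "ft (\<lambda>t. cnj (u t)) \<omega> = (LINT t|lborel. cnj (cis (t * (- \<omega>)) * u t))"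
      unfolding ft_def by (simp add: cis_cnj)
    also have "\<dots> = cnj (ft u (- \<omega>))"
      unfolding ft_def by (rule Bochner_Integration.integral_cnj)
    finally show ?thesis by (simp add: 0)
  qed
  have i: "integrable lborel (\<lambda>t. cis (t * \<omega>) * u t)" "integrable lborel (\<lambda>t. cis (t * \<omega>) * cnj (u t))" for \<omega>
    using u by (auto intro!: integrable_cis_mult)
  have "AE x in lborel. Re (u x) = 0"
  proof (rule real_ft_eq_0)
    fix \<omega>
    have "ft (\<lambda>t. of_real (Re (u t))) \<omega> = (LINT t|lborel. (cis (t * \<omega>) * u t + cis (t * \<omega>) * cnj (u t)) / 2)"
      unfolding ft_def
      by (intro Bochner_Integration.integral_cong) (auto simp: complex_eq_iff field_simps)
    also have "\<dots> = 0"
      using 0[of \<omega>] c[of \<omega>] i[of \<omega>] by (simp add: ft_def)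
    finally show "ft (\<lambda>t. of_real (Re (u t))) \<omega> = 0" .
  qed (use u in auto)
  moreover have "AE x in lborel. Im (u x) = 0"
  proof (rule real_ft_eq_0)
    fix \<omega>
    have "ft (\<lambda>t. of_real (Im (u t))) \<omega> = (LINT t|lborel. (cis (t * \<omega>) * u t - cis (t * \<omega>) * cnj (u t)) * (- \<i> / 2))"
      unfolding ft_def
      by (intro Bochner_Integration.integral_cong)
         (auto simp: complex_eq_iff field_simps)
    also have "\<dots> = 0"
      using 0[of \<omega>] c[of \<omega>] i[of \<omega>] by (simp add: ft_def)
    finally show "ft (\<lambda>t. of_real (Im (u t))) \<omega> = 0" .
  qed (use u in auto)
  ultimately show ?thesis
    by eventually_elim (simp add: complex_eq_iff)
qed

text \<open>Tested against modulated Gaussians, the difference yields the ordinary transform of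
  \<open>(h\<^sub>1 - h\<^sub>2) exp (- x^2 / 2)\<close>, an integrable function; the Gaussian has
  no zero and can be cancelled.\<close>

lemma represented_by_unique:
  assumes "represented_by T h\<^sub>1" "represented_by T h\<^sub>2"
  shows "AE x in lborel. h\<^sub>1 x = h\<^sub>2 x"
proof -
  define u where "u x = (h\<^sub>1 x - h\<^sub>2 x) * gaussian 0 0 x" for x
  have i: "integrable lborel (\<lambda>x. h x * gaussian 0 c x)" if "represented_by T h" for h c
    using that gaussian_schwartz by (auto simp: represented_by_def)
  have u: "integrable lborel u"
    using Bochner_Integration.integrable_diff[OF i[OF assms(1), of 0] i[OF assms(2), of 0]]
    unfolding u_def by (simp add: algebra_simps)
  have "ft u \<omega> = 0" for \<omega>
  proof -
    have "ft u \<omega> = (LINT x|lborel. h\<^sub>1 x * gaussian 0 \<omega> x - h\<^sub>2 x * gaussian 0 \<omega> x)"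
      unfolding ft_def u_def
      by (intro Bochner_Integration.integral_cong) (auto simp: gaussian_def algebra_simps)
    also have "\<dots> = T (gaussian 0 \<omega>) - T (gaussian 0 \<omega>)"
      using assms gaussian_schwartz i by (subst Bochner_Integration.integral_diff) (auto simp: represented_by_def)
    finally show ?thesis by simp
  qed
  from ft_eq_0[OF u this] show ?thesis
    by eventually_elim (auto simp: u_def gaussian_def)
qed

section \<open>Integrals on the line\<close>

lemma integrable_quad_shift: "integrable lborel (\<lambda>s::real. inverse (1 + (x - s)\<^sup>2))"
  using lborel_integrable_real_affine[OF integrable_inverse_quad, of "-1" x] by simp

lemma integral_quad_shift:
  "(LINT s|lborel. inverse (1 + (x - s)\<^sup>2)) = (LINT s::real|lborel. inverse (1 + s\<^sup>2))"
  using lborel_integral_real_affine[of "-1" "\<lambda>s. inverse (1 + s\<^sup>2) :: real" x] by simp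

lemma inverse_quad_pos: "0 < inverse (1 + (x::real)\<^sup>2)"
  by (simp add: add_pos_nonneg)

text \<open>From \<open>s^2 \<le> 2 (x - s)^2 + 2 x^2\<close> the product is at most
  \<open>2 / (1 + s^2)\<close> times the sum of its two factors, and each of these has the same
  integral.\<close>

lemma quad_convolution:
  fixes s :: real
  shows "integrable lborel (\<lambda>x. inverse (1 + (x - s)\<^sup>2) * inverse (1 + x\<^sup>2))"
    and "(LINT x|lborel. inverse (1 + (x - s)\<^sup>2) * inverse (1 + x\<^sup>2))
      \<le> 4 * (LINT x::real|lborel. inverse (1 + x\<^sup>2)) * inverse (1 + s\<^sup>2)"
proof -
  have le: "inverse (1 + (x - s)\<^sup>2) * inverse (1 + x\<^sup>2) \<le> 2 * inverse (1 + s\<^sup>2) * (inverse (1 + x\<^sup>2) + inverse (1 + (s - x)\<^sup>2))" for x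
  proof -
    have "0 \<le> (x - s + x)\<^sup>2" by simp
    then have *: "1 + s\<^sup>2 \<le> 2 * ((1 + (x - s)\<^sup>2) + (1 + x\<^sup>2))"
      by (simp add: power2_eq_square algebra_simps)
    have pos: "0 < 1 + s\<^sup>2" "0 < 1 + (x - s)\<^sup>2" "0 < 1 + x\<^sup>2"
      by (simp_all add: add_pos_nonneg)
    have c: "(s - x)\<^sup>2 = (x - s)\<^sup>2" by (simp add: power2_commute)
    from * pos show ?thesis
      unfolding c by (simp add: divide_simps)
  qed
  have int: "integrable lborel (\<lambda>x. 2 * inverse (1 + s\<^sup>2) * (inverse (1 + x\<^sup>2) + inverse (1 + (s - x)\<^sup>2)))"
    by (intro integrable_mult_right Bochner_Integration.integrable_add integrable_inverse_quad integrable_quad_shift)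
  show i: "integrable lborel (\<lambda>x. inverse (1 + (x - s)\<^sup>2) * inverse (1 + x\<^sup>2))"
    by (rule Bochner_Integration.integrable_bound[OF int])
       (use le in \<open>auto intro!: AE_I2 order_trans[OF _ abs_ge_self] simp: abs_mult\<close>)
  have "(LINT x|lborel. inverse (1 + (x - s)\<^sup>2) * inverse (1 + x\<^sup>2)) \<le>
      (LINT x|lborel. 2 * inverse (1 + s\<^sup>2) * (inverse (1 + x\<^sup>2) + inverse (1 + (s - x)\<^sup>2)))"
    by (rule integral_mono[OF i int le])
  also have "\<dots> = 2 * inverse (1 + s\<^sup>2) * (LINT x|lborel. inverse (1 + x\<^sup>2) + inverse (1 + (s - x)\<^sup>2))"
    by (rule Bochner_Integration.integral_mult_right_zero)
  also have "\<dots> = 4 * (LINT x::real|lborel. inverse (1 + x\<^sup>2)) * inverse (1 + s\<^sup>2)"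
    by (simp add: integrable_inverse_quad integrable_quad_shift integral_quad_shift)
  finally show "(LINT x|lborel. inverse (1 + (x - s)\<^sup>2) * inverse (1 + x\<^sup>2))
      \<le> 4 * (LINT x::real|lborel. inverse (1 + x\<^sup>2)) * inverse (1 + s\<^sup>2)" .
qed

lemma integrable_lborel_of_integrable_on:
  fixes f :: "real \<Rightarrow> real"
  assumes [measurable]: "f \<in> borel_measurable borel" and S [measurable]: "S \<in> sets borel"
    and "f integrable_on S" and "\<And>x. x \<in> S \<Longrightarrow> 0 \<le> f x"
  shows "integrable lborel (\<lambda>x. indicator S x * f x)"
proof -
  have "f absolutely_integrable_on S"
    by (rule nonnegative_absolutely_integrable_1) (use assms in auto)
  then have "integrable (completion lborel) (\<lambda>x. indicator S x * f x)"
    by (simp add: set_integrable_def)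
  moreover have "(\<lambda>x. indicator S x * f x) \<in> borel_measurable lborel"
    by measurable
  ultimately show ?thesis
    by (simp add: integrable_completion)
qed

lemma integral_even:
  fixes f :: "real \<Rightarrow> real"
  assumes [measurable]: "f \<in> borel_measurable borel" and f: "integrable lborel (\<lambda>x. indicator {0<..} x * f x)"
  shows "integrable lborel (\<lambda>x. f \<bar>x\<bar>)"
    and "(LINT x|lborel. f \<bar>x\<bar>) = 2 * (LINT x|lborel. indicator {0<..} x * f x)"
proof -
  let ?g = "\<lambda>x. indicator {0<..} x * f x"
  have g: "integrable lborel (\<lambda>x. ?g (- x))"
    using lborel_integrable_real_affine[OF f, of "-1" 0] by simp
  have eq: "(LINT x|lborel. ?g (- x)) = (LINT x|lborel. ?g x)"
    using lborel_integral_real_affine[of "-1" ?g 0] by simp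
  have ae: "AE x in lborel. ?g x + ?g (- x) = f \<bar>x\<bar>"
    using AE_lborel_singleton[of 0] by eventually_elim (auto simp: indicator_def)
  have int: "integrable lborel (\<lambda>x. ?g x + ?g (- x))"
    using f g by (rule Bochner_Integration.integrable_add)
  show "integrable lborel (\<lambda>x. f \<bar>x\<bar>)"
    by (rule integrable_cong_AE_imp[OF int _ ae]) measurable
  have "(LINT x|lborel. f \<bar>x\<bar>) = (LINT x|lborel. ?g x + ?g (- x))"
    by (rule integral_cong_AE) (use ae in auto)
  also have "\<dots> = 2 * (LINT x|lborel. ?g x)"
    by (subst Bochner_Integration.integral_add[OF f g]) (simp add: eq)
  finally show "(LINT x|lborel. f \<bar>x\<bar>) = 2 * (LINT x|lborel. ?g x)" .
qed

section \<open>Power singularities and power tails\<close>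

lemma integrable_powr_0_1:
  assumes "-1 < (a::real)" 
  shows "integrable lborel (\<lambda>x. indicator {0<..1} x * x powr a)"
  by (rule integrable_lborel_of_integrable_on) (use integrable_on_powr_from_0'[OF assms, of 1] in auto)

lemma integrable_powr_1_inf:
  assumes "(a::real) < -1" 
  shows "integrable lborel (\<lambda>x. indicator {1..} x * x powr a)"
  by (rule integrable_lborel_of_integrable_on) (use has_integral_powr_to_inf[OF assms, of 1] in \<open>auto simp: integrable_on_def\<close>)

text \<open>The majorant in frequency: \<open>p < 1\<close> makes the singularity at the origin
  integrable, and the quadratic factor, supplied by a rapidly decreasing function, controls
  infinity.\<close>

lemma integrable_singular_quad:
  fixes p :: real
  assumes "0 \<le> p" "p < 1"
  shows "integrable lborel (\<lambda>\<omega>. (1 + \<bar>\<omega>\<bar> powr (- p)) * inverse (1 + \<omega>\<^sup>2))"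
proof -
  have "(\<lambda>x. indicator {0<..} x * (indicator {0<..1} x * x powr (- p))) = (\<lambda>x. indicator {0<..1} x * x powr (- p))"
    by (auto simp: indicator_def)
  then have "integrable lborel (\<lambda>x. indicator {0<..} x * (indicator {0<..1} x * x powr (- p)))"
    using integrable_powr_0_1[of "- p"] assms by simp
  then have "integrable lborel (\<lambda>x. indicator {0<..1} \<bar>x\<bar> * \<bar>x\<bar> powr (- p))"
    by (rule integral_even(1)[rotated]) measurable
  then have int: "integrable lborel (\<lambda>x. indicator {0<..1} \<bar>x\<bar> * \<bar>x\<bar> powr (- p) + 2 * inverse (1 + x\<^sup>2))"
    by (intro Bochner_Integration.integrable_add integrable_mult_right integrable_inverse_quad)
  have le: "(1 + \<bar>x\<bar> powr (- p)) * inverse (1 + x\<^sup>2) \<le> indicator {0<..1} \<bar>x\<bar> * \<bar>x\<bar> powr (- p) + 2 * inverse (1 + x\<^sup>2)" for x :: real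
  proof (cases "\<bar>x\<bar> \<in> {0<..1}")
    case True
    have "inverse (1 + x\<^sup>2) \<le> 1"
      by (simp add: inverse_le_1_iff)
    then have "\<bar>x\<bar> powr (- p) * inverse (1 + x\<^sup>2) \<le> \<bar>x\<bar> powr (- p)"
      by (intro mult_left_le) auto
    moreover have i: "indicator {0<..1} \<bar>x\<bar> = (1::real)"
      using True by simp
    ultimately show ?thesis
      using inverse_quad_pos[of x] unfolding distrib_right i mult_1 by linarith
  next
    case False
    then have "\<bar>x\<bar> powr (- p) \<le> 1"
      using assms powr_mono[of "- p" 0 "\<bar>x\<bar>"] by (cases "x = 0") auto
    then have "(1 + \<bar>x\<bar> powr (- p)) * inverse (1 + x\<^sup>2) \<le> 2 * inverse (1 + x\<^sup>2)"
      using inverse_quad_pos[of x] by (intro mult_right_mono) auto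
    moreover have i: "indicator {0<..1} \<bar>x\<bar> = (0::real)"
      using False by (rule indicator_simps(2))
    ultimately show ?thesis
      by (simp add: i)
  qed
  have pos: "0 \<le> (1 + \<bar>x\<bar> powr (- p)) * inverse (1 + x\<^sup>2)" for x :: real
    using inverse_quad_pos[of x] by (intro mult_nonneg_nonneg) auto
  show ?thesis
    by (rule Bochner_Integration.integrable_bound[OF int])
       (use le pos in \<open>auto intro!: AE_I2 intro: order_trans[OF _ abs_ge_self]\<close>)
qed

lemma ft_continuous:
  assumes f: "integrable lborel f"
  shows "continuous_on S (ft f)"
proof -
  have [measurable]: "f \<in> borel_measurable borel" using f by auto
  have "isCont (ft f) \<omega>" for \<omega>
    unfolding isCont_def tendsto_at_iff_sequentially comp_def
  proof (intro allI impI)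
    fix X :: "nat \<Rightarrow> real" assume X: "X \<longlonglongrightarrow> \<omega>"
    show "(\<lambda>i. ft f (X i)) \<longlonglongrightarrow> ft f \<omega>"
      unfolding ft_def
    proof (rule integral_dominated_convergence)
      show "integrable lborel (\<lambda>t. cmod (f t))" using f by auto
      show "AE t in lborel. (\<lambda>i. cis (t * X i) * f t) \<longlonglongrightarrow> cis (t * \<omega>) * f t"
        using X by (intro AE_I2 tendsto_intros tendsto_mult_right continuous_on_tendsto_compose[OF continuous_on_cis[OF continuous_on_id]]) auto
    qed (auto simp: norm_mult)
  qed
  then show ?thesis
    by (simp add: continuous_at_imp_continuous_on)
qed

section \<open>Fourier transforms of slowly decaying kernels\<close>

definition lborel_convol :: "(real \<Rightarrow> complex) \<Rightarrow> (real \<Rightarrow> complex) \<Rightarrow> real \<Rightarrow> complex" where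
  "lborel_convol \<kappa> \<phi> x = (LINT s|lborel. \<kappa> s * \<phi> (x - s))"

text \<open>\<open>\<kappa>\<close> need not be integrable, so its transform
  \<open>\<Lambda>\<close> is given only as a pointwise limit of transforms of integrable
  \<open>\<kappa>n\<close>. The uniform bound with \<open>p < 1\<close> turns this limit into an
  identity of distributions. The causal kernel and its reflection are both instances.\<close>

locale approx_kernel =
  fixes \<kappa> :: "real \<Rightarrow> complex" and \<kappa>n :: "nat \<Rightarrow> real \<Rightarrow> complex" and \<Lambda> :: "real \<Rightarrow> complex"
    and A B C p :: real
  assumes \<kappa>_measurable [measurable]: "\<kappa> \<in> borel_measurable borel"
    and \<Lambda>_measurable [measurable]: "\<Lambda> \<in> borel_measurable borel"
    and integrable_\<kappa>n: "\<And>n. integrable lborel (\<kappa>n n)"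
    and norm_\<kappa>n_le: "\<And>n t. cmod (\<kappa>n n t) \<le> cmod (\<kappa> t)"
    and \<kappa>n_tendsto: "\<And>t. (\<lambda>n. \<kappa>n n t) \<longlonglongrightarrow> \<kappa> t"
    and near: "integrable lborel (\<lambda>t. indicator {-A..A} t * cmod (\<kappa> t))"
    and far: "\<And>t. A < \<bar>t\<bar> \<Longrightarrow> cmod (\<kappa> t) \<le> B" and B_nonneg: "0 \<le> B"
    and p: "0 \<le> p" "p < 1"
    and ft_\<kappa>n_le: "\<And>n \<omega>. \<omega> \<noteq> 0 \<Longrightarrow> cmod (ft (\<kappa>n n) \<omega>) \<le> C * (1 + \<bar>\<omega>\<bar> powr (- p))"
    and ft_\<kappa>n_tendsto: "\<And>\<omega>. \<omega> \<noteq> 0 \<Longrightarrow> (\<lambda>n. ft (\<kappa>n n) \<omega>) \<longlonglongrightarrow> \<Lambda> \<omega>"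
begin

text \<open>Splitting at \<open>A\<close> leaves an integrable piece and a bounded one; the
  resulting bound does not depend on \<open>x\<close>, so the convolutions below are bounded
  functions.\<close>

lemma kernel_quad:
  shows "integrable lborel (\<lambda>s. cmod (\<kappa> s) * inverse (1 + (x - s)\<^sup>2))"
    and "(LINT s|lborel. cmod (\<kappa> s) * inverse (1 + (x - s)\<^sup>2)) \<le>
      (LINT s|lborel. indicator {-A..A} s * cmod (\<kappa> s)) + B * (LINT s::real|lborel. inverse (1 + s\<^sup>2))"
proof -
  let ?u = "\<lambda>s. indicator {-A..A} s * cmod (\<kappa> s) + B * inverse (1 + (x - s)\<^sup>2)"
  have le: "cmod (\<kappa> s) * inverse (1 + (x - s)\<^sup>2) \<le> ?u s" for s
  proof (cases "A < \<bar>s\<bar>")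
    case True
    then have "cmod (\<kappa> s) * inverse (1 + (x - s)\<^sup>2) \<le> B * inverse (1 + (x - s)\<^sup>2)"
      using inverse_quad_pos[of "x - s"] by (intro mult_right_mono far) auto
    then show ?thesis by (simp add: indicator_def add_increasing)
  next
    case False
    have "inverse (1 + (x - s)\<^sup>2) \<le> 1"
      by (simp add: inverse_le_1_iff)
    then have "cmod (\<kappa> s) * inverse (1 + (x - s)\<^sup>2) \<le> cmod (\<kappa> s)"
      by (intro mult_left_le) auto
    moreover have "0 \<le> B * inverse (1 + (x - s)\<^sup>2)"
      using inverse_quad_pos[of "x - s"] B_nonneg by simp
    ultimately show ?thesis
      using False by (auto simp: indicator_def abs_le_iff not_less)
  qed
  have int: "integrable lborel ?u"
    by (intro Bochner_Integration.integrable_add near integrable_mult_right integrable_quad_shift)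
  show i: "integrable lborel (\<lambda>s. cmod (\<kappa> s) * inverse (1 + (x - s)\<^sup>2))"
    by (rule Bochner_Integration.integrable_bound[OF int])
       (use le in \<open>auto intro!: AE_I2 order_trans[OF _ abs_ge_self] simp: abs_mult\<close>)
  have "(LINT s|lborel. cmod (\<kappa> s) * inverse (1 + (x - s)\<^sup>2)) \<le> (LINT s|lborel. ?u s)"
    by (rule integral_mono[OF i int le])
  then show "(LINT s|lborel. cmod (\<kappa> s) * inverse (1 + (x - s)\<^sup>2)) \<le>
      (LINT s|lborel. indicator {-A..A} s * cmod (\<kappa> s)) + B * (LINT s::real|lborel. inverse (1 + s\<^sup>2))"
    by (simp add: near integrable_quad_shift integral_quad_shift)
qed

lemma lborel_convol_measurable:
  assumes "\<phi> \<in> schwartz"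
  shows "lborel_convol \<kappa> \<phi> \<in> borel_measurable borel"
proof -
  note [measurable] = schwartz_borel_measurable[OF assms]
  show ?thesis unfolding lborel_convol_def by measurable
qed

lemma lborel_convol_bounded:
  assumes "\<phi> \<in> schwartz"
  shows "\<exists>b. \<forall>x. cmod (lborel_convol \<kappa> \<phi> x) \<le> b"
proof -
  note [measurable] = schwartz_borel_measurable[OF assms]
  obtain b where b: "\<And>x. cmod (\<phi> x) \<le> b * inverse (1 + x\<^sup>2)"
    using schwartz_quad_decay[OF assms] by (auto simp: quad_decay_def)
  have b0: "0 \<le> b"
    using order_trans[OF norm_ge_zero b[of 0]] by simp
  have "cmod (lborel_convol \<kappa> \<phi> x) \<le> b * ((LINT s|lborel. indicator {-A..A} s * cmod (\<kappa> s)) + B * (LINT s::real|lborel. inverse (1 + s\<^sup>2)))" for x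
  proof -
    have "cmod (\<kappa> s * \<phi> (x - s)) \<le> b * (cmod (\<kappa> s) * inverse (1 + (x - s)\<^sup>2))" for s
      using mult_left_mono[OF b[of "x - s"] norm_ge_zero[of "\<kappa> s"]] by (simp add: norm_mult mult_ac)
    then have "cmod (lborel_convol \<kappa> \<phi> x) \<le> (LINT s|lborel. b * (cmod (\<kappa> s) * inverse (1 + (x - s)\<^sup>2)))"
      unfolding lborel_convol_def
      by (intro order_trans[OF integral_norm_bound] integral_mono integrable_norm integrable_mult_right kernel_quad
          Bochner_Integration.integrable_bound[OF integrable_mult_right[OF kernel_quad(1), of b x]])
         (auto intro!: AE_I2 intro: order_trans[OF _ abs_ge_self])
    also have "\<dots> = b * (LINT s|lborel. (cmod (\<kappa> s) * inverse (1 + (x - s)\<^sup>2)))"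
      by simp
    finally show ?thesis
      using mult_left_mono[OF kernel_quad(2) b0] by (rule order_trans)
  qed
  then show ?thesis by blast
qed

text \<open>For \<open>\<kappa>n\<close> the identity is the multiplication formula. Up to constants
  the limit is dominated by \<open>|\<kappa> s| / (1 + s^2)\<close> in time and by
  \<open>(1 + |\<omega>|^(-p)) / (1 + \<omega>^2)\<close> in frequency. The third part serves the
  noise covariance, the fourth the weak equation.\<close>

lemma pairing:
  assumes \<phi>: "\<phi> \<in> schwartz" and \<psi>: "\<psi> \<in> schwartz"
  shows "integrable lborel (\<lambda>\<omega>. \<Lambda> \<omega> * ft \<phi> \<omega> * \<psi> \<omega>)"
    and "integrable lborel (\<lambda>s. \<kappa> s * (LINT x|lborel. \<phi> (x - s) * ft \<psi> x))"
    and "(LINT s|lborel. \<kappa> s * (LINT x|lborel. \<phi> (x - s) * ft \<psi> x)) = (LINT \<omega>|lborel. \<Lambda> \<omega> * ft \<phi> \<omega> * \<psi> \<omega>)"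
    and "(LINT x|lborel. lborel_convol \<kappa> \<phi> x * ft \<psi> x) = (LINT \<omega>|lborel. \<Lambda> \<omega> * ft \<phi> \<omega> * \<psi> \<omega>)"
proof -
  note [measurable] = schwartz_borel_measurable[OF \<phi>] schwartz_borel_measurable[OF \<psi>]
    borel_measurable_integrable[OF integrable_\<kappa>n, simplified]
  define \<Phi> where "\<Phi> s = (LINT x|lborel. \<phi> (x - s) * ft \<psi> x)" for s
  obtain b where b: "\<And>x. cmod (\<phi> x) \<le> b * inverse (1 + x\<^sup>2)"
    using schwartz_quad_decay[OF \<phi>] by (auto simp: quad_decay_def)
  obtain c where c: "\<And>x. cmod (ft \<psi> x) \<le> c * inverse (1 + x\<^sup>2)"
    using schwartz_quad_decay[OF ft_schwartz[OF \<psi>]] by (auto simp: quad_decay_def)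
  obtain d where d: "\<And>x. cmod (\<psi> x) \<le> d * inverse (1 + x\<^sup>2)"
    using schwartz_quad_decay[OF \<psi>] by (auto simp: quad_decay_def)
  have bcd: "0 \<le> b" "0 \<le> c" "0 \<le> d"
    using order_trans[OF norm_ge_zero b[of 0]] order_trans[OF norm_ge_zero c[of 0]] order_trans[OF norm_ge_zero d[of 0]] by simp_all
  let ?J = "LINT x::real|lborel. inverse (1 + x\<^sup>2)"
  define D where "D = b * c * 4 * ?J"
  have prod: "cmod (\<phi> (x - s) * ft \<psi> x) \<le> b * c * (inverse (1 + (x - s)\<^sup>2) * inverse (1 + x\<^sup>2))" for x s
    using mult_mono[OF b[of "x - s"] c[of x]] bcd inverse_quad_pos[of "x - s"]
    by (simp add: norm_mult mult_ac)
  have prod_int: "integrable lborel (\<lambda>x. \<phi> (x - s) * ft \<psi> x)" for s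
    by (rule Bochner_Integration.integrable_bound[OF integrable_mult_right[OF quad_convolution(1), of "b * c" s]])
       (auto intro!: AE_I2 order_trans[OF prod abs_ge_self])
  have norm_prod: "(LINT x|lborel. cmod (\<phi> (x - s) * ft \<psi> x)) \<le> D * inverse (1 + s\<^sup>2)" for s
  proof -
    have "(LINT x|lborel. cmod (\<phi> (x - s) * ft \<psi> x)) \<le> (LINT x|lborel. b * c * (inverse (1 + (x - s)\<^sup>2) * inverse (1 + x\<^sup>2)))"
      by (intro integral_mono integrable_norm prod_int integrable_mult_right quad_convolution prod)
    also have "\<dots> = b * c * (LINT x|lborel. inverse (1 + (x - s)\<^sup>2) * inverse (1 + x\<^sup>2))"
      by (rule Bochner_Integration.integral_mult_right_zero)
    also have "\<dots> \<le> b * c * (4 * ?J * inverse (1 + s\<^sup>2))"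
      using bcd by (intro mult_left_mono quad_convolution) auto
    finally show ?thesis by (simp add: D_def mult_ac)
  qed
  have \<Phi>_le: "cmod (\<Phi> s) \<le> D * inverse (1 + s\<^sup>2)" for s
    unfolding \<Phi>_def by (rule order_trans[OF integral_norm_bound norm_prod])
  have [measurable]: "\<Phi> \<in> borel_measurable borel"
    unfolding \<Phi>_def by measurable
  have \<phi>\<psi>: "integrable lborel (\<lambda>\<omega>. ft \<phi> \<omega> * \<psi> \<omega>)"
    by (rule ft_multiplication_formula(2)) (intro schwartz_integrable \<phi> \<psi>)+
  \<comment> \<open>A translation by \<open>s\<close> becomes the factor
    \<open>cis (s * \<omega>)\<close>, so moving the transform from \<open>\<psi>\<close> to the
    translate of \<open>\<phi>\<close> exhibits \<open>\<Phi>\<close> itself as a transform.\<close>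
  have \<Phi>_eq: "\<Phi> = ft (\<lambda>\<omega>. ft \<phi> \<omega> * \<psi> \<omega>)"
  proof
    fix s
    have sh: "integrable lborel (\<lambda>x. \<phi> (x - s))"
      using lborel_integrable_real_affine[OF schwartz_integrable[OF \<phi>], of 1 "- s"] by (simp add: algebra_simps)
    have "ft (\<lambda>x. \<phi> (x - s)) \<omega> = cis (s * \<omega>) * ft \<phi> \<omega>" for \<omega>
    proof -
      have "ft (\<lambda>x. \<phi> (x - s)) \<omega> = (LINT t|lborel. cis ((s + 1 * t) * \<omega>) * \<phi> ((s + 1 * t) - s))"
        unfolding ft_def by (subst lborel_integral_real_affine[of 1 _ s]) auto
      also have "\<dots> = (LINT t|lborel. cis (s * \<omega>) * (cis (t * \<omega>) * \<phi> t))"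
        by (simp add: cis_mult distrib_right mult.assoc[symmetric])
      finally show ?thesis by (simp add: ft_def)
    qed
    then show "\<Phi> s = ft (\<lambda>\<omega>. ft \<phi> \<omega> * \<psi> \<omega>) s"
      unfolding \<Phi>_def ft_multiplication_formula(3)[OF sh schwartz_integrable[OF \<psi>]]
      by (simp add: ft_def mult_ac)
  qed
  have \<kappa>\<Phi>_dom: "integrable lborel (\<lambda>s. D * (cmod (\<kappa> s) * inverse (1 + s\<^sup>2)))"
    using kernel_quad(1)[of 0] by (intro integrable_mult_right) simp
  have \<kappa>\<Phi>_le: "cmod (\<kappa> s * \<Phi> s) \<le> D * (cmod (\<kappa> s) * inverse (1 + s\<^sup>2))" for s
    using mult_left_mono[OF \<Phi>_le norm_ge_zero[of "\<kappa> s"], of s] by (simp add: norm_mult mult_ac)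
  have "integrable lborel (\<lambda>s. \<kappa> s * \<Phi> s)"
    by (rule Bochner_Integration.integrable_bound[OF \<kappa>\<Phi>_dom])
       (auto intro!: AE_I2 order_trans[OF \<kappa>\<Phi>_le abs_ge_self])
  then show "integrable lborel (\<lambda>s. \<kappa> s * (LINT x|lborel. \<phi> (x - s) * ft \<psi> x))"
    by (simp only: \<Phi>_def)
  have lim1: "(\<lambda>n. LINT s|lborel. \<kappa>n n s * \<Phi> s) \<longlonglongrightarrow> (LINT s|lborel. \<kappa> s * \<Phi> s)"
  proof (rule integral_dominated_convergence[OF _ _ \<kappa>\<Phi>_dom])
    show "AE s in lborel. (\<lambda>n. \<kappa>n n s * \<Phi> s) \<longlonglongrightarrow> \<kappa> s * \<Phi> s"
      by (intro AE_I2 tendsto_mult_right \<kappa>n_tendsto)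
    show "AE s in lborel. norm (\<kappa>n n s * \<Phi> s) \<le> D * (cmod (\<kappa> s) * inverse (1 + s\<^sup>2))" for n
      using mult_mono[OF norm_\<kappa>n_le \<Phi>_le] by (auto simp: norm_mult mult_ac)
  qed auto
  obtain E where E: "\<And>\<omega>. cmod (ft \<phi> \<omega>) \<le> E"
    using norm_ft_le[of \<phi>] by blast
  have E0: "0 \<le> E" using order_trans[OF norm_ge_zero E] .
  have bd: "cmod (ft \<phi> \<omega> * \<psi> \<omega>) \<le> E * d * inverse (1 + \<omega>\<^sup>2)" for \<omega>
    using mult_mono[OF E d E0 norm_ge_zero] by (simp add: norm_mult mult_ac)
  let ?w = "\<lambda>\<omega>. C * E * d * ((1 + \<bar>\<omega>\<bar> powr (- p)) * inverse (1 + \<omega>\<^sup>2))"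
  have w: "integrable lborel ?w"
    by (intro integrable_mult_right integrable_singular_quad p)
  have ft_w: "AE \<omega> in lborel. cmod (ft (\<kappa>n n) \<omega> * (ft \<phi> \<omega> * \<psi> \<omega>)) \<le> ?w \<omega>" for n
    using AE_lborel_singleton[of 0]
  proof eventually_elim
    case (elim \<omega>)
    from mult_mono[OF ft_\<kappa>n_le[OF elim] bd order_trans[OF norm_ge_zero ft_\<kappa>n_le[OF elim]] norm_ge_zero]
    show ?case by (simp add: norm_mult mult_ac)
  qed
  have lim_ae: "AE \<omega> in lborel. (\<lambda>n. ft (\<kappa>n n) \<omega> * (ft \<phi> \<omega> * \<psi> \<omega>)) \<longlonglongrightarrow> \<Lambda> \<omega> * (ft \<phi> \<omega> * \<psi> \<omega>)"
    using AE_lborel_singleton[of 0]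
    by eventually_elim (intro tendsto_mult_right ft_\<kappa>n_tendsto)
  have lim2: "(\<lambda>n. LINT \<omega>|lborel. ft (\<kappa>n n) \<omega> * (ft \<phi> \<omega> * \<psi> \<omega>)) \<longlonglongrightarrow> (LINT \<omega>|lborel. \<Lambda> \<omega> * (ft \<phi> \<omega> * \<psi> \<omega>))"
    by (rule integral_dominated_convergence[OF _ _ w lim_ae ft_w]) auto
  show "integrable lborel (\<lambda>\<omega>. \<Lambda> \<omega> * ft \<phi> \<omega> * \<psi> \<omega>)"
    using integrable_dominated_convergence[OF _ _ w lim_ae ft_w] by (simp add: mult.assoc)
  have "(LINT s|lborel. \<kappa>n n s * \<Phi> s) = (LINT \<omega>|lborel. ft (\<kappa>n n) \<omega> * (ft \<phi> \<omega> * \<psi> \<omega>))" for n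
    unfolding \<Phi>_eq by (rule ft_multiplication_formula(3)[OF integrable_\<kappa>n \<phi>\<psi>])
  with lim1 lim2 have eq: "(LINT s|lborel. \<kappa> s * \<Phi> s) = (LINT \<omega>|lborel. \<Lambda> \<omega> * (ft \<phi> \<omega> * \<psi> \<omega>))"
    using LIMSEQ_unique by simp
  then show "(LINT s|lborel. \<kappa> s * (LINT x|lborel. \<phi> (x - s) * ft \<psi> x)) = (LINT \<omega>|lborel. \<Lambda> \<omega> * ft \<phi> \<omega> * \<psi> \<omega>)"
    by (simp add: \<Phi>_def mult.assoc)
  \<comment> \<open>The inner integrals of norms obey the same bound \<open>D / (1 + s^2)\<close> as
    \<open>\<Phi>\<close>, so the majorant found for \<open>\<kappa> s * \<Phi> s\<close> also
    justifies Fubini.\<close>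
  have fub: "integrable (lborel \<Otimes>\<^sub>M lborel) (\<lambda>(s, x). \<kappa> s * (\<phi> (x - s) * ft \<psi> x))"
  proof (rule lborel_pair.Fubini_integrable)
    have "integrable lborel (\<lambda>s. cmod (\<kappa> s) * (LINT x|lborel. cmod (\<phi> (x - s) * ft \<psi> x)))"
    proof (rule Bochner_Integration.integrable_bound[OF \<kappa>\<Phi>_dom])
      show "AE s in lborel. norm (cmod (\<kappa> s) * (LINT x|lborel. cmod (\<phi> (x - s) * ft \<psi> x)))
          \<le> norm (D * (cmod (\<kappa> s) * inverse (1 + s\<^sup>2)))"
      proof (rule AE_I2)
        fix s
        have "0 \<le> (LINT x|lborel. cmod (\<phi> (x - s) * ft \<psi> x))"
          by (rule Bochner_Integration.integral_nonneg) simp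
        then show "norm (cmod (\<kappa> s) * (LINT x|lborel. cmod (\<phi> (x - s) * ft \<psi> x)))
          \<le> norm (D * (cmod (\<kappa> s) * inverse (1 + s\<^sup>2)))"
          unfolding real_norm_def
          using mult_left_mono[OF norm_prod[of s] norm_ge_zero[of "\<kappa> s"]]
          by (intro order_trans[OF _ abs_ge_self]) (simp add: abs_mult mult_ac)
      qed
    qed measurable
    then show "integrable lborel (\<lambda>s. LINT x|lborel. norm (case (s, x) of (s, x) \<Rightarrow> \<kappa> s * (\<phi> (x - s) * ft \<psi> x)))"
      by (simp add: norm_mult)
    show "AE s in lborel. integrable lborel (\<lambda>x. case (s, x) of (s, x) \<Rightarrow> \<kappa> s * (\<phi> (x - s) * ft \<psi> x))"
      by (auto intro!: prod_int)
  qed measurable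
  have "(LINT x|lborel. lborel_convol \<kappa> \<phi> x * ft \<psi> x) = (LINT x|lborel. LINT s|lborel. \<kappa> s * (\<phi> (x - s) * ft \<psi> x))"
    unfolding lborel_convol_def by (subst integral_mult_left_zero[symmetric]) (simp add: mult.assoc)
  also have "\<dots> = (LINT s|lborel. LINT x|lborel. \<kappa> s * (\<phi> (x - s) * ft \<psi> x))"
    using lborel_pair.Fubini_integral[OF fub] by simp
  also have "\<dots> = (LINT s|lborel. \<kappa> s * \<Phi> s)"
    by (simp add: \<Phi>_def)
  finally show "(LINT x|lborel. lborel_convol \<kappa> \<phi> x * ft \<psi> x) = (LINT \<omega>|lborel. \<Lambda> \<omega> * ft \<phi> \<omega> * \<psi> \<omega>)"
    by (simp add: eq mult.assoc)
qed

lemma represented_by_lborel_convol: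
  assumes \<phi>: "\<phi> \<in> schwartz"
  shows "represented_by (dist_fourier (fun_dist (lborel_convol \<kappa> \<phi>))) (\<lambda>\<omega>. \<Lambda> \<omega> * ft \<phi> \<omega>)"
proof -
  note [measurable] = schwartz_borel_measurable[OF \<phi>]
  show ?thesis
    using pairing[OF \<phi>] by (simp add: represented_by_fourier_iff[OF lborel_convol_measurable[OF \<phi>]])
qed

end

subsection \<open>Kernels with a monotone tail\<close>

text \<open>The second mean value theorem is stated for increasing functions and therefore applied
  to \<open>- g\<close>. The factor 2 stems from its two subintervals, with weights
  \<open>g a\<close> and \<open>g b \<le> g a\<close>.\<close>

lemma second_mean_value_bound:
  fixes g h :: "real \<Rightarrow> real"
  assumes h: "h integrable_on {a..b}" and "a \<le> b"
    and g: "\<And>x y. a \<le> x \<Longrightarrow> x \<le> y \<Longrightarrow> y \<le> b \<Longrightarrow> g y \<le> g x" and "0 \<le> g b"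
    and H: "\<And>c d. a \<le> c \<Longrightarrow> c \<le> d \<Longrightarrow> d \<le> b \<Longrightarrow> \<bar>integral {c..d} h\<bar> \<le> H"
  shows "\<bar>integral {a..b} (\<lambda>t. g t * h t)\<bar> \<le> 2 * H * g a"
proof -
  obtain c where c: "c \<in> {a..b}"
    and "((\<lambda>x. - g x * h x) has_integral (- g a * integral {a..c} h + - g b * integral {c..b} h)) {a..b}"
    using second_mean_value_theorem_full[OF h \<open>a \<le> b\<close>, of "\<lambda>x. - g x"] g by auto
  from has_integral_neg[OF this(2)]
  have eq: "integral {a..b} (\<lambda>t. g t * h t) = g a * integral {a..c} h + g b * integral {c..b} h"
    by (simp add: integral_unique)
  have ga: "g b \<le> g a" "0 \<le> g a"
    using g[of a b] \<open>a \<le> b\<close> \<open>0 \<le> g b\<close> by auto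
  have H0: "0 \<le> H"
    using H[of a a] \<open>a \<le> b\<close> by auto
  have "\<bar>g a * integral {a..c} h\<bar> \<le> g a * H"
    using H[of a c] c ga by (simp add: abs_mult mult_left_mono)
  moreover have "\<bar>g b * integral {c..b} h\<bar> \<le> g a * H"
    using H[of c b] c ga \<open>0 \<le> g b\<close> H0 by (simp add: abs_mult mult_mono)
  ultimately show ?thesis
    unfolding eq by (simp add: mult_ac)
qed

lemma integral_cos_bound:
  fixes \<omega> c d :: real
  assumes "\<omega> \<noteq> 0" "c \<le> d"
  shows "\<bar>integral {c..d} (\<lambda>t. cos (t * \<omega>))\<bar> \<le> 2 / \<bar>\<omega>\<bar>"
proof -
  have "((\<lambda>t. cos (t * \<omega>)) has_integral (sin (d * \<omega>) / \<omega> - sin (c * \<omega>) / \<omega>)) {c..d}"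
    by (rule fundamental_theorem_of_calculus[where f = "\<lambda>t. sin (t * \<omega>) / \<omega>"])
       (use assms in \<open>auto intro!: derivative_eq_intros simp flip: has_real_derivative_iff_has_vector_derivative\<close>)
  then have "integral {c..d} (\<lambda>t. cos (t * \<omega>)) = (sin (d * \<omega>) - sin (c * \<omega>)) / \<omega>"
    by (simp add: integral_unique diff_divide_distrib)
  moreover have "\<bar>sin (d * \<omega>) - sin (c * \<omega>)\<bar> \<le> 2"
    using sin_le_one[of "d * \<omega>"] sin_ge_minus_one[of "d * \<omega>"] sin_le_one[of "c * \<omega>"] sin_ge_minus_one[of "c * \<omega>"]
    by linarith
  ultimately show ?thesis
    by (simp add: divide_right_mono)
qed

lemma integral_sin_bound:
  fixes \<omega> c d :: real
  assumes "\<omega> \<noteq> 0" "c \<le> d"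
  shows "\<bar>integral {c..d} (\<lambda>t. sin (t * \<omega>))\<bar> \<le> 2 / \<bar>\<omega>\<bar>"
proof -
  have "((\<lambda>t. sin (t * \<omega>)) has_integral (- cos (d * \<omega>) / \<omega> - - cos (c * \<omega>) / \<omega>)) {c..d}"
    by (rule fundamental_theorem_of_calculus[where f = "\<lambda>t. - cos (t * \<omega>) / \<omega>"])
       (use assms in \<open>auto intro!: derivative_eq_intros simp flip: has_real_derivative_iff_has_vector_derivative\<close>)
  then have "integral {c..d} (\<lambda>t. sin (t * \<omega>)) = (cos (c * \<omega>) - cos (d * \<omega>)) / \<omega>"
    by (simp add: integral_unique diff_divide_distrib)
  moreover have "\<bar>cos (c * \<omega>) - cos (d * \<omega>)\<bar> \<le> 2"
    using cos_le_one[of "d * \<omega>"] cos_ge_minus_one[of "d * \<omega>"] cos_le_one[of "c * \<omega>"] cos_ge_minus_one[of "c * \<omega>"]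
    by linarith
  ultimately show ?thesis
    by (simp add: divide_right_mono)
qed

section \<open>Truncated transforms and their improper limit\<close>

definition trunc :: "(real \<Rightarrow> real) \<Rightarrow> real \<Rightarrow> real \<Rightarrow> complex" where
  "trunc k T t = of_real (indicator {..T} t * k t)"

definition ktrans :: "(real \<Rightarrow> real) \<Rightarrow> real \<Rightarrow> real \<Rightarrow> complex" where
  "ktrans k T = ft (trunc k T)"

text \<open>The limit along the integers makes measurability immediate;
  \<open>ktrans_tendsto\<close> shows that off the origin it is the full improper integral. At
  \<open>\<omega> = 0\<close> the value is unspecified if the truncated transforms diverge.\<close>

definition klim :: "(real \<Rightarrow> real) \<Rightarrow> real \<Rightarrow> complex" where
  "klim k \<omega> = lim (\<lambda>n. ktrans k (real n) \<omega>)"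

locale tail_kernel =
  fixes k :: "real \<Rightarrow> real" and A :: real
  assumes k_measurable [measurable]: "k \<in> borel_measurable borel"
    and k_causal: "\<And>t. t \<le> 0 \<Longrightarrow> k t = 0"
    and k_nonneg: "\<And>t. 0 \<le> k t"
    and k_integrable: "\<And>T. integrable lborel (\<lambda>t. indicator {..T} t * k t)"
    and A_pos: "0 < A"
    and k_antimono: "\<And>s t. A \<le> s \<Longrightarrow> s \<le> t \<Longrightarrow> k t \<le> k s"
    and k_tendsto: "(k \<longlongrightarrow> 0) at_top"
begin

lemma trunc_integrable: "integrable lborel (trunc k T)"
  unfolding trunc_def using k_integrable by (rule integrable_of_real)

lemma trunc_measurable [measurable]: "trunc k T \<in> borel_measurable borel"
  unfolding trunc_def by measurable

lemma ktrans_measurable [measurable]: "ktrans k T \<in> borel_measurable borel"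
  unfolding ktrans_def by measurable

lemma klim_measurable [measurable]: "klim k \<in> borel_measurable borel"
  unfolding klim_def by measurable

lemma Re_ktrans: "Re (ktrans k T \<omega>) = (LINT t|lborel. indicator {..T} t * (k t * cos (t * \<omega>)))"
  unfolding ktrans_def ft_def
  unfolding integral_Re[OF integrable_cis_mult[OF trunc_integrable], symmetric]
  by (intro Bochner_Integration.integral_cong) (auto simp: trunc_def)

lemma Im_ktrans: "Im (ktrans k T \<omega>) = (LINT t|lborel. indicator {..T} t * (k t * sin (t * \<omega>)))"
  unfolding ktrans_def ft_def
  unfolding integral_Im[OF integrable_cis_mult[OF trunc_integrable], symmetric]
  by (intro Bochner_Integration.integral_cong) (auto simp: trunc_def)

lemma integrable_trunc_mult:
  assumes [measurable]: "h \<in> borel_measurable borel" and h: "\<And>t. \<bar>h t\<bar> \<le> 1"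
  shows "integrable lborel (\<lambda>t. indicator {..T} t * (k t * h t))"
proof (rule Bochner_Integration.integrable_bound[OF k_integrable[of T]])
  show "AE t in lborel. norm (indicator {..T} t * (k t * h t)) \<le> norm (indicator {..T} t * k t)"
    using h k_nonneg by (auto simp: abs_mult indicator_def mult_left_le)
qed measurable

lemma tail_bound_aux:
  assumes [measurable]: "h \<in> borel_measurable borel" and h: "\<And>t. \<bar>h t\<bar> \<le> 1"
    and cont: "continuous_on UNIV h" and ST: "A \<le> S" "S \<le> T"
    and H: "\<And>c d. c \<le> d \<Longrightarrow> \<bar>integral {c..d} h\<bar> \<le> H"
  shows "\<bar>(LINT t|lborel. indicator {..T} t * (k t * h t)) - (LINT t|lborel. indicator {..S} t * (k t * h t))\<bar> \<le> 2 * H * k S"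
proof -
  let ?f = "\<lambda>t. k t * h t"
  have "(LINT t|lborel. indicator {..T} t * ?f t) - (LINT t|lborel. indicator {..S} t * ?f t)
      = (LINT t|lborel. indicator {..T} t * ?f t - indicator {..S} t * ?f t)"
    by (rule Bochner_Integration.integral_diff[symmetric]) (intro integrable_trunc_mult h; measurable)+
  also have "\<dots> = (LINT t|lborel. indicator {S..T} t * ?f t)"
  proof (rule integral_cong_AE)
    show "AE t in lborel. indicator {..T} t * ?f t - indicator {..S} t * ?f t = indicator {S..T} t * ?f t"
      using AE_lborel_singleton[of S] by eventually_elim (use ST in \<open>auto simp: indicator_def\<close>)
  qed measurable
  also have "\<dots> = integral {S..T} ?f"
  proof -
    have "set_integrable lborel {S..T} ?f"
      unfolding set_integrable_def
    proof (rule Bochner_Integration.integrable_bound[OF integrable_trunc_mult[OF assms(1) h, of T]])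
      show "AE t in lborel. norm (indicator {S..T} t *\<^sub>R ?f t) \<le> norm (indicator {..T} t * ?f t)"
        by (auto simp: indicator_def)
    qed measurable
    from set_borel_integral_eq_integral(2)[OF this] show ?thesis
      by (simp add: set_lebesgue_integral_def)
  qed
  finally have eq: "(LINT t|lborel. indicator {..T} t * ?f t) - (LINT t|lborel. indicator {..S} t * ?f t) = integral {S..T} ?f" .
  show ?thesis
    unfolding eq
    by (rule second_mean_value_bound)
       (use ST k_antimono k_nonneg H integrable_continuous_interval[OF continuous_on_subset[OF cont subset_UNIV]] in auto)
qed

text \<open>Real and imaginary part each contribute \<open>2 (2 / |\<omega>|) k S\<close>, by the
  second mean value bound and the bound \<open>2 / |\<omega>|\<close> for integrals of the cosine
  and sine.\<close>

lemma ktrans_diff_le: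
  assumes "A \<le> S" "S \<le> T" "\<omega> \<noteq> 0"
  shows "cmod (ktrans k T \<omega> - ktrans k S \<omega>) \<le> 8 * k S / \<bar>\<omega>\<bar>"
proof -
  have "\<bar>Re (ktrans k T \<omega> - ktrans k S \<omega>)\<bar> \<le> 2 * (2 / \<bar>\<omega>\<bar>) * k S"
    unfolding minus_complex.sel Re_ktrans
    by (rule tail_bound_aux) (auto intro!: continuous_intros integral_cos_bound assms)
  moreover have "\<bar>Im (ktrans k T \<omega> - ktrans k S \<omega>)\<bar> \<le> 2 * (2 / \<bar>\<omega>\<bar>) * k S"
    unfolding minus_complex.sel Im_ktrans
    by (rule tail_bound_aux) (auto intro!: continuous_intros integral_sin_bound assms)
  ultimately show ?thesis
    using cmod_le[of "ktrans k T \<omega> - ktrans k S \<omega>"] by simp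
qed

lemma tail_tendsto_0: "((\<lambda>T. 8 * k T / c) \<longlongrightarrow> 0) at_top"
  using tendsto_divide_zero[OF tendsto_mult_right_zero[OF k_tendsto]] by blast

lemma klim_diff_le:
  assumes "A \<le> S" "\<omega> \<noteq> 0"
  shows "cmod (klim k \<omega> - ktrans k S \<omega>) \<le> 8 * k S / \<bar>\<omega>\<bar>"
proof -
  have "Cauchy (\<lambda>n. ktrans k (real n) \<omega>)"
  proof (rule CauchyI')
    fix e :: real assume "0 < e"
    have "eventually (\<lambda>T. 8 * k T / \<bar>\<omega>\<bar> < e) at_top"
      by (rule order_tendstoD(2)[OF tail_tendsto_0 \<open>0 < e\<close>])
    then obtain N where N: "\<And>T. N \<le> T \<Longrightarrow> 8 * k T / \<bar>\<omega>\<bar> < e"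
      by (auto simp: eventually_at_top_linorder)
    show "\<exists>M. \<forall>m\<ge>M. \<forall>n>m. dist (ktrans k (real m) \<omega>) (ktrans k (real n) \<omega>) < e"
    proof (intro exI[of _ "nat \<lceil>max A N\<rceil>"] allI impI)
      fix m n :: nat assume mn: "nat \<lceil>max A N\<rceil> \<le> m" "m < n"
      then have m: "A \<le> real m" "N \<le> real m" by linarith+
      have "cmod (ktrans k (real n) \<omega> - ktrans k (real m) \<omega>) \<le> 8 * k m / \<bar>\<omega>\<bar>"
        using m mn assms by (intro ktrans_diff_le) auto
      also have "\<dots> < e" by (rule N) (rule m)
      finally show "dist (ktrans k (real m) \<omega>) (ktrans k (real n) \<omega>) < e"
        by (simp add: dist_norm norm_minus_commute)
    qed
  qed
  then have "(\<lambda>n. ktrans k (real n) \<omega>) \<longlonglongrightarrow> klim k \<omega>"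
    unfolding klim_def by (simp add: Cauchy_convergent_iff convergent_LIMSEQ_iff)
  then have lim: "(\<lambda>n. cmod (ktrans k (real n) \<omega> - ktrans k S \<omega>)) \<longlonglongrightarrow> cmod (klim k \<omega> - ktrans k S \<omega>)"
    by (intro tendsto_intros)
  have ev: "eventually (\<lambda>n. cmod (ktrans k (real n) \<omega> - ktrans k S \<omega>) \<le> 8 * k S / \<bar>\<omega>\<bar>) sequentially"
    using eventually_ge_at_top[of "nat \<lceil>S\<rceil>"]
    by eventually_elim (intro ktrans_diff_le assms, linarith)
  show ?thesis
    by (rule tendsto_upperbound[OF lim ev]) simp
qed

lemma ktrans_tendsto:
  assumes "\<omega> \<noteq> 0"
  shows "((\<lambda>T. ktrans k T \<omega>) \<longlongrightarrow> klim k \<omega>) at_top"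
proof -
  have "eventually (\<lambda>T. norm (ktrans k T \<omega> - klim k \<omega>) \<le> 8 * k T / \<bar>\<omega>\<bar>) at_top"
    using eventually_ge_at_top[of A]
    by eventually_elim (use klim_diff_le[OF _ assms] in \<open>simp add: norm_minus_commute\<close>)
  from Lim_null_comparison[OF this tail_tendsto_0] show ?thesis
    by (simp add: LIM_zero_iff)
qed

lemma ktrans_LIMSEQ: "\<omega> \<noteq> 0 \<Longrightarrow> (\<lambda>n. ktrans k (real n) \<omega>) \<longlonglongrightarrow> klim k \<omega>"
  by (rule filterlim_compose[OF ktrans_tendsto filterlim_real_sequentially])

lemma ktrans_minus: "ktrans k T (- \<omega>) = cnj (ktrans k T \<omega>)"
proof -
  have "ktrans k T (- \<omega>) = (LINT t|lborel. cnj (cis (t * \<omega>) * trunc k T t))"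
    unfolding ktrans_def ft_def by (simp add: cis_cnj trunc_def)
  also have "\<dots> = cnj (ktrans k T \<omega>)"
    unfolding ktrans_def ft_def by (rule Bochner_Integration.integral_cnj)
  finally show ?thesis .
qed

lemma klim_minus:
  assumes "\<omega> \<noteq> 0"
  shows "klim k (- \<omega>) = cnj (klim k \<omega>)"
proof (rule LIMSEQ_unique)
  show "(\<lambda>n. ktrans k (real n) (- \<omega>)) \<longlonglongrightarrow> klim k (- \<omega>)"
    using assms by (intro ktrans_LIMSEQ) simp
  show "(\<lambda>n. ktrans k (real n) (- \<omega>)) \<longlonglongrightarrow> cnj (klim k \<omega>)"
    unfolding ktrans_minus by (intro tendsto_cnj ktrans_LIMSEQ assms)
qed

text \<open>The truncation error \<open>8 k T / |\<omega>|\<close> is uniform away from the origin.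
  Continuity provides the minimum of \<open>Re (klim k)\<close> on a compact set later on.\<close>

lemma klim_continuous_on:
  assumes "0 < e"
  shows "continuous_on {\<omega>. e \<le> \<bar>\<omega>\<bar>} (klim k)"
proof (rule uniform_limit_theorem)
  show "\<forall>\<^sub>F n in sequentially. continuous_on {\<omega>. e \<le> \<bar>\<omega>\<bar>} (ktrans k (real n))"
    unfolding ktrans_def by (intro always_eventually allI ft_continuous trunc_integrable)
  show "uniform_limit {\<omega>. e \<le> \<bar>\<omega>\<bar>} (\<lambda>n. ktrans k (real n)) (klim k) sequentially"
  proof (rule uniform_limitI)
    fix d :: real assume "0 < d"
    have "eventually (\<lambda>T. A \<le> T \<and> 8 * k T / e < d) at_top"
      by (intro eventually_conj eventually_ge_at_top order_tendstoD(2)[OF tail_tendsto_0 \<open>0 < d\<close>])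
    then have "eventually (\<lambda>n. A \<le> real n \<and> 8 * k (real n) / e < d) sequentially"
      by (rule eventually_compose_filterlim[OF _ filterlim_real_sequentially])
    then show "\<forall>\<^sub>F n in sequentially. \<forall>\<omega>\<in>{\<omega>. e \<le> \<bar>\<omega>\<bar>}. dist (ktrans k (real n) \<omega>) (klim k \<omega>) < d"
    proof eventually_elim
      case (elim n)
      show ?case
      proof
        fix \<omega> assume "\<omega> \<in> {\<omega>. e \<le> \<bar>\<omega>\<bar>}"
        then have \<omega>: "e \<le> \<bar>\<omega>\<bar>" "\<omega> \<noteq> 0" using assms by auto
        have "dist (ktrans k (real n) \<omega>) (klim k \<omega>) \<le> 8 * k (real n) / \<bar>\<omega>\<bar>"
          using klim_diff_le[of "real n" \<omega>] \<omega> elim by (simp add: dist_norm norm_minus_commute)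
        also have "\<dots> \<le> 8 * k (real n) / e"
          using \<omega> assms k_nonneg[of n] by (intro divide_left_mono) auto
        finally show "dist (ktrans k (real n) \<omega>) (klim k \<omega>) < d"
          using elim by simp
      qed
    qed
  qed
qed simp

lemma norm_ktrans_le: "cmod (ktrans k T \<omega>) \<le> (LINT t|lborel. indicator {..T} t * k t)"
  using norm_ft_le[of "trunc k T" \<omega>] k_nonneg
  by (simp add: ktrans_def trunc_def[abs_def] abs_mult norm_mult)

lemma trunc_integral_mono: "S \<le> T \<Longrightarrow> (LINT t|lborel. indicator {..S} t * k t) \<le> (LINT t|lborel. indicator {..T} t * k t)"
  by (intro integral_mono k_integrable) (auto simp: indicator_def k_nonneg)

text \<open>Mass below the cut \<open>S\<close> plus oscillation beyond it, uniformly in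
  \<open>T\<close>; the cut may be chosen depending on \<open>\<omega>\<close>.\<close>

lemma norm_ktrans_split:
  assumes "A \<le> S" "\<omega> \<noteq> 0"
  shows "cmod (ktrans k T \<omega>) \<le> (LINT t|lborel. indicator {..S} t * k t) + 8 * k S / \<bar>\<omega>\<bar>"
proof (cases "S \<le> T")
  case True
  then show ?thesis
    using norm_triangle_sub[of "ktrans k T \<omega>" "ktrans k S \<omega>"] ktrans_diff_le[OF assms(1) True assms(2)]
      norm_ktrans_le[of S \<omega>] by linarith
next
  case False
  moreover have "0 \<le> 8 * k S / \<bar>\<omega>\<bar>" using k_nonneg by simp
  ultimately show ?thesis
    using norm_ktrans_le[of T \<omega>] trunc_integral_mono[of T S] by linarith
qed

end

text \<open>The exponent is \<open>p = 0\<close> in the diffusive and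
  \<open>p = 1 - \<alpha>\<close> in the subdiffusive regime.\<close>

locale bounded_kernel = tail_kernel +
  fixes C p :: real
  assumes p01: "0 \<le> p" "p < 1"
    and ktrans_le: "\<And>T \<omega>. \<omega> \<noteq> 0 \<Longrightarrow> cmod (ktrans k T \<omega>) \<le> C * (1 + \<bar>\<omega>\<bar> powr (- p))"
begin

lemma near_integrable: "integrable lborel (\<lambda>t. indicator {-A..A} t * \<bar>k t\<bar>)"
  by (rule Bochner_Integration.integrable_bound[OF k_integrable[of A]])
     (auto simp: indicator_def)

lemma far_le: "A < \<bar>t\<bar> \<Longrightarrow> k t \<le> k A"
  using k_antimono[of A t] k_causal[of t] k_nonneg[of A] by (cases "0 < t") auto

lemma klim_le: "\<omega> \<noteq> 0 \<Longrightarrow> cmod (klim k \<omega>) \<le> C * (1 + \<bar>\<omega>\<bar> powr (- p))"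
  by (rule tendsto_upperbound[OF tendsto_norm[OF ktrans_LIMSEQ]])
     (auto intro!: always_eventually ktrans_le)

lemma trunc_LIMSEQ: "(\<lambda>n. trunc k (real n) t) \<longlonglongrightarrow> of_real (k t)"
proof (rule tendsto_eventually)
  show "\<forall>\<^sub>F n in sequentially. trunc k (real n) t = of_real (k t)"
    using eventually_ge_at_top[of "nat \<lceil>t\<rceil>"]
    by eventually_elim (auto simp: trunc_def indicator_def)
qed

sublocale fwd: approx_kernel "\<lambda>t. of_real (k t)" "\<lambda>n. trunc k (real n)" "klim k" A "k A" C p
  by unfold_locales
     (use near_integrable far_le k_nonneg p01 ktrans_le ktrans_LIMSEQ trunc_LIMSEQ trunc_integrable in
       \<open>auto simp: ktrans_def trunc_def indicator_def\<close>)

text \<open>The weak equation contains a correlation instead of a convolution, and the noise the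
  even kernel \<open>k t + k (- t)\<close>. Both need the reflected kernel, whose transform is the
  conjugate since \<open>k\<close> is real.\<close>

sublocale bwd: approx_kernel "\<lambda>t. of_real (k (- t))" "\<lambda>n t. trunc k (real n) (- t)" "\<lambda>\<omega>. cnj (klim k \<omega>)" A "k A" C p
proof unfold_locales
  have [measurable]: "cnj \<in> borel_measurable borel"
    by (intro borel_measurable_continuous_onI continuous_intros)
  show "(\<lambda>\<omega>. cnj (klim k \<omega>)) \<in> borel_measurable borel"
    by measurable
  have ft: "ft (\<lambda>t. trunc k (real n) (- t)) \<omega> = cnj (ktrans k (real n) \<omega>)" for n \<omega>
    using lborel_integral_real_affine[of "-1" "\<lambda>t. cis (t * - \<omega>) * trunc k (real n) t" 0]
    unfolding ktrans_minus[symmetric] by (simp add: ft_def ktrans_def)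
  show "cmod (ft (\<lambda>t. trunc k (real n) (- t)) \<omega>) \<le> C * (1 + \<bar>\<omega>\<bar> powr - p)" if "\<omega> \<noteq> 0" for n \<omega>
    using ktrans_le[OF that] by (simp add: ft)
  show "(\<lambda>n. ft (\<lambda>t. trunc k (real n) (- t)) \<omega>) \<longlonglongrightarrow> cnj (klim k \<omega>)" if "\<omega> \<noteq> 0" for \<omega>
    unfolding ft by (intro tendsto_cnj ktrans_LIMSEQ that)
  show "integrable lborel (\<lambda>t. trunc k (real n) (- t))" for n
    using lborel_integrable_real_affine[OF trunc_integrable[of "real n"], of "-1" 0] by simp
  show "integrable lborel (\<lambda>t. indicator {-A..A} t * cmod (of_real (k (- t))))"
  proof -
    have "indicator {-A..A} (- t) = (indicator {-A..A} t :: real)" for t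
      by (auto simp: indicator_def)
    then show ?thesis
      using lborel_integrable_real_affine[OF near_integrable, of "-1" 0] by simp
  qed
  show "(\<lambda>n. trunc k (real n) (- t)) \<longlonglongrightarrow> of_real (k (- t))" for t
    by (rule trunc_LIMSEQ)
  show "cmod (of_real (k (- t))) \<le> k A" if "A < \<bar>t\<bar>" for t
    using far_le[of "- t"] that k_nonneg[of "- t"] by simp
qed (use p01 k_nonneg in \<open>auto simp: trunc_def indicator_def\<close>)

end

section \<open>The spectral density of the weak solution\<close>

lemma borel_measurable_lebesgue_AE:
  fixes f g :: "real \<Rightarrow> 'b::second_countable_topology"
  assumes [measurable]: "g \<in> borel_measurable borel" and ae: "AE x in lborel. f x = g x"
  shows "f \<in> borel_measurable lebesgue"
proof (rule measurableI)
  fix S :: "'b set" assume [measurable]: "S \<in> sets borel"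
  have ae': "AE x in lebesgue. x \<in> g -` S \<longleftrightarrow> x \<in> f -` S"
    using ae by (auto simp: AE_completion_iff)
  have "g -` S \<inter> space borel \<in> sets borel"
    by measurable
  then have "g -` S \<in> sets lebesgue"
    by (simp add: sets_completionI_sets)
  then show "f -` S \<inter> space lebesgue \<in> sets lebesgue"
    using complete_measure.in_sets_AE[OF completion.complete_measure_axioms ae'] by simp
qed simp

lemma integral_lebesgue_AE_eq:
  fixes f g :: "real \<Rightarrow> 'b::{banach, second_countable_topology}"
  assumes g: "g \<in> borel_measurable borel" and ae: "AE x in lborel. f x = g x"
  shows "(LINT x|lebesgue. f x) = (LINT x|lborel. g x)"
proof -
  have "(LINT x|lebesgue. f x) = (LINT x|lebesgue. g x)"
    by (rule integral_cong_AE)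
       (use ae g borel_measurable_lebesgue_AE[OF g ae] in \<open>auto simp: AE_completion_iff intro: measurable_completion\<close>)
  also have "\<dots> = (LINT x|lborel. g x)"
    by (rule integral_completion) (use g in simp)
  finally show ?thesis .
qed

subsection \<open>A Borel version of the memory kernel\<close>

text \<open>
  The kernel itself is only Lebesgue measurable, whereas Fubini's theorem is available for
  \<^const>\<open>lborel\<close>.
\<close>
lemma gle_kernel_borel_version:
  assumes K: "gle_kernel K"
  obtains k A where "tail_kernel k A" "AE t in lborel. real_kernel K t = k \<bar>t\<bar>"
    "\<And>t. A \<le> t \<Longrightarrow> k t = real_kernel K t" "\<And>t. A \<le> t \<Longrightarrow> 0 < k t"
    "\<And>\<omega>. \<omega> \<noteq> 0 \<Longrightarrow> 0 < Re (klim k \<omega>)"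
proof -
  let ?r = "real_kernel K"
  have fin: "\<bar>K t\<bar> \<noteq> \<infinity>" if "t \<noteq> 0" for t
    using K that by (auto simp: gle_kernel_def)
  have r_pos: "0 < ?r t" if "t \<noteq> 0" for t
    using K fin[OF that] that unfolding gle_kernel_def real_kernel_def
    by (cases "K t") auto
  have r_even: "?r (- t) = ?r t" for t
    using K by (simp add: gle_kernel_def real_kernel_def)
  obtain A0 where "antimono_on {A0..} K"
    using K by (auto simp: gle_kernel_def)
  then have anti: "K t \<le> K s" if "A0 \<le> s" "s \<le> t" for s t
    using that by (auto simp: monotone_on_def)
  \<comment> \<open>At least 1, so that the origin and its possible infinite value lie outside the
    monotone range.\<close>
  define A where "A = max A0 1"
  have A: "0 < A" "A0 \<le> A" by (auto simp: A_def)
  have r_anti: "?r t \<le> ?r s" if "A \<le> s" "s \<le> t" for s t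
    using anti[of s t] fin[of s] fin[of t] that A by (cases "K s"; cases "K t") (auto simp: real_kernel_def)
  have r_lim: "(?r \<longlongrightarrow> 0) at_top"
  proof -
    have "(K \<longlongrightarrow> ereal 0) at_top"
      using K by (simp add: gle_kernel_def zero_ereal_def)
    then show ?thesis
      unfolding real_kernel_def by (rule lim_real_of_ereal)
  qed
  have r_int: "?r absolutely_integrable_on {0..T}" for T
    using K by (simp add: gle_kernel_def locally_integrable_def)
  have r_int': "integrable lebesgue (\<lambda>t. indicator {0..T} t * ?r t)" for T
    using r_int[of T] by (simp add: set_integrable_def)
  obtain g where [measurable]: "g \<in> borel_measurable borel"
    and g: "AE t in lborel. indicator {0..A} t * ?r t = g t"
    using completion_ex_borel_measurable_real[OF borel_measurable_integrable[OF r_int'[of A]]] by auto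
  \<comment> \<open>Below \<open>A\<close> a Borel representative, clipped at 0 to be nonnegative
    everywhere; from \<open>A\<close> on the kernel itself, since the monotone function
    \<open>?r (max A t)\<close> is Borel.\<close>
  define k where "k t = (if t \<le> 0 then 0 else if t < A then max 0 (g t) else ?r (max A t))" for t
  have [measurable]: "(\<lambda>t. ?r (max A t)) \<in> borel_measurable borel"
  proof -
    have "mono (\<lambda>t. - ?r (max A t))"
      by (intro monoI) (auto intro!: r_anti)
    from borel_measurable_uminus[OF borel_measurable_mono[OF this]] show ?thesis by simp
  qed
  have k_meas [measurable]: "k \<in> borel_measurable borel"
    unfolding k_def by measurable
  have k_eq: "k t = ?r t" if "A \<le> t" for t
    using that A by (auto simp: k_def max_def)
  have k_ae: "AE t in lborel. 0 < t \<longrightarrow> k t = ?r t"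
    using g
  proof eventually_elim
    case (elim t)
    show ?case
    proof (cases "t < A")
      case True
      then show ?thesis
        using elim r_pos[of t] by (auto simp: k_def)
    qed (use k_eq in auto)
  qed
  have k_T: "AE t in lborel. indicator {..T} t * k t = indicator {0..T} t * ?r t" for T
    using k_ae AE_lborel_singleton[of 0]
    by eventually_elim (auto simp: indicator_def k_def)
  interpret k: tail_kernel k A
  proof
    show "integrable lborel (\<lambda>t. indicator {..T} t * k t)" for T
    proof -
      have "AE t in lebesgue. indicator {0..T} t * ?r t = indicator {..T} t * k t"
        unfolding AE_completion_iff using k_T[of T] by eventually_elim (rule sym)
      then have "integrable lebesgue (\<lambda>t. indicator {..T} t * k t)"
        by (rule integrable_cong_AE_imp[OF r_int'[of T], rotated]) (auto intro!: measurable_completion)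
      then show ?thesis
        by (simp add: integrable_completion)
    qed
    show "k t \<le> k s" if "A \<le> s" "s \<le> t" for s t
      using r_anti[OF that] that by (simp add: k_eq)
    show "(k \<longlongrightarrow> 0) at_top"
      by (rule Lim_transform_eventually[OF r_lim])
         (rule eventually_mono[OF eventually_ge_at_top[of A] k_eq[symmetric]])
    show "0 \<le> k t" for t
      using r_pos[of "max A t"] A by (auto simp: k_def less_imp_le)
  qed (use A in \<open>auto simp: k_def\<close>)
  have even: "AE t in lborel. ?r t = k \<bar>t\<bar>"
  proof -
    \<comment> \<open>Reflection preserves Lebesgue null sets, so the identity on the positive
      half-line passes to the negative one.\<close>
    have "AE t in lborel. 0 < - t \<longrightarrow> k (- t) = ?r (- t)"
      by (rule AE_distrD[of uminus lborel borel]) (use k_ae in \<open>simp_all only: lborel_distr_uminus, measurable\<close>)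
    then show ?thesis
      using k_ae AE_lborel_singleton[of 0]
      by eventually_elim (use r_even in \<open>auto simp: abs_if\<close>)
  qed
  have pos: "0 < Re (klim k \<omega>)" if "\<omega> \<noteq> 0" for \<omega>
  proof -
    have "\<forall>\<omega>. \<omega> \<noteq> 0 \<longrightarrow> (\<exists>I>0. has_improper_integral (\<lambda>t. ?r t * cos (t * \<omega>)) I)"
      using K by (simp add: gle_kernel_def)
    then obtain I where "0 < I" and I: "has_improper_integral (\<lambda>t. ?r t * cos (t * \<omega>)) I"
      using \<open>\<omega> \<noteq> 0\<close> by blast
    have "integral {0..T} (\<lambda>t. ?r t * cos (t * \<omega>)) = Re (ktrans k T \<omega>)" for T
    proof -
      have "(\<lambda>t. ?r t * cos (t * \<omega>)) absolutely_integrable_on {0..T}"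
      proof -
        have ae: "AE t in lborel. indicator {0..T} t * (?r t * cos (t * \<omega>)) = indicator {..T} t * (k t * cos (t * \<omega>))"
          using k_T[of T] by eventually_elim (auto simp: indicator_def)
        have "integrable lebesgue (\<lambda>t. indicator {..T} t * (k t * cos (t * \<omega>)))"
          by (subst integrable_completion) (auto intro!: k.integrable_trunc_mult)
        then have "integrable lebesgue (\<lambda>t. indicator {0..T} t * (?r t * cos (t * \<omega>)))"
        proof (rule integrable_cong_AE_imp)
          show "(\<lambda>t. indicator {0..T} t * (?r t * cos (t * \<omega>))) \<in> borel_measurable lebesgue"
            by (rule borel_measurable_lebesgue_AE[OF _ ae]) measurable
          show "AE t in lebesgue. indicator {..T} t * (k t * cos (t * \<omega>)) = indicator {0..T} t * (?r t * cos (t * \<omega>))"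
            unfolding AE_completion_iff using ae by eventually_elim (rule sym)
        qed
        then show ?thesis by (simp add: set_integrable_def)
      qed
      then have "integral {0..T} (\<lambda>t. ?r t * cos (t * \<omega>)) = (LINT t|lebesgue. indicator {0..T} t * (?r t * cos (t * \<omega>)))"
        by (simp add: set_lebesgue_integral_eq_integral(2)[symmetric] set_lebesgue_integral_def)
      also have "\<dots> = (LINT t|lborel. indicator {..T} t * (k t * cos (t * \<omega>)))"
        by (rule integral_lebesgue_AE_eq) (use k_T[of T] in \<open>auto elim!: eventually_mono simp: indicator_def\<close>)
      finally show ?thesis by (simp add: k.Re_ktrans)
    qed
    \<comment> \<open>The positive improper integral of the hypothesis and the real part of
      \<open>klim\<close> are limits of the same function of \<open>T\<close>.\<close>
    then have "((\<lambda>T. Re (ktrans k T \<omega>)) \<longlongrightarrow> I) at_top"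
      using I by (simp add: has_improper_integral_def)
    moreover have "((\<lambda>T. Re (ktrans k T \<omega>)) \<longlongrightarrow> Re (klim k \<omega>)) at_top"
      by (intro tendsto_Re k.ktrans_tendsto that)
    ultimately have "Re (klim k \<omega>) = I"
      using tendsto_unique trivial_limit_at_top_linorder by blast
    then show ?thesis using \<open>0 < I\<close> by simp
  qed
  show thesis
    by (rule that[OF k.tail_kernel_axioms even k_eq _ pos]) (use k_eq r_pos A in auto)
qed

subsection \<open>The weak solution in the frequency domain\<close>

definition spectral_denominator :: "real \<Rightarrow> real \<Rightarrow> complex \<Rightarrow> real \<Rightarrow> real" where
  "spectral_denominator m \<beta> z \<omega> = (\<beta> * Re z)\<^sup>2 + (m * \<omega> - \<beta> * Im z)\<^sup>2"

text \<open>
  The absolute value only matters at \<open>\<omega> = 0\<close>, where \<^const>\<open>klim\<close> may be the limit of a divergent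
  sequence.
\<close>
definition spectral_density :: "real \<Rightarrow> real \<Rightarrow> (real \<Rightarrow> real) \<Rightarrow> real \<Rightarrow> real" where
  "spectral_density m \<beta> k \<omega> =
     \<beta> * \<bar>Re (klim k \<omega>)\<bar> / (pi * spectral_denominator m \<beta> (klim k \<omega>) \<omega>)"

lemma norm_ft_indicator:
  assumes "0 \<le> t" "\<omega> \<noteq> 0"
  shows "(cmod (ft (indicator {0..t}) \<omega>))\<^sup>2 = 2 * (1 - cos (t * \<omega>)) / \<omega>\<^sup>2"
proof -
  have "(LINT s|lborel. indicator {0..t} s *\<^sub>R cis (\<omega> * s)) = cis (\<omega> * t) / (\<i> * of_real \<omega>) - cis (\<omega> * 0) / (\<i> * of_real \<omega>)"
  proof (rule integral_FTC_Icc[OF assms(1)])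
    fix s
    have "((\<lambda>s. cis (\<omega> * s) / (\<i> * of_real \<omega>)) has_vector_derivative (\<i> * of_real \<omega> * cis (\<omega> * s)) / (\<i> * of_real \<omega>)) (at s)"
      by (intro has_vector_derivative_divide has_vector_derivative_cis)
    then show "((\<lambda>s. cis (\<omega> * s) / (\<i> * of_real \<omega>)) has_vector_derivative cis (\<omega> * s)) (at s within {0..t})"
      using assms(2) by (simp add: has_vector_derivative_at_within)
  qed (intro continuous_intros)
  moreover have "ft (indicator {0..t}) \<omega> = (LINT s|lborel. indicator {0..t} s *\<^sub>R cis (\<omega> * s))"
    unfolding ft_def by (intro Bochner_Integration.integral_cong) (auto simp: indicator_def mult.commute)
  ultimately have "ft (indicator {0..t}) \<omega> = (cis (\<omega> * t) - 1) / (\<i> * of_real \<omega>)"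
    by (simp add: diff_divide_distrib)
  then have "(cmod (ft (indicator {0..t}) \<omega>))\<^sup>2 = (cmod (cis (\<omega> * t) - 1))\<^sup>2 / \<omega>\<^sup>2"
    by (simp add: norm_divide norm_mult power_divide)
  also have "(cmod (cis (\<omega> * t) - 1))\<^sup>2 = 2 * (1 - cos (t * \<omega>))"
  proof -
    have "(cmod (cis (\<omega> * t) - 1))\<^sup>2 = (cos (t * \<omega>) - 1)\<^sup>2 + (sin (t * \<omega>))\<^sup>2"
      by (simp add: cmod_power2 mult.commute)
    also have "\<dots> = (sin (t * \<omega>))\<^sup>2 + (cos (t * \<omega>))\<^sup>2 + 1 - 2 * cos (t * \<omega>)"
      by (simp add: power2_eq_square algebra_simps)
    finally show ?thesis by simp
  qed
  finally show ?thesis .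
qed

text \<open>The trivial bound \<open>t^2\<close> and the bound \<open>4 / \<omega>^2\<close> from
  the explicit formula combine to a multiple of \<open>1 / (1 + \<omega>^2)\<close>.\<close>

lemma integrable_norm_ft_indicator:
  assumes "0 \<le> t"
  shows "integrable lborel (\<lambda>\<omega>. (cmod (ft (indicator {0..t}) \<omega>))\<^sup>2)"
proof -
  have [measurable]: "ft (indicator {0..t}) \<in> borel_measurable borel"
    by measurable
  have le: "(cmod (ft (indicator {0..t}) \<omega>))\<^sup>2 \<le> (t\<^sup>2 + 4) * inverse (1 + \<omega>\<^sup>2)" for \<omega>
  proof -
    have "cmod (ft (indicator {0..t}) \<omega>) \<le> (LINT s|lborel. cmod (indicator {0..t} s))"
      by (rule norm_ft_le)
    also have "(\<lambda>s. cmod (indicator {0..t} s)) = (indicator {0..t} :: real \<Rightarrow> real)"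
      by (auto simp: indicator_def)
    also have "(LINT s|lborel. indicator {0..t} s) = t"
      using assms by simp
    finally have 1: "(cmod (ft (indicator {0..t}) \<omega>))\<^sup>2 \<le> t\<^sup>2"
      by (intro power_mono) auto
    have 2: "\<omega>\<^sup>2 * (cmod (ft (indicator {0..t}) \<omega>))\<^sup>2 \<le> 4"
    proof (cases "\<omega> = 0")
      case False
      have "\<omega>\<^sup>2 * (cmod (ft (indicator {0..t}) \<omega>))\<^sup>2 = 2 * (1 - cos (t * \<omega>))"
        using False by (simp add: norm_ft_indicator[OF assms False])
      also have "\<dots> \<le> 2 * 2"
        using cos_ge_minus_one[of "t * \<omega>"] by (intro mult_left_mono) auto
      also have "\<dots> = 4" by simp
      finally show ?thesis .
    qed simp
    have pos: "0 < 1 + \<omega>\<^sup>2" by (simp add: add_pos_nonneg)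
    from 1 2 have "(1 + \<omega>\<^sup>2) * (cmod (ft (indicator {0..t}) \<omega>))\<^sup>2 \<le> t\<^sup>2 + 4"
      by (simp add: distrib_right)
    then show ?thesis
      using pos by (simp add: field_simps)
  qed
  show ?thesis
    by (rule Bochner_Integration.integrable_bound[OF integrable_mult_right[OF integrable_inverse_quad, of "t\<^sup>2 + 4"]])
       (auto intro!: AE_I2 le)
qed

section \<open>Identification of the spectral measure\<close>

locale gle_solution = bounded_kernel k A C s for k :: "real \<Rightarrow> real" and A C s :: real +
  fixes K :: "real \<Rightarrow> real" and m \<beta> :: real
    and M :: "'w measure"
    and F :: "(real \<Rightarrow> complex) \<Rightarrow> 'w \<Rightarrow> complex"
    and V :: "((real \<Rightarrow> complex) \<Rightarrow> complex) \<Rightarrow> 'w \<Rightarrow> complex"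
  assumes K_eq: "AE t in lborel. K t = k \<bar>t\<bar>"
    and klim_pos: "\<And>\<omega>. \<omega> \<noteq> 0 \<Longrightarrow> 0 < Re (klim k \<omega>)"
    and m_pos: "0 < m" and \<beta>_pos: "0 < \<beta>"
    and noise: "gle_noise M K F"
    and weak: "gle_weak_solution M m \<beta> K F V"
begin

abbreviation "L \<equiv> klim k"
abbreviation "g h \<equiv> gaussian h 0"

lemma K_split: "AE t in lborel. K t = k t + k (- t)"
  using K_eq by eventually_elim (use k_causal in \<open>auto simp: abs_if\<close>)

lemma denominator_pos: "\<omega> \<noteq> 0 \<Longrightarrow> 0 < spectral_denominator m \<beta> (L \<omega>) \<omega>"
  using klim_pos[of \<omega>] \<beta>_pos by (auto simp: spectral_denominator_def intro!: add_pos_nonneg)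

lemma convol_causal:
  assumes [measurable]: "\<phi> \<in> borel_measurable borel"
  shows "convol (causal_part K) \<phi> = lborel_convol (\<lambda>t. of_real (k t)) \<phi>"
proof
  fix t
  show "convol (causal_part K) \<phi> t = lborel_convol (\<lambda>t. of_real (k t)) \<phi> t"
    unfolding convol_def lborel_convol_def
  proof (rule integral_lebesgue_AE_eq)
    show "AE s in lborel. causal_part K s * \<phi> (t - s) = of_real (k s) * \<phi> (t - s)"
      using K_eq by eventually_elim (use k_causal in \<open>auto simp: causal_part_def\<close>)
  qed measurable
qed

text \<open>The two reflections turn the causal convolution into
  \<open>\<integral> k u \<phi> (t + u) du\<close>, a convolution with the reflected kernel; hence
  the conjugate of \<open>L\<close> in \<open>H\<close>.\<close>

lemma gle_test_eq:
  assumes \<phi>: "\<phi> \<in> schwartz"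
  shows "gle_test m \<beta> K \<phi> = (\<lambda>t. - of_real m * vderiv \<phi> t + of_real \<beta> * lborel_convol (\<lambda>t. of_real (k (- t))) \<phi> t)"
proof
  fix t
  note [measurable] = schwartz_borel_measurable[OF \<phi>]
  have [measurable]: "reflect \<phi> \<in> borel_measurable borel"
    unfolding reflect_def[abs_def] by measurable
  have "reflect (convol (causal_part K) (reflect \<phi>)) t = (LINT s|lborel. of_real (k s) * \<phi> (t + s))"
    by (simp add: reflect_def convol_causal) (simp add: lborel_convol_def reflect_def add.commute)
  also have "\<dots> = lborel_convol (\<lambda>t. of_real (k (- t))) \<phi> t"
    using lborel_integral_real_affine[of "-1" "\<lambda>s. of_real (k s) * \<phi> (t + s)" 0] by (simp add: lborel_convol_def)
  finally show "gle_test m \<beta> K \<phi> t = - of_real m * vderiv \<phi> t + of_real \<beta> * lborel_convol (\<lambda>t. of_real (k (- t))) \<phi> t"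
    by (simp add: gle_test_def)
qed

text \<open>The transform of the test function in the weak equation: \<open>- m \<phi>'\<close>
  contributes \<open>\<i> m \<omega>\<close>, the correlation with \<open>K\<^sup>+\<close>
  contributes \<open>\<beta> cnj L\<close>. The factor is the conjugate of
  \<open>\<beta> L - \<i> m \<omega>\<close>.\<close>

definition H :: "(real \<Rightarrow> complex) \<Rightarrow> real \<Rightarrow> complex" where
  "H \<phi> \<omega> = (\<i> * of_real (m * \<omega>) + of_real \<beta> * cnj (L \<omega>)) * ft \<phi> \<omega>"

lemma norm_H: "(cmod (\<i> * of_real (m * \<omega>) + of_real \<beta> * cnj z))\<^sup>2 = spectral_denominator m \<beta> z \<omega>"
  by (simp add: cmod_power2 spectral_denominator_def)

lemma gle_test_represented:
  assumes \<phi>: "\<phi> \<in> schwartz"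
  shows "fun_dist (gle_test m \<beta> K \<phi>) \<in> tempered"
    and "represented_by (dist_fourier (fun_dist (gle_test m \<beta> K \<phi>))) (H \<phi>)"
proof -
  let ?c = "lborel_convol (\<lambda>t. of_real (k (- t))) \<phi>"
  note [measurable] = schwartz_borel_measurable[OF \<phi>] schwartz_borel_measurable[OF schwartz_vderiv[OF \<phi>]]
    bwd.lborel_convol_measurable[OF \<phi>] bwd.\<Lambda>_measurable
  have [measurable]: "gle_test m \<beta> K \<phi> \<in> borel_measurable borel"
    unfolding gle_test_eq[OF \<phi>] by measurable
  obtain b1 where b1: "\<And>x. cmod (?c x) \<le> b1"
    using bwd.lborel_convol_bounded[OF \<phi>] by blast
  obtain b2 where b2: "\<And>x. cmod (vderiv \<phi> x) \<le> b2"
    using schwartz_bounded[OF schwartz_vderiv[OF \<phi>], of 0] by (auto simp: bounded_iff)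
  have "cmod (gle_test m \<beta> K \<phi> x) \<le> m * b2 + \<beta> * b1" for x
  proof -
    have "cmod (gle_test m \<beta> K \<phi> x) \<le> cmod (- of_real m * vderiv \<phi> x) + cmod (of_real \<beta> * ?c x)"
      unfolding gle_test_eq[OF \<phi>] by (rule norm_triangle_ineq)
    also have "\<dots> \<le> m * b2 + \<beta> * b1"
      using b1[of x] b2[of x] m_pos \<beta>_pos by (intro add_mono) (auto simp: norm_mult intro!: mult_left_mono)
    finally show ?thesis .
  qed
  then show "fun_dist (gle_test m \<beta> K \<phi>) \<in> tempered"
    by (intro fun_dist_tempered) auto
  have [measurable]: "H \<phi> \<in> borel_measurable borel"
    unfolding H_def by measurable
  show "represented_by (dist_fourier (fun_dist (gle_test m \<beta> K \<phi>))) (H \<phi>)"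
    unfolding represented_by_fourier_iff[OF \<open>gle_test m \<beta> K \<phi> \<in> borel_measurable borel\<close>]
  proof (intro conjI ballI)
    fix \<psi> assume \<psi>: "\<psi> \<in> schwartz"
    note \<phi>' = schwartz_vderiv[OF \<phi>]
    note mf = ft_multiplication_formula[OF schwartz_integrable[OF \<phi>'] schwartz_integrable[OF \<psi>]]
    have Heq: "H \<phi> \<omega> * \<psi> \<omega> = - of_real m * (ft (vderiv \<phi>) \<omega> * \<psi> \<omega>) + of_real \<beta> * (cnj (L \<omega>) * ft \<phi> \<omega> * \<psi> \<omega>)" for \<omega>
      by (simp add: H_def ft_vderiv[OF \<phi>] algebra_simps)
    show "integrable lborel (\<lambda>x. H \<phi> x * \<psi> x)"
      unfolding Heq by (intro Bochner_Integration.integrable_add integrable_mult_right mf bwd.pairing \<phi> \<psi>)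
    have ic: "integrable lborel (\<lambda>x. ?c x * ft \<psi> x)"
      by (rule integrable_bounded_mult_schwartz[OF _ b1 ft_schwartz[OF \<psi>]]) measurable
    have "(LINT x|lborel. gle_test m \<beta> K \<phi> x * ft \<psi> x)
        = (LINT x|lborel. - of_real m * (vderiv \<phi> x * ft \<psi> x) + of_real \<beta> * (?c x * ft \<psi> x))"
      unfolding gle_test_eq[OF \<phi>] by (simp add: algebra_simps)
    also have "\<dots> = - of_real m * (LINT x|lborel. vderiv \<phi> x * ft \<psi> x) + of_real \<beta> * (LINT x|lborel. ?c x * ft \<psi> x)"
      using mf(1) ic by simp
    also have "\<dots> = - of_real m * (LINT x|lborel. ft (vderiv \<phi>) x * \<psi> x) + of_real \<beta> * (LINT \<omega>|lborel. cnj (L \<omega>) * ft \<phi> \<omega> * \<psi> \<omega>)"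
      unfolding mf(3) bwd.pairing(4)[OF \<phi> \<psi>] by (rule refl)
    also have "\<dots> = (LINT \<omega>|lborel. H \<phi> \<omega> * \<psi> \<omega>)"
      unfolding Heq using mf(2) bwd.pairing(1)[OF \<phi> \<psi>] by simp
    finally show "(LINT x|lborel. gle_test m \<beta> K \<phi> x * ft \<psi> x) = (LINT \<omega>|lborel. H \<phi> \<omega> * \<psi> \<omega>)" .
  qed measurable
qed

text \<open>The causal half of the kernel contributes \<open>L\<close>, its reflection
  \<open>cnj L\<close>, together \<open>2 Re L\<close>. The absolute value changes nothing off the
  origin and makes the density nonnegative everywhere.\<close>

lemma noise_covariance:
  "(LINT w|M. F (g h) w * cnj (F (g 0) w)) =
    (LINT \<omega>|lborel. of_real (2 * \<bar>Re (L \<omega>)\<bar> * exp (- \<omega>\<^sup>2)) * cis (h * \<omega>))"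
proof -
  \<comment> \<open>Chosen so that its transform is the translate \<open>g h\<close>; the noise
    covariance then has the shape treated by the pairing lemma.\<close>
  define \<gamma> where "\<gamma> x = of_real (1 / sqrt (2 * pi)) * gaussian 0 (- h) x" for x
  have \<gamma>: "\<gamma> \<in> schwartz"
    unfolding \<gamma>_def by (intro schwartz_cmult gaussian_schwartz)
  have ft_\<gamma>: "ft \<gamma> x = g h x" for x
    unfolding \<gamma>_def ft_cmult ft_gaussian_modulated by simp
  note g0 = gaussian_schwartz[of 0 0]
  let ?\<Phi> = "\<lambda>s. LINT x|lborel. g 0 (x - s) * ft \<gamma> x"
  have [measurable]: "ft \<gamma> \<in> borel_measurable borel"
    by (rule ft_measurable[OF schwartz_borel_measurable[OF \<gamma>]])
  have convol: "convol (g h) (\<lambda>s. cnj (g 0 (- s))) t = ?\<Phi> t" for t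
  proof -
    have "convol (g h) (\<lambda>s. cnj (g 0 (- s))) t = (LINT s|lborel. g h s * cnj (g 0 (- (t - s))))"
      unfolding convol_def by (intro integral_completion) (simp add: gaussian_def)
    also have "\<dots> = ?\<Phi> t"
      by (intro Bochner_Integration.integral_cong) (simp_all add: ft_\<gamma> gaussian_def mult.commute)
    finally show ?thesis .
  qed
  have "(LINT w|M. F (g h) w * cnj (F (g 0) w)) = (LINT t|lebesgue. of_real (K t) * ?\<Phi> t)"
    using noise gaussian_schwartz by (simp add: gle_noise_def convol)
  also have "\<dots> = (LINT t|lborel. of_real (k t) * ?\<Phi> t + of_real (k (- t)) * ?\<Phi> t)"
  proof (rule integral_lebesgue_AE_eq)
    show "AE t in lborel. of_real (K t) * ?\<Phi> t = of_real (k t) * ?\<Phi> t + of_real (k (- t)) * ?\<Phi> t"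
      using K_split by eventually_elim (simp add: distrib_right)
  qed measurable
  also have "\<dots> = (LINT t|lborel. of_real (k t) * ?\<Phi> t) + (LINT t|lborel. of_real (k (- t)) * ?\<Phi> t)"
    by (rule Bochner_Integration.integral_add[OF fwd.pairing(2)[OF g0 \<gamma>] bwd.pairing(2)[OF g0 \<gamma>]])
  also have "\<dots> = (LINT \<omega>|lborel. L \<omega> * ft (g 0) \<omega> * \<gamma> \<omega>) + (LINT \<omega>|lborel. cnj (L \<omega>) * ft (g 0) \<omega> * \<gamma> \<omega>)"
    unfolding fwd.pairing(3)[OF g0 \<gamma>] bwd.pairing(3)[OF g0 \<gamma>] by (rule refl)
  also have "\<dots> = (LINT \<omega>|lborel. L \<omega> * ft (g 0) \<omega> * \<gamma> \<omega> + cnj (L \<omega>) * ft (g 0) \<omega> * \<gamma> \<omega>)"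
    by (rule Bochner_Integration.integral_add[OF fwd.pairing(1)[OF g0 \<gamma>] bwd.pairing(1)[OF g0 \<gamma>], symmetric])
  \<comment> \<open>The pairing produces the phase \<open>cis (- h * \<omega>)\<close>; reflecting
    the variable gives it the sign of a characteristic function.\<close>
  also have "\<dots> = (LINT \<omega>|lborel. L (- \<omega>) * ft (g 0) (- \<omega>) * \<gamma> (- \<omega>) + cnj (L (- \<omega>)) * ft (g 0) (- \<omega>) * \<gamma> (- \<omega>))"
    using lborel_integral_real_affine[of "-1" "\<lambda>\<omega>. L \<omega> * ft (g 0) \<omega> * \<gamma> \<omega> + cnj (L \<omega>) * ft (g 0) \<omega> * \<gamma> \<omega>" 0] by simp
  also have "\<dots> = (LINT \<omega>|lborel. of_real (2 * \<bar>Re (L \<omega>)\<bar> * exp (- \<omega>\<^sup>2)) * cis (h * \<omega>))"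
  proof (rule integral_cong_AE)
    note [measurable] = schwartz_borel_measurable[OF \<gamma>] bwd.\<Lambda>_measurable
    show "(\<lambda>\<omega>. L (- \<omega>) * ft (g 0) (- \<omega>) * \<gamma> (- \<omega>) + cnj (L (- \<omega>)) * ft (g 0) (- \<omega>) * \<gamma> (- \<omega>)) \<in> borel_measurable lborel"
      by measurable
    show "AE \<omega> in lborel. L (- \<omega>) * ft (g 0) (- \<omega>) * \<gamma> (- \<omega>) + cnj (L (- \<omega>)) * ft (g 0) (- \<omega>) * \<gamma> (- \<omega>)
        = of_real (2 * \<bar>Re (L \<omega>)\<bar> * exp (- \<omega>\<^sup>2)) * cis (h * \<omega>)"
      using AE_lborel_singleton[of 0]
    proof eventually_elim
      case (elim \<omega>)
      have e: "exp (- \<omega>\<^sup>2) = exp (- \<omega>\<^sup>2 / 2) * exp (- \<omega>\<^sup>2 / 2)"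
        by (simp add: exp_add[symmetric])
      have "L (- \<omega>) * ft (g 0) (- \<omega>) * \<gamma> (- \<omega>) + cnj (L (- \<omega>)) * ft (g 0) (- \<omega>) * \<gamma> (- \<omega>)
          = (L \<omega> + cnj (L \<omega>)) * (ft (g 0) (- \<omega>) * \<gamma> (- \<omega>))"
        using klim_minus[OF elim] by (simp add: algebra_simps)
      also have "ft (g 0) (- \<omega>) * \<gamma> (- \<omega>) = of_real (exp (- \<omega>\<^sup>2)) * cis (h * \<omega>)"
        unfolding e by (simp add: \<gamma>_def ft_gaussian_0 gaussian_def)
      also have "L \<omega> + cnj (L \<omega>) = of_real (2 * \<bar>Re (L \<omega>)\<bar>)"
        using klim_pos[OF elim] by (simp add: complex_add_cnj)
      finally show ?case by simp
    qed
  qed measurable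
  finally show ?thesis .
qed

lemma spectral_density_measurable [measurable]: "spectral_density m \<beta> k \<in> borel_measurable borel"
  unfolding spectral_density_def spectral_denominator_def by measurable

text \<open>Gaussian tests give \<open>p d\<nu> = q d\<omega>\<close> as finite measures. Dividing
  by \<open>p\<close>, which vanishes at most at the origin, a null set of \<open>\<nu>\<close>,
  identifies \<open>\<nu>\<close>. The bound \<open>b\<close> secures that the indicator of
  \<open>{0..t}\<close> lies in the domain of \<open>V\<close>.\<close>

theorem position_second_moment:
  assumes b: "\<And>\<omega>. \<omega> \<noteq> 0 \<Longrightarrow> spectral_density m \<beta> k \<omega> \<le> b" and t: "0 \<le> t"
  shows "(LINT w|M. (cmod (position_process V t w))\<^sup>2) =
    (LINT \<omega>|lborel. (cmod (ft (indicator {0..t}) \<omega>))\<^sup>2 * spectral_density m \<beta> k \<omega>)"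
proof -
  let ?D = "\<lambda>\<omega>. spectral_denominator m \<beta> (L \<omega>) \<omega>"
  obtain \<nu> where so: "spectral_operator M \<nu> V"
    and dom: "\<And>\<phi>. \<phi> \<in> schwartz \<Longrightarrow> fun_dist (convol (causal_part K) \<phi>) \<in> spectral_dom \<nu>"
    and weak_eq: "\<And>\<phi> \<psi>. \<phi> \<in> schwartz \<Longrightarrow> \<psi> \<in> schwartz \<Longrightarrow>
           (LINT w|M. V (fun_dist (gle_test m \<beta> K \<phi>)) w * cnj (V (fun_dist (gle_test m \<beta> K \<psi>)) w)) =
           (LINT w|M. (of_real (sqrt \<beta>) * F \<phi> w) * cnj (of_real (sqrt \<beta>) * F \<psi> w))"
    using weak unfolding gle_weak_solution_def by blast
  obtain j :: int where sets_\<nu>: "sets \<nu> = sets borel" and ac: "absolutely_continuous lborel \<nu>"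
    and j: "integrable \<nu> (\<lambda>x. (1 + x\<^sup>2) powi (- j))"
    using so unfolding spectral_operator_def tempered_spectral_measure_def by blast
  have cov: "(LINT w|M. V g\<^sub>1 w * cnj (V g\<^sub>2 w)) = (LINT \<omega>|\<nu>. h\<^sub>1 \<omega> * cnj (h\<^sub>2 \<omega>))"
    if "g\<^sub>1 \<in> spectral_dom \<nu>" "g\<^sub>2 \<in> spectral_dom \<nu>" "represented_by (dist_fourier g\<^sub>1) h\<^sub>1" "represented_by (dist_fourier g\<^sub>2) h\<^sub>2"
    for g\<^sub>1 g\<^sub>2 h\<^sub>1 h\<^sub>2
    using so that unfolding spectral_operator_def by blast
  note [measurable_cong] = sets_\<nu>
  note [measurable] = klim_measurable
  have [measurable]: "?D \<in> borel_measurable borel"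
    unfolding spectral_denominator_def by measurable
  have AE_\<nu>: "AE x in \<nu>. P x" if "AE x in lborel. P x" for P
    by (rule absolutely_continuous_AE[OF _ ac that]) (simp add: sets_\<nu>)
  have nz: "AE x in \<nu>. x \<noteq> 0"
    by (rule AE_\<nu>[OF AE_lborel_singleton])
  have D_nonneg: "0 \<le> ?D \<omega>" for \<omega>
    by (simp add: spectral_denominator_def)
  have norm_ft_g: "(cmod (ft (g h) \<omega>))\<^sup>2 = 2 * pi * exp (- \<omega>\<^sup>2)" for h \<omega>
    by (simp add: ft_gaussian_shift norm_mult norm_gaussian power_mult_distrib exp_double[symmetric])
  \<comment> \<open>Near 0 the factor \<open>|L|\<^sup>2\<close> can be unbounded, so this needs \<open>K\<^sup>+ * \<phi> \<in> Dom(V)\<close>.\<close>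
  have L2: "integrable \<nu> (\<lambda>\<omega>. (cmod (L \<omega>))\<^sup>2 * exp (- \<omega>\<^sup>2))"
  proof -
    obtain h where h: "represented_by (dist_fourier (fun_dist (convol (causal_part K) (g 0)))) h"
      and h2: "square_integrable \<nu> h"
      using dom[OF gaussian_schwartz[of 0 0]] by (auto simp: spectral_dom_def)
    have "AE \<omega> in lborel. h \<omega> = L \<omega> * ft (g 0) \<omega>"
      using represented_by_unique[OF h[unfolded convol_causal[OF gaussian_measurable]] fwd.represented_by_lborel_convol[OF gaussian_schwartz]] .
    then have "AE \<omega> in \<nu>. h \<omega> = L \<omega> * ft (g 0) \<omega>"
      by (rule AE_\<nu>)
    then have ae: "AE \<omega> in \<nu>. (cmod (h \<omega>))\<^sup>2 / (2 * pi) = (cmod (L \<omega>))\<^sup>2 * exp (- \<omega>\<^sup>2)"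
      by eventually_elim (simp add: norm_mult power_mult_distrib norm_ft_g)
    have "integrable \<nu> (\<lambda>\<omega>. (cmod (h \<omega>))\<^sup>2 / (2 * pi))"
      using h2 unfolding square_integrable_def by (intro integrable_divide) auto
    then show ?thesis
      by (rule integrable_cong_AE_imp[OF _ _ ae]) measurable
  qed
  have X2: "integrable \<nu> (\<lambda>\<omega>. \<omega>\<^sup>2 * exp (- \<omega>\<^sup>2))"
  proof -
    \<comment> \<open>The integer \<open>j\<close> of the temperedness condition may have either
      sign; its absolute value covers both. The Gaussian beats the power through
      \<open>y^(n + 1) \<le> (n + 1)! e^y\<close> at \<open>y = 1 + \<omega>^2\<close>.\<close>
    let ?n = "nat \<bar>j\<bar>"
    have le: "\<omega>\<^sup>2 * exp (- \<omega>\<^sup>2) \<le> (fact (Suc ?n) * exp 1) * (1 + \<omega>\<^sup>2) powi (- j)" for \<omega> :: real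
    proof -
      have ge1: "1 \<le> 1 + \<omega>\<^sup>2" by simp
      have "\<omega>\<^sup>2 * (1 + \<omega>\<^sup>2) ^ ?n \<le> (1 + \<omega>\<^sup>2) ^ Suc ?n"
        by (simp add: mult_right_mono)
      also have "\<dots> \<le> fact (Suc ?n) * exp (1 + \<omega>\<^sup>2)"
        by (rule power_le_fact_exp) simp
      finally have *: "\<omega>\<^sup>2 * (1 + \<omega>\<^sup>2) ^ ?n * exp (- \<omega>\<^sup>2) \<le> fact (Suc ?n) * exp 1"
        by (simp add: exp_add exp_minus field_simps)
      have "(1 + \<omega>\<^sup>2) powi (- int ?n) \<le> (1 + \<omega>\<^sup>2) powi (- j)"
        by (rule power_int_increasing) (use ge1 in auto)
      then have "inverse ((1 + \<omega>\<^sup>2) ^ ?n) \<le> (1 + \<omega>\<^sup>2) powi (- j)"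
        by (simp only: power_int_minus power_int_of_nat)
      from mult_left_mono[OF this, of "fact (Suc ?n) * exp 1"]
      have "(fact (Suc ?n) * exp 1) * inverse ((1 + \<omega>\<^sup>2) ^ ?n) \<le> (fact (Suc ?n) * exp 1) * (1 + \<omega>\<^sup>2) powi (- j)"
        by simp
      moreover have "\<omega>\<^sup>2 * exp (- \<omega>\<^sup>2) \<le> (fact (Suc ?n) * exp 1) * inverse ((1 + \<omega>\<^sup>2) ^ ?n)"
      proof -
        have "0 < (1 + \<omega>\<^sup>2) ^ ?n" using ge1 by (intro zero_less_power) linarith
        with * show ?thesis by (simp add: divide_inverse[symmetric] pos_le_divide_eq mult_ac)
      qed
      ultimately show ?thesis by linarith
    qed
    show ?thesis
      by (rule Bochner_Integration.integrable_bound[OF integrable_mult_right[OF j, of "fact (Suc ?n) * exp 1"]])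
         (auto intro!: AE_I2 le simp del: fact_Suc)
  qed
  \<comment> \<open>\<open>p\<close> is \<open>|H|^2\<close> for a Gaussian test function,
    \<open>q\<close> is \<open>\<beta>\<close> times the spectral density of the noise weighted by
    the same Gaussians.\<close>
  define p q where "p \<omega> = 2 * pi * (?D \<omega> * exp (- \<omega>\<^sup>2))" and "q \<omega> = 2 * \<beta> * (\<bar>Re (L \<omega>)\<bar> * exp (- \<omega>\<^sup>2))" for \<omega>
  have [measurable]: "p \<in> borel_measurable borel" "q \<in> borel_measurable borel"
    unfolding p_def q_def by measurable
  have p_int: "integrable \<nu> p"
  proof -
    \<comment> \<open>\<open>(x - y)^2 \<le> 2 x^2 + 2 y^2\<close> separates the inertial term from
      \<open>L\<close>; \<open>X2\<close> and \<open>L2\<close> then apply.\<close>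
    have le: "?D \<omega> * exp (- \<omega>\<^sup>2) \<le> 2 * m\<^sup>2 * (\<omega>\<^sup>2 * exp (- \<omega>\<^sup>2)) + 2 * \<beta>\<^sup>2 * ((cmod (L \<omega>))\<^sup>2 * exp (- \<omega>\<^sup>2))" for \<omega>
    proof -
      have "0 \<le> (m * \<omega> + \<beta> * Im (L \<omega>))\<^sup>2" "0 \<le> (\<beta> * Re (L \<omega>))\<^sup>2" by simp_all
      then have "?D \<omega> \<le> 2 * m\<^sup>2 * \<omega>\<^sup>2 + 2 * \<beta>\<^sup>2 * (cmod (L \<omega>))\<^sup>2"
        unfolding spectral_denominator_def cmod_power2 by (simp add: power2_eq_square algebra_simps)
      from mult_right_mono[OF this, of "exp (- \<omega>\<^sup>2)"] show ?thesis
        by (simp add: algebra_simps)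
    qed
    have "integrable \<nu> (\<lambda>\<omega>. ?D \<omega> * exp (- \<omega>\<^sup>2))"
      by (rule Bochner_Integration.integrable_bound[OF Bochner_Integration.integrable_add[OF
            integrable_mult_right[OF X2, of "2 * m\<^sup>2"] integrable_mult_right[OF L2, of "2 * \<beta>\<^sup>2"]]])
         (use D_nonneg in \<open>auto intro!: AE_I2 le\<close>)
    then show ?thesis
      unfolding p_def[abs_def] by (rule integrable_mult_right)
  qed
  have q_int: "integrable lborel q"
  proof -
    have "AE \<omega> in lborel. norm (\<bar>Re (L \<omega>)\<bar> * exp (- \<omega>\<^sup>2)) \<le> norm (C * ((1 + \<bar>\<omega>\<bar> powr (- s)) * inverse (1 + \<omega>\<^sup>2)))"
      using AE_lborel_singleton[of 0]
    proof eventually_elim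
      case (elim \<omega>)
      have "1 + \<omega>\<^sup>2 \<le> exp (\<omega>\<^sup>2)"
        by (rule exp_ge_add_one_self)
      then have "exp (- \<omega>\<^sup>2) \<le> inverse (1 + \<omega>\<^sup>2)"
        unfolding exp_minus by (rule le_imp_inverse_le) (simp add: add_pos_nonneg)
      moreover have "\<bar>Re (L \<omega>)\<bar> \<le> C * (1 + \<bar>\<omega>\<bar> powr (- s))"
        using abs_Re_le_cmod klim_le[OF elim] by (rule order_trans)
      ultimately have "\<bar>Re (L \<omega>)\<bar> * exp (- \<omega>\<^sup>2) \<le> C * (1 + \<bar>\<omega>\<bar> powr (- s)) * inverse (1 + \<omega>\<^sup>2)"
        by (intro mult_mono) auto
      then show ?case
        by (simp add: mult.assoc)
    qed
    then have "integrable lborel (\<lambda>\<omega>. \<bar>Re (L \<omega>)\<bar> * exp (- \<omega>\<^sup>2))"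
      by (rule Bochner_Integration.integrable_bound[OF integrable_mult_right[OF integrable_singular_quad[OF p01]], rotated]) measurable
    then show ?thesis
      unfolding q_def[abs_def] by (rule integrable_mult_right)
  qed
  have H_eq: "H (g h) \<omega> * cnj (H (g 0) \<omega>) = of_real (p \<omega>) * cis (h * \<omega>)" for h \<omega>
  proof -
    let ?z = "\<i> * of_real (m * \<omega>) + of_real \<beta> * cnj (L \<omega>)"
    have "?z * cnj ?z = of_real (?D \<omega>)"
      unfolding complex_norm_square[symmetric] norm_H by simp
    moreover have "ft (g h) \<omega> * cnj (ft (g 0) \<omega>) = of_real (2 * pi * exp (- \<omega>\<^sup>2)) * cis (h * \<omega>)"
      by (simp add: ft_gaussian_shift gaussian_def mult_ac flip: of_real_mult exp_add)
    ultimately show ?thesis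
      unfolding H_def complex_cnj_mult p_def by (simp add: mult_ac)
  qed
  have test_dom: "fun_dist (gle_test m \<beta> K (g h)) \<in> spectral_dom \<nu>" for h
  proof -
    have "H (g h) \<in> borel_measurable borel"
      using gle_test_represented(2)[OF gaussian_schwartz] by (simp add: represented_by_def)
    moreover have "(cmod (H (g h) \<omega>))\<^sup>2 = p \<omega>" for \<omega>
      unfolding H_def norm_mult power_mult_distrib norm_H norm_ft_g p_def by simp
    ultimately have "square_integrable \<nu> (H (g h))"
      using p_int by (simp add: square_integrable_def measurable_cong_sets[OF sets_\<nu> refl])
    then show ?thesis
      unfolding spectral_dom_def using gle_test_represented[OF gaussian_schwartz] by blast
  qed
  have "density \<nu> (\<lambda>x. ennreal (p x)) = density lborel (\<lambda>x. ennreal (q x))"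
  proof (rule density_eqI_char[OF sets_\<nu> _ p_int _ q_int])
    fix h
    have "(LINT \<omega>|\<nu>. of_real (p \<omega>) * cis (h * \<omega>)) = (LINT w|M. (of_real (sqrt \<beta>) * F (g h) w) * cnj (of_real (sqrt \<beta>) * F (g 0) w))"
      unfolding H_eq[symmetric] weak_eq[OF gaussian_schwartz gaussian_schwartz, symmetric]
      by (rule cov[symmetric]) (intro test_dom gle_test_represented gaussian_schwartz)+
    also have "\<dots> = (LINT w|M. of_real \<beta> * (F (g h) w * cnj (F (g 0) w)))"
    proof -
      have "complex_of_real (sqrt \<beta>) * complex_of_real (sqrt \<beta>) = of_real \<beta>"
        using \<beta>_pos by (simp flip: of_real_mult)
      then have "(of_real (sqrt \<beta>) * F (g h) w) * cnj (of_real (sqrt \<beta>) * F (g 0) w) = of_real \<beta> * (F (g h) w * cnj (F (g 0) w))" for w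
        by (simp add: mult_ac)
      then show ?thesis by (simp only:)
    qed
    also have "\<dots> = of_real \<beta> * (LINT w|M. F (g h) w * cnj (F (g 0) w))"
      by simp
    also have "\<dots> = (LINT \<omega>|lborel. of_real \<beta> * (of_real (2 * \<bar>Re (L \<omega>)\<bar> * exp (- \<omega>\<^sup>2)) * cis (h * \<omega>)))"
      unfolding noise_covariance by simp
    also have "\<dots> = (LINT \<omega>|lborel. of_real (q \<omega>) * cis (h * \<omega>))"
      by (simp add: q_def mult_ac)
    finally show "(LINT \<omega>|\<nu>. of_real (p \<omega>) * cis (h * \<omega>)) = (LINT \<omega>|lborel. of_real (q \<omega>) * cis (h * \<omega>))" .
  qed (use D_nonneg \<beta>_pos in \<open>auto simp: p_def q_def\<close>)
  note eq = this
  have pq: "0 \<le> p \<omega>" "0 \<le> q \<omega>" for \<omega>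
    using D_nonneg \<beta>_pos by (simp_all add: p_def q_def)
  \<comment> \<open>Where \<open>p\<close> vanishes, both sides are 0 because division by 0 gives
    0.\<close>
  have quot: "q \<omega> * (y / p \<omega>) = y * spectral_density m \<beta> k \<omega>" for \<omega> y
    by (simp add: p_def q_def spectral_density_def)
  have p_nz: "AE \<omega> in \<nu>. p \<omega> * (f \<omega> / p \<omega>) = f \<omega>" for f :: "real \<Rightarrow> real"
    using nz
  proof eventually_elim
    case (elim \<omega>)
    then show ?case
      using denominator_pos[OF elim] by (simp add: p_def)
  qed
  \<comment> \<open>Writing \<open>f = p (f / p)\<close> almost everywhere moves integrals from
    \<open>\<nu>\<close> through the common measure \<open>p d\<nu> = q d\<omega>\<close> to
    Lebesgue measure.\<close>
  have int_iff: "integrable \<nu> f \<longleftrightarrow> integrable lborel (\<lambda>\<omega>. f \<omega> * spectral_density m \<beta> k \<omega>)"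
    and int_eq: "(LINT \<omega>|\<nu>. f \<omega>) = (LINT \<omega>|lborel. f \<omega> * spectral_density m \<beta> k \<omega>)"
    if [measurable]: "f \<in> borel_measurable borel" for f :: "real \<Rightarrow> real"
  proof -
    have "integrable \<nu> f \<longleftrightarrow> integrable \<nu> (\<lambda>\<omega>. p \<omega> *\<^sub>R (f \<omega> / p \<omega>))"
      by (rule integrable_cong_AE) (use p_nz[of f] in \<open>auto elim!: eventually_mono\<close>)
    also have "\<dots> \<longleftrightarrow> integrable (density \<nu> (\<lambda>x. ennreal (p x))) (\<lambda>\<omega>. f \<omega> / p \<omega>)"
      by (rule integrable_density[symmetric]) (use pq in auto)
    also have "\<dots> \<longleftrightarrow> integrable lborel (\<lambda>\<omega>. q \<omega> *\<^sub>R (f \<omega> / p \<omega>))"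
      unfolding eq by (rule integrable_density) (use pq in auto)
    finally show "integrable \<nu> f \<longleftrightarrow> integrable lborel (\<lambda>\<omega>. f \<omega> * spectral_density m \<beta> k \<omega>)"
      by (simp only: real_scaleR_def quot)
    have "(LINT \<omega>|\<nu>. f \<omega>) = (LINT \<omega>|\<nu>. p \<omega> *\<^sub>R (f \<omega> / p \<omega>))"
      by (rule integral_cong_AE) (use p_nz[of f] in \<open>auto elim!: eventually_mono\<close>)
    also have "\<dots> = (LINT \<omega>|density \<nu> (\<lambda>x. ennreal (p x)). f \<omega> / p \<omega>)"
      by (rule integral_density[symmetric]) (use pq in auto)
    also have "\<dots> = (LINT \<omega>|lborel. q \<omega> *\<^sub>R (f \<omega> / p \<omega>))"
      unfolding eq by (rule integral_density) (use pq in auto)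
    finally show "(LINT \<omega>|\<nu>. f \<omega>) = (LINT \<omega>|lborel. f \<omega> * spectral_density m \<beta> k \<omega>)"
      by (simp only: real_scaleR_def quot)
  qed
  let ?I = "indicator {0..t} :: real \<Rightarrow> complex"
  have ind: "integrable lborel ?I"
    by (rule integrable_real_indicator[THEN integrable_of_real, where 'a=complex, simplified of_real_indicator])
       (use t in simp_all)
  have [measurable]: "ft ?I \<in> borel_measurable borel"
    by measurable
  have "integrable lborel (\<lambda>\<omega>. (cmod (ft ?I \<omega>))\<^sup>2 * spectral_density m \<beta> k \<omega>)"
  proof (rule Bochner_Integration.integrable_bound[OF integrable_mult_right[OF integrable_norm_ft_indicator[OF t], of b]])
    show "AE \<omega> in lborel. norm ((cmod (ft ?I \<omega>))\<^sup>2 * spectral_density m \<beta> k \<omega>) \<le> norm (b * (cmod (ft ?I \<omega>))\<^sup>2)"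
      using AE_lborel_singleton[of 0]
    proof eventually_elim
      case (elim \<omega>)
      have "0 \<le> spectral_density m \<beta> k \<omega>"
        using D_nonneg[of \<omega>] \<beta>_pos by (simp add: spectral_density_def)
      then have "\<bar>spectral_density m \<beta> k \<omega>\<bar> \<le> \<bar>b\<bar>"
        using b[OF elim] by linarith
      from mult_left_mono[OF this, of "(cmod (ft ?I \<omega>))\<^sup>2"] show ?case
        by (simp add: abs_mult mult.commute)
    qed
  qed measurable
  then have "integrable \<nu> (\<lambda>\<omega>. (cmod (ft ?I \<omega>))\<^sup>2)"
    by (subst int_iff) measurable
  then have "square_integrable \<nu> (ft ?I)"
    unfolding square_integrable_def by (intro conjI) measurable
  moreover have rep: "represented_by (dist_fourier (fun_dist ?I)) (ft ?I)"
    by (rule represented_by_ft[OF ind])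
  moreover have "fun_dist ?I \<in> tempered"
    by (rule fun_dist_tempered[of _ 1]) (auto simp: indicator_def)
  ultimately have I_dom: "fun_dist ?I \<in> spectral_dom \<nu>"
    by (auto simp: spectral_dom_def)
  have "complex_of_real (LINT w|M. (cmod (position_process V t w))\<^sup>2) = (LINT w|M. V (fun_dist ?I) w * cnj (V (fun_dist ?I) w))"
    unfolding position_process_def complex_norm_square[symmetric] by (rule integral_complex_of_real[symmetric])
  also have "\<dots> = (LINT \<omega>|\<nu>. ft ?I \<omega> * cnj (ft ?I \<omega>))"
    by (rule cov[OF I_dom I_dom rep rep])
  also have "\<dots> = complex_of_real (LINT \<omega>|\<nu>. (cmod (ft ?I \<omega>))\<^sup>2)"
    unfolding complex_norm_square[symmetric] by (rule integral_complex_of_real)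
  finally have "(LINT w|M. (cmod (position_process V t w))\<^sup>2) = (LINT \<omega>|\<nu>. (cmod (ft ?I \<omega>))\<^sup>2)"
    by (rule of_real_eq_iff[THEN iffD1])
  then show ?thesis
    by (subst (asm) int_eq) measurable
qed

end

section \<open>Asymptotics of the frequency integral\<close>

text \<open>The value at \<open>t = 1\<close> of the frequency integral of the pure power
  \<open>|\<omega>|^(1 - a)\<close>; other \<open>t\<close> follow by scaling.\<close>

definition cos_moment :: "real \<Rightarrow> real" where
  "cos_moment a = (LINT \<omega>|lborel. 2 * (1 - cos \<omega>) * \<bar>\<omega>\<bar> powr (- 1 - a))"

lemma one_minus_cos_le: "1 - cos x \<le> x\<^sup>2 / 2" for x :: real
proof -
  have "1 - cos x = 2 * (sin (x / 2))\<^sup>2"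
    using cos_double_sin[of "x / 2"] by simp
  also have "\<dots> \<le> 2 * (x / 2)\<^sup>2"
    using abs_sin_x_le_abs_x[of "x / 2"] unfolding abs_le_square_iff by (rule mult_left_mono) simp
  finally show ?thesis by (simp add: power2_eq_square)
qed

text \<open>\<open>1 - cos x \<le> x^2 / 2\<close> settles the origin for \<open>a < 2\<close>,
  boundedness settles infinity for \<open>a > 0\<close>.\<close>

lemma
  assumes "0 < a" "a < 2"
  shows integrable_cos_moment_pos: "integrable lborel (\<lambda>x. indicator {0<..} x * (2 * (1 - cos x) * x powr (- 1 - a)))"
    and integrable_cos_moment: "integrable lborel (\<lambda>\<omega>. 2 * (1 - cos \<omega>) * \<bar>\<omega>\<bar> powr (- 1 - a))"
    and cos_moment_pos: "cos_moment a = 2 * (LINT x|lborel. indicator {0<..} x * (2 * (1 - cos x) * x powr (- 1 - a)))"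
proof -
  have int: "integrable lborel (\<lambda>x. indicator {0<..1} x * x powr (1 - a) + 4 * (indicator {1..} x * x powr (- 1 - a)))"
    using assms by (intro Bochner_Integration.integrable_add integrable_mult_right integrable_powr_0_1 integrable_powr_1_inf) auto
  have le: "indicator {0<..} x * (2 * (1 - cos x) * x powr (- 1 - a))
      \<le> indicator {0<..1} x * x powr (1 - a) + 4 * (indicator {1..} x * x powr (- 1 - a))" for x :: real
  proof (cases "0 < x")
    case x: True
    show ?thesis
    proof (cases "x < 1")
      case True
      have "2 * (1 - cos x) \<le> x powr 2"
        using one_minus_cos_le[of x] x by simp
      then have "2 * (1 - cos x) * x powr (- 1 - a) \<le> x powr 2 * x powr (- 1 - a)"
        by (rule mult_right_mono) simp
      also have "\<dots> = x powr (1 - a)"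
        unfolding powr_add[symmetric] by (rule arg_cong[of _ _ "(powr) x"]) simp
      finally show ?thesis using True x by simp
    next
      case False
      have "2 * (1 - cos x) \<le> 2 * 2"
        using cos_ge_minus_one[of x] by (intro mult_left_mono) auto
      then have "2 * (1 - cos x) * x powr (- 1 - a) \<le> 4 * x powr (- 1 - a)"
        by (intro mult_right_mono) auto
      moreover have "0 \<le> indicator {0<..1} x * x powr (1 - a)"
        by simp
      moreover have i: "indicator {0<..} x = (1::real)" "indicator {1..} x = (1::real)"
        using False x by simp_all
      ultimately show ?thesis
        unfolding i mult_1 by linarith
    qed
  qed simp
  have nn: "0 \<le> indicator {0<..} x * (2 * (1 - cos x) * x powr (- 1 - a))" for x :: real
    by (intro mult_nonneg_nonneg) auto
  show pos: "integrable lborel (\<lambda>x. indicator {0<..} x * (2 * (1 - cos x) * x powr (- 1 - a)))"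
  proof (rule Bochner_Integration.integrable_bound[OF int])
    show "AE x in lborel. norm (indicator {0<..} x * (2 * (1 - cos x) * x powr (- 1 - a)))
        \<le> norm (indicator {0<..1} x * x powr (1 - a) + 4 * (indicator {1..} x * x powr (- 1 - a)))"
      unfolding real_norm_def abs_of_nonneg[OF nn] by (rule AE_I2) (rule order_trans[OF le abs_ge_self])
  qed measurable
  from integral_even[OF _ this]
  show "integrable lborel (\<lambda>\<omega>. 2 * (1 - cos \<omega>) * \<bar>\<omega>\<bar> powr (- 1 - a))"
    and "cos_moment a = 2 * (LINT x|lborel. indicator {0<..} x * (2 * (1 - cos x) * x powr (- 1 - a)))"
    by (simp_all add: cos_moment_def)
qed

lemma
  assumes t: "0 < t" and a: "0 < a" "a < 2"
  shows integrable_cos_scaled: "integrable lborel (\<lambda>\<omega>. 2 * (1 - cos (t * \<omega>)) * \<bar>\<omega>\<bar> powr (- 1 - a))"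
    and integral_cos_scaled: "(LINT \<omega>|lborel. 2 * (1 - cos (t * \<omega>)) * \<bar>\<omega>\<bar> powr (- 1 - a)) = t powr a * cos_moment a"
proof -
  have eq: "2 * (1 - cos (t * \<omega>)) * \<bar>t * \<omega>\<bar> powr (- 1 - a) = t powr (- 1 - a) * (2 * (1 - cos (t * \<omega>)) * \<bar>\<omega>\<bar> powr (- 1 - a))" for \<omega>
    using t by (simp add: abs_mult powr_mult)
  have "integrable lborel (\<lambda>\<omega>. 2 * (1 - cos (0 + t * \<omega>)) * \<bar>0 + t * \<omega>\<bar> powr (- 1 - a))"
    by (rule lborel_integrable_real_affine[OF integrable_cos_moment[OF a]]) (use t in simp)
  from integrable_mult_right[OF this[unfolded add_0 eq], of "t powr (1 + a)"]
  have "integrable lborel (\<lambda>\<omega>. (t powr (1 + a) * t powr (- 1 - a)) * (2 * (1 - cos (t * \<omega>)) * \<bar>\<omega>\<bar> powr (- 1 - a)))"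
    by (simp only: mult.assoc)
  moreover have "t powr (1 + a) * t powr (- 1 - a) = 1"
    using t by (simp add: powr_add[symmetric])
  ultimately show "integrable lborel (\<lambda>\<omega>. 2 * (1 - cos (t * \<omega>)) * \<bar>\<omega>\<bar> powr (- 1 - a))"
    by (simp only: mult_1)
  have "cos_moment a = t * (LINT \<omega>|lborel. 2 * (1 - cos (t * \<omega>)) * \<bar>t * \<omega>\<bar> powr (- 1 - a))"
    unfolding cos_moment_def using t by (subst lborel_integral_real_affine[of t _ 0]) auto
  also have "\<dots> = (t * t powr (- 1 - a)) * (LINT \<omega>|lborel. 2 * (1 - cos (t * \<omega>)) * \<bar>\<omega>\<bar> powr (- 1 - a))"
    unfolding eq by simp
  also have "t * t powr (- 1 - a) = t powr (- a)"
    using t powr_add[of t 1 "- 1 - a"] by simp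
  finally show "(LINT \<omega>|lborel. 2 * (1 - cos (t * \<omega>)) * \<bar>\<omega>\<bar> powr (- 1 - a)) = t powr a * cos_moment a"
    using t by (simp add: powr_minus field_simps)
qed

lemma norm_ft_indicator_mult_powr:
  assumes "0 \<le> t" "\<omega> \<noteq> 0"
  shows "(cmod (ft (indicator {0..t}) \<omega>))\<^sup>2 * \<bar>\<omega>\<bar> powr (1 - a) = 2 * (1 - cos (t * \<omega>)) * \<bar>\<omega>\<bar> powr (- 1 - a)"
proof -
  have "\<bar>\<omega>\<bar> powr (1 - a) = \<omega>\<^sup>2 * \<bar>\<omega>\<bar> powr (- 1 - a)"
  proof -
    have "\<bar>\<omega>\<bar> powr (1 - a) = \<bar>\<omega>\<bar> powr (2 + (- 1 - a))"
      by (rule arg_cong[of _ _ "(powr) \<bar>\<omega>\<bar>"]) simp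
    also have "\<dots> = \<bar>\<omega>\<bar> powr 2 * \<bar>\<omega>\<bar> powr (- 1 - a)"
      by (rule powr_add)
    finally show ?thesis
      using assms(2) by simp
  qed
  then show ?thesis
    using assms by (simp add: norm_ft_indicator)
qed

lemma ft_indicator_measurable [measurable]: "ft (indicator {0..t}) \<in> borel_measurable borel"
  by measurable

lemma frequency_integral_power:
  assumes t: "0 < t" and a: "0 < a" "a < 2"
  shows "integrable lborel (\<lambda>\<omega>. (cmod (ft (indicator {0..t}) \<omega>))\<^sup>2 * \<bar>\<omega>\<bar> powr (1 - a))"
    and "(LINT \<omega>|lborel. (cmod (ft (indicator {0..t}) \<omega>))\<^sup>2 * \<bar>\<omega>\<bar> powr (1 - a)) = t powr a * cos_moment a"
proof -
  have ae: "AE \<omega> in lborel. 2 * (1 - cos (t * \<omega>)) * \<bar>\<omega>\<bar> powr (- 1 - a) = (cmod (ft (indicator {0..t}) \<omega>))\<^sup>2 * \<bar>\<omega>\<bar> powr (1 - a)"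
    using AE_lborel_singleton[of 0]
  proof eventually_elim
    case (elim \<omega>)
    then show ?case
      using norm_ft_indicator_mult_powr[of t \<omega> a] t by simp
  qed
  show "integrable lborel (\<lambda>\<omega>. (cmod (ft (indicator {0..t}) \<omega>))\<^sup>2 * \<bar>\<omega>\<bar> powr (1 - a))"
    by (rule integrable_cong_AE_imp[OF integrable_cos_scaled[OF assms] _ ae]) measurable
  have "(LINT \<omega>|lborel. (cmod (ft (indicator {0..t}) \<omega>))\<^sup>2 * \<bar>\<omega>\<bar> powr (1 - a)) = (LINT \<omega>|lborel. 2 * (1 - cos (t * \<omega>)) * \<bar>\<omega>\<bar> powr (- 1 - a))"
    by (rule integral_cong_AE[symmetric, OF _ _ ae]) measurable
  then show "(LINT \<omega>|lborel. (cmod (ft (indicator {0..t}) \<omega>))\<^sup>2 * \<bar>\<omega>\<bar> powr (1 - a)) = t powr a * cos_moment a"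
    by (simp only: integral_cos_scaled[OF assms])
qed

text \<open>After division by \<open>t^a\<close> the power \<open>c |\<omega>|^(1 - a)\<close>
  contributes exactly \<open>c * cos_moment a\<close>, so only the weighted error remains.\<close>

lemma frequency_integral_error:
  assumes [measurable]: "r \<in> borel_measurable borel"
    and t: "0 < t" and a: "0 < a" "a < 2" and G: "integrable lborel (\<lambda>\<omega>. (cmod (ft (indicator {0..t}) \<omega>))\<^sup>2 * G \<omega>)"
    and r: "\<And>\<omega>. \<omega> \<noteq> 0 \<Longrightarrow> \<bar>r \<omega> - c * \<bar>\<omega>\<bar> powr (1 - a)\<bar> \<le> G \<omega>"
  shows "\<bar>(LINT \<omega>|lborel. (cmod (ft (indicator {0..t}) \<omega>))\<^sup>2 * r \<omega>) / t powr a - c * cos_moment a\<bar>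
      \<le> (LINT \<omega>|lborel. (cmod (ft (indicator {0..t}) \<omega>))\<^sup>2 * G \<omega>) / t powr a"
proof -
  let ?w = "\<lambda>\<omega>. (cmod (ft (indicator {0..t}) \<omega>))\<^sup>2"
  let ?s = "\<lambda>\<omega>. r \<omega> - c * \<bar>\<omega>\<bar> powr (1 - a)"
  have le: "AE \<omega> in lborel. \<bar>?w \<omega> * ?s \<omega>\<bar> \<le> ?w \<omega> * G \<omega>"
    using AE_lborel_singleton[of 0]
  proof eventually_elim
    case (elim \<omega>)
    from mult_left_mono[OF r[OF elim], of "?w \<omega>"] show ?case
      by (simp add: abs_mult)
  qed
  have s: "integrable lborel (\<lambda>\<omega>. ?w \<omega> * ?s \<omega>)"
  proof (rule Bochner_Integration.integrable_bound[OF G])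
    show "AE \<omega> in lborel. norm (?w \<omega> * ?s \<omega>) \<le> norm (?w \<omega> * G \<omega>)"
      unfolding real_norm_def using le
    proof eventually_elim
      case (elim \<omega>)
      then show ?case
        by (rule order_trans[OF _ abs_ge_self])
    qed
  qed measurable
  note pw = frequency_integral_power[OF t a]
  have "(LINT \<omega>|lborel. ?w \<omega> * r \<omega>) = (LINT \<omega>|lborel. ?w \<omega> * ?s \<omega> + c * (?w \<omega> * \<bar>\<omega>\<bar> powr (1 - a)))"
    by (intro Bochner_Integration.integral_cong) (simp_all add: algebra_simps)
  also have "\<dots> = (LINT \<omega>|lborel. ?w \<omega> * ?s \<omega>) + c * (t powr a * cos_moment a)"
    using s pw by (subst Bochner_Integration.integral_add) auto
  finally have eq: "(LINT \<omega>|lborel. ?w \<omega> * r \<omega>) = (LINT \<omega>|lborel. ?w \<omega> * ?s \<omega>) + c * (t powr a * cos_moment a)" .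
  have "\<bar>LINT \<omega>|lborel. ?w \<omega> * ?s \<omega>\<bar> \<le> (LINT \<omega>|lborel. \<bar>?w \<omega> * ?s \<omega>\<bar>)"
    by (rule integral_abs_bound)
  also have "\<dots> \<le> (LINT \<omega>|lborel. ?w \<omega> * G \<omega>)"
    by (rule integral_mono_AE[OF _ G le]) (use s in \<open>rule integrable_abs\<close>)
  finally have "\<bar>LINT \<omega>|lborel. ?w \<omega> * ?s \<omega>\<bar> / t powr a \<le> (LINT \<omega>|lborel. ?w \<omega> * G \<omega>) / t powr a"
    using t by (intro divide_right_mono) auto
  moreover have "(LINT \<omega>|lborel. ?w \<omega> * r \<omega>) / t powr a - c * cos_moment a = (LINT \<omega>|lborel. ?w \<omega> * ?s \<omega>) / t powr a"
    unfolding eq using t by (simp add: field_simps)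
  ultimately show ?thesis
    using t by (simp add: abs_divide)
qed

text \<open>An error that is itself a power belongs to the exponent \<open>a - d\<close>;
  \<open>d < a\<close> keeps this exponent positive and its moment finite.\<close>

corollary frequency_integral_rate:
  assumes [measurable]: "r \<in> borel_measurable borel"
    and t: "0 < t" and a: "0 < a" "a \<le> 1" and d: "0 < d" "d < a"
    and r: "\<And>\<omega>. \<omega> \<noteq> 0 \<Longrightarrow> \<bar>r \<omega> - c * \<bar>\<omega>\<bar> powr (1 - a)\<bar> \<le> E * \<bar>\<omega>\<bar> powr (1 - a + d)"
  shows "\<bar>(LINT \<omega>|lborel. (cmod (ft (indicator {0..t}) \<omega>))\<^sup>2 * r \<omega>) / t powr a - c * cos_moment a\<bar>
      \<le> E * cos_moment (a - d) * t powr (- d)"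
proof -
  have eq: "1 - a + d = 1 - (a - d)" by simp
  note pw = frequency_integral_power[of t "a - d"]
  have int: "integrable lborel (\<lambda>\<omega>. (cmod (ft (indicator {0..t}) \<omega>))\<^sup>2 * (E * \<bar>\<omega>\<bar> powr (1 - a + d)))"
    using integrable_mult_right[OF pw(1), of E] t a d unfolding eq by (simp add: mult.left_commute)
  have "\<bar>(LINT \<omega>|lborel. (cmod (ft (indicator {0..t}) \<omega>))\<^sup>2 * r \<omega>) / t powr a - c * cos_moment a\<bar>
      \<le> (LINT \<omega>|lborel. (cmod (ft (indicator {0..t}) \<omega>))\<^sup>2 * (E * \<bar>\<omega>\<bar> powr (1 - a + d))) / t powr a"
    by (rule frequency_integral_error[OF assms(1) t _ _ int r]) (use a in auto)
  also have "(LINT \<omega>|lborel. (cmod (ft (indicator {0..t}) \<omega>))\<^sup>2 * (E * \<bar>\<omega>\<bar> powr (1 - a + d)))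
      = E * (LINT \<omega>|lborel. (cmod (ft (indicator {0..t}) \<omega>))\<^sup>2 * \<bar>\<omega>\<bar> powr (1 - (a - d)))"
    unfolding eq by (subst integral_mult_right_zero[symmetric]) (simp add: mult.left_commute)
  also have "\<dots> / t powr a = E * cos_moment (a - d) * (t powr (a - d) / t powr a)"
    using pw(2) t a d by simp
  also have "t powr (a - d) / t powr a = t powr (- d)"
    by (simp add: powr_diff[symmetric])
  finally show ?thesis .
qed

text \<open>The factor \<open>\<omega>^2\<close> cancels the \<open>\<omega>^(-2)\<close> of the
  weight and leaves a majorant independent of \<open>t\<close>, whence \<open>1 / t\<close>. This
  covers the borderline \<open>d = a = 1\<close>, where the integral for the exponent
  \<open>a - d\<close> diverges.\<close>

corollary frequency_integral_rate_quadratic: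
  assumes [measurable]: "r \<in> borel_measurable borel" and t: "0 < t"
    and r: "\<And>\<omega>. \<omega> \<noteq> 0 \<Longrightarrow> \<bar>r \<omega> - c\<bar> \<le> E * (\<omega>\<^sup>2 * inverse (1 + \<omega>\<^sup>2))"
  shows "\<bar>(LINT \<omega>|lborel. (cmod (ft (indicator {0..t}) \<omega>))\<^sup>2 * r \<omega>) / t - c * cos_moment 1\<bar>
      \<le> 4 * E * (LINT \<omega>::real|lborel. inverse (1 + \<omega>\<^sup>2)) / t"
proof -
  let ?w = "\<lambda>\<omega>. (cmod (ft (indicator {0..t}) \<omega>))\<^sup>2"
  let ?G = "\<lambda>\<omega>. E * (\<omega>\<^sup>2 * inverse (1 + \<omega>\<^sup>2))"
  have "0 \<le> E"
    using order_trans[OF abs_ge_zero r[of 1]] by simp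
  have le: "?w \<omega> * ?G \<omega> \<le> 4 * E * inverse (1 + \<omega>\<^sup>2)" for \<omega>
  proof (cases "\<omega> = 0")
    case False
    have "2 * (1 - cos (t * \<omega>)) \<le> 2 * 2"
      using cos_ge_minus_one[of "t * \<omega>"] by (intro mult_left_mono) auto
    then have "2 * (1 - cos (t * \<omega>)) * (E * inverse (1 + \<omega>\<^sup>2)) \<le> 4 * (E * inverse (1 + \<omega>\<^sup>2))"
      using \<open>0 \<le> E\<close> inverse_quad_pos[of \<omega>] by (intro mult_right_mono) auto
    moreover have "?w \<omega> * ?G \<omega> = 2 * (1 - cos (t * \<omega>)) * (E * inverse (1 + \<omega>\<^sup>2))"
      using t False by (simp add: norm_ft_indicator)
    ultimately show ?thesis by (simp only: mult.assoc)
  qed (use \<open>0 \<le> E\<close> in simp)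
  have dom: "integrable lborel (\<lambda>\<omega>::real. 4 * E * inverse (1 + \<omega>\<^sup>2))"
    by (intro integrable_mult_right integrable_inverse_quad)
  have nn: "0 \<le> ?w \<omega> * ?G \<omega>" for \<omega>
    using \<open>0 \<le> E\<close> inverse_quad_pos[of \<omega>] by (intro mult_nonneg_nonneg) auto
  have int: "integrable lborel (\<lambda>\<omega>. ?w \<omega> * ?G \<omega>)"
  proof (rule Bochner_Integration.integrable_bound[OF dom])
    show "AE \<omega> in lborel. norm (?w \<omega> * ?G \<omega>) \<le> norm (4 * E * inverse (1 + \<omega>\<^sup>2))"
      using order_trans[OF le abs_ge_self] unfolding real_norm_def abs_of_nonneg[OF nn] by blast
  qed measurable
  have "\<bar>(LINT \<omega>|lborel. ?w \<omega> * r \<omega>) / t powr 1 - c * cos_moment 1\<bar> \<le> (LINT \<omega>|lborel. ?w \<omega> * ?G \<omega>) / t powr 1"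
    by (rule frequency_integral_error[OF assms(1) t _ _ int]) (use r in auto)
  also have "(LINT \<omega>|lborel. ?w \<omega> * ?G \<omega>) / t powr 1 \<le> (LINT \<omega>|lborel. 4 * E * inverse (1 + \<omega>\<^sup>2)) / t powr 1"
    using t by (intro divide_right_mono integral_mono int dom le) auto
  finally show ?thesis
    using t by simp
qed

subsection \<open>The value of the moment\<close>

text \<open>Integration by parts with \<open>?F\<close>, whose derivative is
  \<open>a (1 - cos x) x^(-1 - a) - sin x x^(-a)\<close>. Near 0 it is at most of order
  \<open>x^(2 - a)\<close>, at infinity of order \<open>x^(-a)\<close>, so no boundary term
  survives. The sine integral converges only conditionally, hence the limit in
  \<open>T\<close>.\<close>

lemma cos_moment_eq:
  assumes a: "0 < a" "a \<le> 1"
    and S: "((\<lambda>T. integral {0..T} (\<lambda>x. sin x * x powr (- a))) \<longlongrightarrow> S) at_top"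
  shows "cos_moment a = 4 / a * S"
proof -
  let ?g = "\<lambda>x::real. 2 * (1 - cos x) * x powr (- 1 - a)"
  let ?F = "\<lambda>x::real. - (1 - cos x) * x powr (- a)"
  have a2: "a < 2" using a by simp
  have Fle: "\<bar>?F x\<bar> \<le> x powr (2 - a)" if "0 \<le> x" for x
  proof (cases "x = 0")
    case False
    have "\<bar>?F x\<bar> = (1 - cos x) * x powr (- a)"
      by (simp add: abs_mult)
    also have "\<dots> \<le> x\<^sup>2 * x powr (- a)"
    proof (rule mult_right_mono)
      show "1 - cos x \<le> x\<^sup>2"
        using one_minus_cos_le[of x] zero_le_power2[of x] by linarith
    qed simp
    also have "\<dots> = x powr 2 * x powr (- a)"
      using that False by simp
    also have "\<dots> = x powr (2 - a)"
      unfolding powr_add[symmetric] by simp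
    finally show ?thesis .
  qed simp
  have Fcont: "continuous_on {0..T} ?F" for T
  proof -
    have "(?F \<longlongrightarrow> ?F x) (at x within {0..T})" if x: "x \<in> {0..T}" for x
    proof (cases "x = 0")
      case True
      have "((\<lambda>x. x powr (2 - a)) \<longlongrightarrow> 0 powr (2 - a)) (at 0 within {0..T})"
        by (intro tendsto_powr' tendsto_intros) (use a2 in \<open>auto simp: eventually_at_filter\<close>)
      then have lim: "((\<lambda>x. x powr (2 - a)) \<longlongrightarrow> 0) (at 0 within {0..T})"
        by simp
      have "\<forall>\<^sub>F x in at 0 within {0..T}. norm (?F x) \<le> x powr (2 - a)"
        unfolding eventually_at_filter using Fle by (auto intro!: always_eventually)
      from Lim_null_comparison[OF this lim] show ?thesis
        using True by simp
    next
      case False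
      then show ?thesis
        using x by (intro tendsto_intros) auto
    qed
    then show ?thesis
      by (simp add: continuous_on_def)
  qed
  have deriv: "(?F has_vector_derivative (a / 2 * ?g x - sin x * x powr (- a))) (at x)" if "0 < x" for x
    using that
    by (auto intro!: derivative_eq_intros simp: field_simps powr_diff powr_minus simp flip: has_real_derivative_iff_has_vector_derivative)
  have FTC: "((\<lambda>x. a / 2 * ?g x - sin x * x powr (- a)) has_integral (?F T - ?F 0)) {0..T}" if "0 \<le> T" for T
    by (rule fundamental_theorem_of_calculus_interior[OF that Fcont]) (use deriv in auto)
  have g_abs: "?g absolutely_integrable_on {0<..}"
    unfolding set_integrable_def using integrable_cos_moment_pos[OF a(1) a2]
    by (simp add: integrable_completion)
  have g_int: "?g integrable_on {0..T}" for T
  proof -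
    have "?g absolutely_integrable_on {0<..T}"
      by (rule set_integrable_subset[OF g_abs]) auto
    then have "?g integrable_on {0<..T}"
      by (simp add: set_lebesgue_integral_eq_integral)
    then show ?thesis
      by (rule integrable_spike_set) (auto intro!: negligible_subset[OF negligible_sing[of 0]])
  qed
  have eq: "a / 2 * integral {0..T} ?g = integral {0..T} (\<lambda>x. sin x * x powr (- a)) + ?F T" if "0 \<le> T" for T
  proof -
    have "((\<lambda>x. a / 2 * ?g x - (a / 2 * ?g x - sin x * x powr (- a))) has_integral (a / 2 * integral {0..T} ?g - (?F T - ?F 0))) {0..T}"
      by (intro has_integral_diff FTC that has_integral_mult_right integrable_integral g_int)
    then have "integral {0..T} (\<lambda>x. sin x * x powr (- a)) = a / 2 * integral {0..T} ?g - (?F T - ?F 0)"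
      by (simp add: integral_unique)
    then show ?thesis by simp
  qed
  have "((\<lambda>T. integral {0..T} ?g) \<longlongrightarrow> (LINT x|lborel. indicator {0<..} x * ?g x)) at_top"
  proof -
    have ind: "indicator {0..} x * ?g x = indicator {0<..} x * ?g x" for x :: real
      by (auto simp: indicator_def)
    have g0: "set_integrable lborel {0..} ?g"
      unfolding set_integrable_def real_scaleR_def ind by (rule integrable_cos_moment_pos[OF a(1) a2])
    have "((\<lambda>T. LINT x:{0..T}|lborel. ?g x) \<longlongrightarrow> (LINT x:{0..}|lborel. ?g x)) at_top"
      by (rule tendsto_set_lebesgue_integral_at_top[OF _ g0]) simp
    moreover have "(LINT x:{0..T}|lborel. ?g x) = integral {0..T} ?g" for T
      by (rule set_borel_integral_eq_integral(2)[OF set_integrable_subset[OF g0]]) auto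
    ultimately show ?thesis
      by (simp only: set_lebesgue_integral_def real_scaleR_def ind)
  qed
  then have lim1: "((\<lambda>T. a / 2 * integral {0..T} ?g) \<longlongrightarrow> a / 2 * (LINT x|lborel. indicator {0<..} x * ?g x)) at_top"
    by (rule tendsto_mult_left)
  have "(?F \<longlongrightarrow> 0) at_top"
  proof (rule Lim_null_comparison)
    show "\<forall>\<^sub>F x in at_top. norm (?F x) \<le> 2 * x powr (- a)"
    proof (intro always_eventually allI)
      fix x :: real
      have "\<bar>- (1 - cos x)\<bar> \<le> 2"
        using cos_ge_minus_one[of x] cos_le_one[of x] by linarith
      then have "\<bar>- (1 - cos x)\<bar> * x powr (- a) \<le> 2 * x powr (- a)"
        by (rule mult_right_mono) simp
      then show "norm (?F x) \<le> 2 * x powr (- a)"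
        unfolding real_norm_def abs_mult by simp
    qed
    show "((\<lambda>x. 2 * x powr (- a)) \<longlongrightarrow> 0) at_top"
      using a by real_asymp
  qed
  with S have "((\<lambda>T. integral {0..T} (\<lambda>x. sin x * x powr (- a)) + ?F T) \<longlongrightarrow> S + 0) at_top"
    by (rule tendsto_add)
  then have lim2: "((\<lambda>T. a / 2 * integral {0..T} ?g) \<longlongrightarrow> S + 0) at_top"
    by (rule Lim_transform_eventually) (rule eventually_mono[OF eventually_ge_at_top[of 0] eq[symmetric]])
  have "a / 2 * (LINT x|lborel. indicator {0<..} x * ?g x) = S"
    using tendsto_unique[OF _ lim1 lim2] by simp
  then show ?thesis
    unfolding cos_moment_pos[OF a(1) a2] using a by (simp add: field_simps)
qed

section \<open>The spectral density near the origin\<close>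

lemma Re_inverse_diff_le:
  fixes u v :: complex
  assumes "v \<noteq> 0" "cmod (u - v) \<le> cmod v / 2"
  shows "\<bar>Re (inverse u) - Re (inverse v)\<bar> \<le> 2 * cmod (u - v) / (cmod v)\<^sup>2"
proof -
  have v: "0 < cmod v" using assms by simp
  have "cmod v \<le> cmod u + cmod (u - v)"
    by (metis norm_minus_commute norm_triangle_sub)
  then have u: "cmod v / 2 \<le> cmod u" using assms(2) by linarith
  then have "u \<noteq> 0" using v by auto
  have "\<bar>Re (inverse u) - Re (inverse v)\<bar> \<le> cmod (inverse u - inverse v)"
    using abs_Re_le_cmod[of "inverse u - inverse v"] by simp
  also have "inverse u - inverse v = (v - u) / (u * v)"
    using \<open>u \<noteq> 0\<close> \<open>v \<noteq> 0\<close> by (simp add: field_simps)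
  also have "cmod \<dots> = cmod (u - v) / (cmod u * cmod v)"
    by (simp add: norm_divide norm_mult norm_minus_commute)
  also have "\<dots> \<le> cmod (u - v) / (cmod v / 2 * cmod v)"
    using u v by (intro divide_left_mono mult_right_mono mult_pos_pos) auto
  also have "\<dots> = 2 * cmod (u - v) / (cmod v)\<^sup>2"
    by (simp add: power2_eq_square)
  finally show ?thesis .
qed

section \<open>Expansion of the density and global bounds\<close>

locale positive_kernel = tail_kernel +
  fixes m \<beta> :: real
  assumes klim_pos: "\<And>\<omega>. \<omega> \<noteq> 0 \<Longrightarrow> 0 < Re (klim k \<omega>)"
    and m_pos: "0 < m" and \<beta>_pos: "0 < \<beta>"
begin

abbreviation "r \<equiv> spectral_density m \<beta> k"

text \<open>\<open>Re (1 / z) = Re z / |z|^2\<close>. In this form an error in \<open>klim\<close>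
  reaches the density through a single complex inverse.\<close>

lemma spectral_density_eq_inverse:
  assumes "\<omega> \<noteq> 0"
  shows "r \<omega> = Re (inverse (of_real \<beta> * klim k \<omega> - \<i> * of_real (m * \<omega>))) / pi"
proof -
  have "spectral_denominator m \<beta> (klim k \<omega>) \<omega> = (Re (of_real \<beta> * klim k \<omega> - \<i> * of_real (m * \<omega>)))\<^sup>2 + (Im (of_real \<beta> * klim k \<omega> - \<i> * of_real (m * \<omega>)))\<^sup>2"
    by (simp add: spectral_denominator_def power2_commute)
  then show ?thesis
    using klim_pos[OF assms] by (simp add: spectral_density_def complex_inverse mult.commute)
qed

lemma spectral_density_nonneg: "0 \<le> r \<omega>"
  using \<beta>_pos by (simp add: spectral_density_def spectral_denominator_def)

lemma spectral_density_minus: 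
  assumes "\<omega> \<noteq> 0"
  shows "r (- \<omega>) = r \<omega>"
proof -
  have "(- (m * \<omega>) + \<beta> * x)\<^sup>2 = (m * \<omega> - \<beta> * x)\<^sup>2" for x
    by (simp add: power2_eq_square algebra_simps)
  then show ?thesis
    by (simp add: spectral_density_def spectral_denominator_def klim_minus[OF assms])
qed

lemma spectral_density_abs: "\<omega> \<noteq> 0 \<Longrightarrow> r \<bar>\<omega>\<bar> = r \<omega>"
  using spectral_density_minus[of \<omega>] by (simp add: abs_if)

text \<open>For large \<open>|\<omega>|\<close> the inertial term \<open>m \<omega>\<close>
  outweighs the bounded \<open>klim\<close>; on the remaining compact set \<open>Re (klim k)\<close>
  is continuous and positive, hence bounded below.\<close>

lemma spectral_density_bounded_away:
  assumes "0 < e"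
  shows "\<exists>b. \<forall>\<omega>. e \<le> \<bar>\<omega>\<bar> \<longrightarrow> r \<omega> \<le> b"
proof -
  define B where "B = (LINT t|lborel. indicator {..A} t * k t) + 8 * k A / e"
  have L_le: "cmod (klim k \<omega>) \<le> B" if "e \<le> \<bar>\<omega>\<bar>" for \<omega>
  proof (rule tendsto_upperbound)
    have nz: "\<omega> \<noteq> 0" using that assms by auto
    show "(\<lambda>n. cmod (ktrans k (real n) \<omega>)) \<longlonglongrightarrow> cmod (klim k \<omega>)"
      by (intro tendsto_norm ktrans_LIMSEQ nz)
    have "8 * k A / \<bar>\<omega>\<bar> \<le> 8 * k A / e"
      using that assms k_nonneg by (intro divide_left_mono) auto
    then show "\<forall>\<^sub>F n in sequentially. cmod (ktrans k (real n) \<omega>) \<le> B"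
      unfolding B_def by (intro always_eventually allI order_trans[OF norm_ktrans_split[OF order_refl nz]]) simp
  qed simp
  have B0: "0 \<le> B"
    using order_trans[OF norm_ge_zero L_le[of e]] by simp
  \<comment> \<open>Beyond \<open>W\<close> one has \<open>\<beta> B \<le> m |\<omega>| / 2\<close>,
    so at least half of the inertial term survives.\<close>
  define W where "W = max e (2 * \<beta> * B / m)"
  have W: "e \<le> W" "2 * \<beta> * B \<le> m * W"
    using m_pos by (auto simp: W_def max_def field_simps)
  have num: "\<beta> * \<bar>Re (klim k \<omega>)\<bar> \<le> \<beta> * B" if "e \<le> \<bar>\<omega>\<bar>" for \<omega>
    using \<beta>_pos order_trans[OF abs_Re_le_cmod L_le[OF that]] by simp
  let ?D = "\<lambda>\<omega>. spectral_denominator m \<beta> (klim k \<omega>) \<omega>"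
  have quot: "r \<omega> \<le> \<beta> * B / (pi * d)" if "e \<le> \<bar>\<omega>\<bar>" "d \<le> ?D \<omega>" "0 < d" for \<omega> d
    unfolding spectral_density_def
    using that \<beta>_pos B0 num[OF that(1)] by (intro frac_le mult_left_mono) auto
  have far: "r \<omega> \<le> \<beta> * B / (pi * (m * e / 2)\<^sup>2)" if "W \<le> \<bar>\<omega>\<bar>" for \<omega>
  proof (rule quot)
    show "e \<le> \<bar>\<omega>\<bar>" using that W by simp
    have "\<bar>\<beta> * Im (klim k \<omega>)\<bar> \<le> \<beta> * B"
      using \<beta>_pos order_trans[OF abs_Im_le_cmod L_le[OF \<open>e \<le> \<bar>\<omega>\<bar>\<close>]] by (simp add: abs_mult)
    moreover have "m * W \<le> m * \<bar>\<omega>\<bar>" "m * e \<le> m * W"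
      using that W m_pos by auto
    moreover have "\<bar>m * \<omega>\<bar> = m * \<bar>\<omega>\<bar>"
      using m_pos by (simp add: abs_mult)
    ultimately have "m * e / 2 \<le> \<bar>m * \<omega> - \<beta> * Im (klim k \<omega>)\<bar>"
      using W(2) by linarith
    then have "(m * e / 2)\<^sup>2 \<le> \<bar>m * \<omega> - \<beta> * Im (klim k \<omega>)\<bar>\<^sup>2"
      using m_pos assms by (intro power_mono) auto
    moreover have "0 \<le> (\<beta> * Re (klim k \<omega>))\<^sup>2" by simp
    ultimately show "(m * e / 2)\<^sup>2 \<le> ?D \<omega>"
      unfolding spectral_denominator_def power2_abs by linarith
    show "0 < (m * e / 2)\<^sup>2"
      using m_pos assms by simp
  qed
  define S where "S = {\<omega>. e \<le> \<bar>\<omega>\<bar> \<and> \<bar>\<omega>\<bar> \<le> W}"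
  have "S = ({..-e} \<union> {e..}) \<inter> {-W..W}"
    by (auto simp: S_def abs_if)
  then have "compact S"
    by (simp add: closed_Int_compact closed_Un)
  moreover have "W \<in> S" using W assms by (simp add: S_def)
  moreover have "continuous_on S (\<lambda>\<omega>. Re (klim k \<omega>))"
    by (intro continuous_on_Re continuous_on_subset[OF klim_continuous_on[OF assms]]) (auto simp: S_def)
  ultimately obtain \<omega>\<^sub>0 where \<omega>\<^sub>0: "\<omega>\<^sub>0 \<in> S" "\<And>\<omega>. \<omega> \<in> S \<Longrightarrow> Re (klim k \<omega>\<^sub>0) \<le> Re (klim k \<omega>)"
    using continuous_attains_inf[of S "\<lambda>\<omega>. Re (klim k \<omega>)"] by blast
  define \<rho> where "\<rho> = Re (klim k \<omega>\<^sub>0)"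
  have \<rho>: "0 < \<rho>"
    unfolding \<rho>_def using \<omega>\<^sub>0(1) assms by (intro klim_pos) (auto simp: S_def)
  have near: "r \<omega> \<le> \<beta> * B / (pi * (\<beta> * \<rho>)\<^sup>2)" if "\<omega> \<in> S" for \<omega>
  proof (rule quot)
    show "e \<le> \<bar>\<omega>\<bar>" using that by (simp add: S_def)
    have "(\<beta> * \<rho>)\<^sup>2 \<le> (\<beta> * Re (klim k \<omega>))\<^sup>2"
      using \<omega>\<^sub>0(2)[OF that] \<rho> \<beta>_pos by (intro power_mono) (auto simp: \<rho>_def)
    then show "(\<beta> * \<rho>)\<^sup>2 \<le> ?D \<omega>"
      by (simp add: spectral_denominator_def add_increasing2)
    show "0 < (\<beta> * \<rho>)\<^sup>2" using \<rho> \<beta>_pos by simp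
  qed
  show ?thesis
  proof (intro exI[of _ "max (\<beta> * B / (pi * (m * e / 2)\<^sup>2)) (\<beta> * B / (pi * (\<beta> * \<rho>)\<^sup>2))"] allI impI)
    fix \<omega> assume "e \<le> \<bar>\<omega>\<bar>"
    then show "r \<omega> \<le> max (\<beta> * B / (pi * (m * e / 2)\<^sup>2)) (\<beta> * B / (pi * (\<beta> * \<rho>)\<^sup>2))"
      using far[of \<omega>] near[of \<omega>] by (cases "W \<le> \<bar>\<omega>\<bar>") (auto simp: S_def le_max_iff_disj)
  qed
qed

text \<open>
  With \<open>u = \<omega>^(1 - a) (\<beta> L(\<omega>) - i m \<omega>)\<close> one has \<open>\<omega>^(a - 1) r(\<omega>) = Re (1 / u) / \<pi>\<close>, and \<open>u\<close>
  tends to \<open>\<beta> \<kappa>\<close> as \<open>\<omega>\<close> decreases to 0.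
\<close>
lemma spectral_density_expansion:
  assumes a: "0 < a" "a \<le> 1" and d: "0 < d" "d \<le> a" and \<kappa>: "0 < Re \<kappa>"
    and E: "\<And>\<omega>. 0 < \<omega> \<Longrightarrow> \<omega> \<le> 1 \<Longrightarrow> cmod (klim k \<omega> - \<kappa> * of_real (\<omega> powr (a - 1))) \<le> E * \<omega> powr (a - 1 + d)"
  obtains E' b where "\<And>\<omega>. \<omega> \<noteq> 0 \<Longrightarrow> \<bar>r \<omega> - Re (inverse \<kappa>) / (pi * \<beta>) * \<bar>\<omega>\<bar> powr (1 - a)\<bar> \<le> E' * \<bar>\<omega>\<bar> powr (1 - a + d)"
    and "\<And>\<omega>. \<omega> \<noteq> 0 \<Longrightarrow> r \<omega> \<le> b"
proof -
  define c where "c = Re (inverse \<kappa>) / (pi * \<beta>)"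
  \<comment> \<open>\<open>\<beta> E\<close> comes from the expansion of \<open>klim\<close>,
    \<open>m\<close> from the inertial term, which in \<open>u\<close> has order
    \<open>\<omega>^(2 - a)\<close> and so is at most \<open>m \<omega>^d\<close> on
    \<open>(0, 1]\<close>.\<close>
  define G where "G = \<beta> * E + m"
  define u where "u \<omega> = of_real (\<omega> powr (1 - a)) * (of_real \<beta> * klim k \<omega> - \<i> * of_real (m * \<omega>))" for \<omega>
  let ?v = "of_real \<beta> * \<kappa>"
  have E0: "0 \<le> E" using order_trans[OF norm_ge_zero E[of 1]] by simp
  have G0: "0 < G" using E0 \<beta>_pos m_pos by (simp add: G_def add_nonneg_pos)
  have v: "?v \<noteq> 0" using \<kappa> \<beta>_pos by auto
  have c0: "0 \<le> c"
    using \<kappa> \<beta>_pos by (simp add: c_def complex_inverse)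
  have u_diff: "cmod (u \<omega> - ?v) \<le> G * \<omega> powr d" if w: "0 < \<omega>" "\<omega> \<le> 1" for \<omega>
  proof -
    have p1: "\<omega> powr (1 - a) * \<omega> powr (a - 1) = 1"
      using w by (simp add: powr_add[symmetric])
    have "u \<omega> - ?v = of_real (\<beta> * \<omega> powr (1 - a)) * (klim k \<omega> - \<kappa> * of_real (\<omega> powr (a - 1))) - \<i> * of_real (m * (\<omega> powr (1 - a) * \<omega>))"
    proof -
      have "of_real \<beta> * \<kappa> = of_real (\<beta> * (\<omega> powr (1 - a) * \<omega> powr (a - 1))) * \<kappa>"
        by (simp add: p1)
      then show ?thesis
        by (simp add: u_def algebra_simps)
    qed
    also have "cmod \<dots> \<le> cmod (of_real (\<beta> * \<omega> powr (1 - a)) * (klim k \<omega> - \<kappa> * of_real (\<omega> powr (a - 1)))) + cmod (\<i> * of_real (m * (\<omega> powr (1 - a) * \<omega>)))"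
      by (rule norm_triangle_ineq4)
    also have "\<dots> = \<beta> * \<omega> powr (1 - a) * cmod (klim k \<omega> - \<kappa> * of_real (\<omega> powr (a - 1))) + m * (\<omega> powr (1 - a) * \<omega>)"
      using \<beta>_pos m_pos w by (simp add: norm_mult abs_mult)
    also have "\<dots> \<le> \<beta> * \<omega> powr (1 - a) * (E * \<omega> powr (a - 1 + d)) + m * \<omega> powr d"
    proof (intro add_mono mult_left_mono E w)
      have "\<omega> powr (1 - a) * \<omega> = \<omega> powr (2 - a)"
        using w powr_add[of \<omega> "1 - a" 1] by simp
      also have "\<dots> \<le> \<omega> powr d"
        using w a d by (intro powr_mono') auto
      finally show "\<omega> powr (1 - a) * \<omega> \<le> \<omega> powr d" .
    qed (use \<beta>_pos m_pos in auto)
    also have "\<dots> = \<beta> * E * (\<omega> powr (1 - a) * \<omega> powr (a - 1 + d)) + m * \<omega> powr d"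
      by (simp add: mult_ac)
    also have "\<omega> powr (1 - a) * \<omega> powr (a - 1 + d) = \<omega> powr d"
      by (simp add: powr_add[symmetric])
    finally show ?thesis
      by (simp add: G_def distrib_right)
  qed
  \<comment> \<open>Below \<open>e\<close> the function \<open>u\<close> stays within half the
    modulus of its limit, where inversion is Lipschitz.\<close>
  define e where "e = min 1 ((cmod ?v / (2 * G)) powr (1 / d))"
  have e: "0 < e" "e \<le> 1"
    using v G0 by (auto simp: e_def)
  have small: "G * \<omega> powr d \<le> cmod ?v / 2" if "0 < \<omega>" "\<omega> \<le> e" for \<omega>
  proof -
    have "\<omega> powr d \<le> ((cmod ?v / (2 * G)) powr (1 / d)) powr d"
      using that d by (intro powr_mono2) (auto simp: e_def)
    also have "\<dots> = cmod ?v / (2 * G)"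
      using d v G0 by (simp add: powr_powr)
    finally show ?thesis
      using G0 by (simp add: field_simps)
  qed
  define E1 where "E1 = 2 * G / ((cmod ?v)\<^sup>2 * pi)"
  have near: "\<bar>r \<omega> - c * \<omega> powr (1 - a)\<bar> \<le> E1 * \<omega> powr (1 - a + d)" if w: "0 < \<omega>" "\<omega> \<le> e" for \<omega>
  proof -
    have w1: "\<omega> \<le> 1" using w e by simp
    have "cmod (u \<omega> - ?v) \<le> cmod ?v / 2"
      using u_diff[OF w(1) w1] small[OF w] by linarith
    from Re_inverse_diff_le[OF v this]
    have "\<bar>Re (inverse (u \<omega>)) - Re (inverse ?v)\<bar> \<le> 2 * cmod (u \<omega> - ?v) / (cmod ?v)\<^sup>2" .
    also have "\<dots> \<le> 2 * (G * \<omega> powr d) / (cmod ?v)\<^sup>2"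
      using u_diff[OF w(1) w1] by (intro divide_right_mono mult_left_mono) auto
    finally have 1: "\<bar>Re (inverse (u \<omega>)) - Re (inverse ?v)\<bar> / pi \<le> 2 * (G * \<omega> powr d) / (cmod ?v)\<^sup>2 / pi"
      by (intro divide_right_mono) auto
    define Q where "Q = Re (inverse (of_real \<beta> * klim k \<omega> - \<i> * of_real (m * \<omega>)))"
    have "inverse (u \<omega>) = inverse (\<omega> powr (1 - a)) *\<^sub>R inverse (of_real \<beta> * klim k \<omega> - \<i> * of_real (m * \<omega>))"
      unfolding u_def inverse_mult_distrib scaleR_conv_of_real of_real_inverse by (rule refl)
    then have "Re (inverse (u \<omega>)) = inverse (\<omega> powr (1 - a)) * Q"
      by (simp only: scaleR_complex.sel Q_def)
    moreover have "r \<omega> = Q / pi"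
      unfolding Q_def using w by (intro spectral_density_eq_inverse) simp
    ultimately have 2: "r \<omega> = \<omega> powr (1 - a) * (Re (inverse (u \<omega>)) / pi)"
      using w by (simp add: field_simps)
    have "inverse ?v = inverse \<beta> *\<^sub>R inverse \<kappa>"
      by (simp add: scaleR_conv_of_real)
    then have "Re (inverse ?v) = inverse \<beta> * Re (inverse \<kappa>)"
      by (simp only: scaleR_complex.sel)
    then have 3: "c = Re (inverse ?v) / pi"
      unfolding c_def by (simp only: divide_inverse inverse_mult_distrib mult_ac)
    have "r \<omega> - c * \<omega> powr (1 - a) = \<omega> powr (1 - a) * ((Re (inverse (u \<omega>)) - Re (inverse ?v)) / pi)"
      unfolding 3 by (subst 2) (simp add: algebra_simps diff_divide_distrib)
    then have "\<bar>r \<omega> - c * \<omega> powr (1 - a)\<bar> = \<omega> powr (1 - a) * (\<bar>Re (inverse (u \<omega>)) - Re (inverse ?v)\<bar> / pi)"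
      by (simp add: abs_mult)
    also have "\<dots> \<le> \<omega> powr (1 - a) * (2 * (G * \<omega> powr d) / (cmod ?v)\<^sup>2 / pi)"
      by (intro mult_left_mono 1) simp
    also have "\<dots> = E1 * (\<omega> powr (1 - a) * \<omega> powr d)"
      by (simp add: E1_def)
    finally show ?thesis
      by (simp add: powr_add)
  qed
  obtain b where b: "\<And>\<omega>. e \<le> \<bar>\<omega>\<bar> \<Longrightarrow> r \<omega> \<le> b"
    using spectral_density_bounded_away[OF e(1)] by blast
  have b0: "0 \<le> b" using order_trans[OF spectral_density_nonneg b[of e]] e by simp
  \<comment> \<open>From \<open>e\<close> on boundedness suffices:
    \<open>\<omega>^(a - 1) \<le> e^(a - 1)\<close> moves \<open>b\<close> under the power
    \<open>\<omega>^(1 - a)\<close>, and \<open>1 \<le> (\<omega> / e)^d\<close> supplies the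
    missing exponent.\<close>
  define E2 where "E2 = (b * e powr (a - 1) + c) / e powr d"
  have far: "\<bar>r \<omega> - c * \<omega> powr (1 - a)\<bar> \<le> E2 * \<omega> powr (1 - a + d)" if w: "e \<le> \<omega>" for \<omega>
  proof -
    have w0: "0 < \<omega>" using e w by linarith
    have p1: "\<omega> powr (1 - a) * \<omega> powr (a - 1) = 1"
      using w0 by (simp add: powr_add[symmetric])
    have "r \<omega> \<le> b" using b[of \<omega>] w by simp
    have "\<bar>r \<omega> - c * \<omega> powr (1 - a)\<bar> \<le> b + c * \<omega> powr (1 - a)"
      using \<open>r \<omega> \<le> b\<close> spectral_density_nonneg[of \<omega>] mult_nonneg_nonneg[OF c0 powr_ge_zero[of \<omega> "1 - a"]]
      by linarith
    also have "\<dots> = \<omega> powr (1 - a) * (b * \<omega> powr (a - 1) + c)"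
      using p1 by (simp add: algebra_simps)
    also have "\<dots> \<le> \<omega> powr (1 - a) * (b * e powr (a - 1) + c)"
      using e w a b0 by (intro mult_left_mono add_mono powr_mono2') auto
    also have "\<dots> = \<omega> powr (1 - a) * E2 * e powr d"
      using e by (simp add: E2_def)
    also have "\<dots> \<le> \<omega> powr (1 - a) * E2 * \<omega> powr d"
      using e w d b0 c0 by (intro mult_left_mono powr_mono2 mult_nonneg_nonneg) (auto simp: E2_def)
    finally show ?thesis
      by (simp add: powr_add mult_ac)
  qed
  have all: "\<bar>r \<omega> - c * \<bar>\<omega>\<bar> powr (1 - a)\<bar> \<le> max E1 E2 * \<bar>\<omega>\<bar> powr (1 - a + d)" if "\<omega> \<noteq> 0" for \<omega>
  proof -
    have "\<bar>r \<bar>\<omega>\<bar> - c * \<bar>\<omega>\<bar> powr (1 - a)\<bar> \<le> max E1 E2 * \<bar>\<omega>\<bar> powr (1 - a + d)"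
    proof (cases "\<bar>\<omega>\<bar> \<le> e")
      case True
      then have "\<bar>r \<bar>\<omega>\<bar> - c * \<bar>\<omega>\<bar> powr (1 - a)\<bar> \<le> E1 * \<bar>\<omega>\<bar> powr (1 - a + d)"
        using that by (intro near) auto
      also have "\<dots> \<le> max E1 E2 * \<bar>\<omega>\<bar> powr (1 - a + d)"
        by (intro mult_right_mono) auto
      finally show ?thesis .
    next
      case False
      then have "\<bar>r \<bar>\<omega>\<bar> - c * \<bar>\<omega>\<bar> powr (1 - a)\<bar> \<le> E2 * \<bar>\<omega>\<bar> powr (1 - a + d)"
        by (intro far) auto
      also have "\<dots> \<le> max E1 E2 * \<bar>\<omega>\<bar> powr (1 - a + d)"
        by (intro mult_right_mono) auto
      finally show ?thesis .
    qed
    then show ?thesis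
      by (simp add: spectral_density_abs[OF that])
  qed
  \<comment> \<open>Near the origin the expansion itself bounds the density, since both exponents
    are nonnegative.\<close>
  have bound: "r \<omega> \<le> max b (c + max E1 E2)" if "\<omega> \<noteq> 0" for \<omega>
  proof (cases "e \<le> \<bar>\<omega>\<bar>")
    case True
    then show ?thesis using b[of \<omega>] by auto
  next
    case False
    have "0 \<le> max E1 E2"
      using G0 by (simp add: E1_def le_max_iff_disj)
    have "r \<omega> \<le> c * \<bar>\<omega>\<bar> powr (1 - a) + max E1 E2 * \<bar>\<omega>\<bar> powr (1 - a + d)"
      using all[OF that] by linarith
    also have "\<dots> \<le> c * 1 + max E1 E2 * 1"
      using False e a d c0 \<open>0 \<le> max E1 E2\<close> by (intro add_mono mult_left_mono powr_le1) auto
    finally show ?thesis by simp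
  qed
  show thesis
    by (rule that[OF all[unfolded c_def] bound])
qed

end

section \<open>The diffusive regime\<close>

text \<open>\<open>Si\<close> integrates \<open>sinc\<close>, which differs from this integrand only
  at the origin.\<close>

lemma Dirichlet_integral:
  "((\<lambda>T. integral {0..T} (\<lambda>x. sin x * x powr (- 1))) \<longlongrightarrow> pi / 2) at_top"
proof (rule Lim_transform_eventually[OF Si_at_top])
  have "Si T = integral {0..T} (\<lambda>x. sin x * x powr (- 1))" if "0 \<le> T" for T
  proof -
    have "set_integrable lborel {0..T} sinc"
      by (rule borel_integrable_atLeastAtMost') (auto intro!: continuous_at_imp_continuous_on isCont_sinc)
    then have "Si T = integral {0..T} sinc"
      using interval_integral_eq_integral[OF that, of sinc] by (simp add: Si_alt_def zero_ereal_def)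
    also have "\<dots> = integral {0..T} (\<lambda>x. sin x * x powr (- 1))"
      by (rule integral_spike[OF negligible_sing[of 0]]) (auto simp: powr_minus_divide)
    finally show ?thesis .
  qed
  then show "\<forall>\<^sub>F T in at_top. Si T = integral {0..T} (\<lambda>x. sin x * x powr (- 1))"
    by (rule eventually_mono[OF eventually_ge_at_top[of 0]])
qed

lemma cos_moment_1: "cos_moment 1 = 2 * pi"
  using cos_moment_eq[OF _ _ Dirichlet_integral] by simp

text \<open>Interpolates between the bounds \<open>|x|\<close> and 2.\<close>

lemma norm_cis_minus_1_le_powr:
  assumes "0 \<le> d" "d \<le> 1"
  shows "cmod (cis x - 1) \<le> 2 * \<bar>x\<bar> powr d"
proof (cases "\<bar>x\<bar> \<le> 1")
  case True
  have "cmod (cis x - 1) \<le> \<bar>x\<bar>"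
    using norm_cis_diff_le[of x 0] by simp
  also have "\<bar>x\<bar> \<le> 2 * \<bar>x\<bar> powr d"
  proof (cases "x = 0")
    case False
    then have "\<bar>x\<bar> powr 1 \<le> \<bar>x\<bar> powr d"
      using True assms by (intro powr_mono') auto
    moreover have "0 \<le> \<bar>x\<bar> powr d" by simp
    ultimately show ?thesis using False by simp
  qed simp
  finally show ?thesis .
next
  case False
  have "cmod (cis x - 1) \<le> cmod (cis x) + cmod 1"
    by (rule norm_triangle_ineq4)
  also have "\<dots> = 2 * 1" by simp
  also have "\<dots> \<le> 2 * \<bar>x\<bar> powr d"
    using False assms by (intro mult_left_mono ge_one_powr_ge_zero) auto
  finally show ?thesis .
qed

section \<open>Moments of an integrable kernel\<close>

context tail_kernel
begin

lemma klim_eq_ft: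
  assumes k: "integrable lborel k" and "\<omega> \<noteq> 0"
  shows "klim k \<omega> = ft (\<lambda>t. of_real (k t)) \<omega>"
proof (rule LIMSEQ_unique[OF ktrans_LIMSEQ[OF assms(2)]])
  show "(\<lambda>n. ktrans k (real n) \<omega>) \<longlonglongrightarrow> ft (\<lambda>t. of_real (k t)) \<omega>"
    unfolding ktrans_def ft_def
  proof (rule integral_dominated_convergence[OF _ _ k])
    have "\<forall>\<^sub>F n in sequentially. cis (t * \<omega>) * trunc k (real n) t = cis (t * \<omega>) * of_real (k t)" for t
      using eventually_ge_at_top[of "nat \<lceil>t\<rceil>"]
      by eventually_elim (auto simp: trunc_def indicator_def)
    then show "AE t in lborel. (\<lambda>n. cis (t * \<omega>) * trunc k (real n) t) \<longlonglongrightarrow> cis (t * \<omega>) * of_real (k t)"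
      by (intro AE_I2 tendsto_eventually)
  qed (auto simp: norm_mult trunc_def indicator_def k_nonneg)
qed

lemma klim_minus_integral:
  assumes k: "integrable lborel k" and "\<omega> \<noteq> 0"
  shows "klim k \<omega> - of_real (LINT t|lborel. k t) = (LINT t|lborel. (cis (t * \<omega>) - 1) * of_real (k t))"
proof -
  have kc: "integrable lborel (\<lambda>t. complex_of_real (k t))"
    using k by (rule integrable_of_real)
  have "(LINT t|lborel. (cis (t * \<omega>) - 1) * of_real (k t)) = (LINT t|lborel. cis (t * \<omega>) * of_real (k t) - of_real (k t))"
    by (simp add: algebra_simps)
  also have "\<dots> = ft (\<lambda>t. of_real (k t)) \<omega> - (LINT t|lborel. of_real (k t))"
    unfolding ft_def by (rule Bochner_Integration.integral_diff[OF integrable_cis_mult[OF kc] kc])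
  finally show ?thesis
    by (simp add: klim_eq_ft[OF assms])
qed

text \<open>The interpolated bound for \<open>cis (t * \<omega>) - 1\<close> under the integral: a
  moment of order \<open>d\<close> makes the transform Hoelder continuous at the origin.\<close>

lemma klim_Hoelder:
  assumes k: "integrable lborel k" and tk: "integrable lborel (\<lambda>t. \<bar>t\<bar> powr d * k t)"
    and d: "0 \<le> d" "d \<le> 1" and "\<omega> \<noteq> 0"
  shows "cmod (klim k \<omega> - of_real (LINT t|lborel. k t)) \<le> 2 * (LINT t|lborel. \<bar>t\<bar> powr d * k t) * \<bar>\<omega>\<bar> powr d"
proof -
  have le: "cmod ((cis (t * \<omega>) - 1) * of_real (k t)) \<le> 2 * \<bar>\<omega>\<bar> powr d * (\<bar>t\<bar> powr d * k t)" for t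
    using mult_right_mono[OF norm_cis_minus_1_le_powr[OF d, of "t * \<omega>"] k_nonneg[of t]] k_nonneg[of t]
    by (simp add: norm_mult abs_mult powr_mult mult_ac)
  have dom: "integrable lborel (\<lambda>t. 2 * \<bar>\<omega>\<bar> powr d * (\<bar>t\<bar> powr d * k t))"
    by (rule integrable_mult_right[OF tk])
  have int: "integrable lborel (\<lambda>t. (cis (t * \<omega>) - 1) * of_real (k t))"
    by (rule Bochner_Integration.integrable_bound[OF dom])
       (use order_trans[OF le abs_ge_self] in auto)
  have "cmod (LINT t|lborel. (cis (t * \<omega>) - 1) * of_real (k t)) \<le> (LINT t|lborel. 2 * \<bar>\<omega>\<bar> powr d * (\<bar>t\<bar> powr d * k t))"
    by (intro order_trans[OF integral_norm_bound] integral_mono integrable_norm int dom le)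
  then show ?thesis
    unfolding klim_minus_integral[OF k assms(5)] Bochner_Integration.integral_mult_right_zero
    by (simp only: mult_ac)
qed

text \<open>The real part sees only \<open>cos (t * \<omega>) - 1\<close>, which is of second order,
  while the imaginary part remains linear in \<open>\<omega>\<close>.\<close>

lemma Re_klim_quadratic:
  assumes k: "integrable lborel k" and tk: "integrable lborel (\<lambda>t. t\<^sup>2 * k t)" and "\<omega> \<noteq> 0"
  shows "\<bar>Re (klim k \<omega> - of_real (LINT t|lborel. k t))\<bar> \<le> (LINT t|lborel. t\<^sup>2 * k t) * \<omega>\<^sup>2"
proof -
  have le: "\<bar>(cos (t * \<omega>) - 1) * k t\<bar> \<le> \<omega>\<^sup>2 * (t\<^sup>2 * k t)" for t
  proof -
    have "\<bar>cos (t * \<omega>) - 1\<bar> \<le> (t * \<omega>)\<^sup>2"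
      using one_minus_cos_le[of "t * \<omega>"] zero_le_power2[of "t * \<omega>"] cos_le_one[of "t * \<omega>"] by linarith
    from mult_right_mono[OF this k_nonneg[of t]] show ?thesis
      using k_nonneg[of t] by (simp add: abs_mult power_mult_distrib mult_ac)
  qed
  have dom: "integrable lborel (\<lambda>t. \<omega>\<^sup>2 * (t\<^sup>2 * k t))"
    by (rule integrable_mult_right[OF tk])
  have kc: "integrable lborel (\<lambda>t. complex_of_real (k t))"
    using k by (rule integrable_of_real)
  have int: "integrable lborel (\<lambda>t. (cos (t * \<omega>) - 1) * k t)"
    by (rule Bochner_Integration.integrable_bound[OF dom])
       (use order_trans[OF le abs_ge_self] in auto)
  have int': "integrable lborel (\<lambda>t. (cis (t * \<omega>) - 1) * of_real (k t))"
    using Bochner_Integration.integrable_diff[OF integrable_cis_mult[OF kc, of \<omega>] kc] by (simp add: algebra_simps)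
  have "Re (klim k \<omega> - of_real (LINT t|lborel. k t)) = (LINT t|lborel. (cos (t * \<omega>) - 1) * k t)"
    unfolding klim_minus_integral[OF k assms(3)] integral_Re[OF int', symmetric] by simp
  also have "\<bar>\<dots>\<bar> \<le> (LINT t|lborel. \<omega>\<^sup>2 * (t\<^sup>2 * k t))"
    by (intro order_trans[OF integral_abs_bound] integral_mono integrable_abs int dom le)
  finally show ?thesis
    unfolding Bochner_Integration.integral_mult_right_zero by (simp only: mult.commute)
qed

lemma klim_power_moment:
  assumes k: "integrable lborel k" and tk: "integrable lborel (\<lambda>t. \<bar>t\<bar> powr b * k t)" and d: "0 \<le> d" "d \<le> b"
  shows "integrable lborel (\<lambda>t. \<bar>t\<bar> powr d * k t)"
proof (rule Bochner_Integration.integrable_bound[OF Bochner_Integration.integrable_add[OF k tk]])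
  have "\<bar>t\<bar> powr d \<le> 1 + \<bar>t\<bar> powr b" for t
  proof (cases "\<bar>t\<bar> \<le> 1")
    case True
    then have "\<bar>t\<bar> powr d \<le> 1" using d by (intro powr_le1) auto
    then show ?thesis by (simp add: add_increasing2)
  next
    case False
    then have "\<bar>t\<bar> powr d \<le> \<bar>t\<bar> powr b" using d by (intro powr_mono) auto
    then show ?thesis by simp
  qed
  from mult_right_mono[OF this k_nonneg]
  have le: "\<bar>t\<bar> powr d * k t \<le> k t + \<bar>t\<bar> powr b * k t" for t
    by (simp add: distrib_right)
  show "AE t in lborel. norm (\<bar>t\<bar> powr d * k t) \<le> norm (k t + \<bar>t\<bar> powr b * k t)"
    using le k_nonneg by (auto simp: abs_mult)
qed measurable

lemma bounded_kernel_integrable: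
  assumes k: "integrable lborel k"
  shows "bounded_kernel k A (LINT t|lborel. k t) 0"
proof unfold_locales
  fix T \<omega> :: real assume "\<omega> \<noteq> 0"
  have "cmod (ktrans k T \<omega>) \<le> (LINT t|lborel. indicator {..T} t * k t)"
    by (rule norm_ktrans_le)
  also have "\<dots> \<le> (LINT t|lborel. k t)"
    by (intro integral_mono k_integrable k) (auto simp: indicator_def k_nonneg)
  also have "\<dots> \<le> (LINT t|lborel. k t) * (1 + \<bar>\<omega>\<bar> powr - 0)"
    using Bochner_Integration.integral_nonneg[of lborel k] k_nonneg \<open>\<omega> \<noteq> 0\<close> by simp
  finally show "cmod (ktrans k T \<omega>) \<le> (LINT t|lborel. k t) * (1 + \<bar>\<omega>\<bar> powr - 0)" .
qed auto

end

text \<open>To first order \<open>u - v\<close> is imaginary, so the linear term of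
  \<open>1 / u\<close> does not reach the real part: \<open>Re (u - v)\<close> and
  \<open>(u - v)^2\<close> are both \<open>O(\<omega>^2)\<close>.\<close>

lemma (in positive_kernel) spectral_density_quadratic:
  assumes k: "integrable lborel k" and tk: "integrable lborel (\<lambda>t. \<bar>t\<bar> powr 1 * k t)" and ttk: "integrable lborel (\<lambda>t. t\<^sup>2 * k t)"
    and pos: "0 < (LINT t|lborel. k t)"
  obtains E where "\<And>\<omega>. \<omega> \<noteq> 0 \<Longrightarrow> \<bar>r \<omega> - 1 / (pi * \<beta> * (LINT t|lborel. k t))\<bar> \<le> E * (\<omega>\<^sup>2 * inverse (1 + \<omega>\<^sup>2))"
proof -
  define \<kappa> where "\<kappa> = (LINT t|lborel. k t)"
  define v where "v = \<beta> * \<kappa>"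
  define c where "c = 1 / (pi * \<beta> * \<kappa>)"
  define u where "u \<omega> = of_real \<beta> * klim k \<omega> - \<i> * of_real (m * \<omega>)" for \<omega>
  define M1 where "M1 = (LINT t|lborel. \<bar>t\<bar> powr 1 * k t)"
  define M2 where "M2 = (LINT t|lborel. t\<^sup>2 * k t)"
  define G where "G = \<beta> * (2 * M1) + m"
  have M: "0 \<le> M1" "0 \<le> M2"
    unfolding M1_def M2_def by (rule Bochner_Integration.integral_nonneg; simp add: k_nonneg)+
  have v: "0 < v" using pos \<beta>_pos by (simp add: v_def \<kappa>_def)
  have c0: "0 < c" using pos \<beta>_pos by (simp add: c_def \<kappa>_def)
  have G0: "0 < G" using M \<beta>_pos m_pos by (simp add: G_def add_nonneg_pos)
  have s: "u \<omega> - of_real v = of_real \<beta> * (klim k \<omega> - of_real \<kappa>) - \<i> * of_real (m * \<omega>)" for \<omega>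
    by (simp add: u_def v_def algebra_simps)
  have s_le: "cmod (u \<omega> - of_real v) \<le> G * \<bar>\<omega>\<bar>" if "\<omega> \<noteq> 0" for \<omega>
  proof -
    have "cmod (u \<omega> - of_real v) \<le> cmod (of_real \<beta> * (klim k \<omega> - of_real \<kappa>)) + cmod (\<i> * of_real (m * \<omega>))"
      unfolding s by (rule norm_triangle_ineq4)
    also have "\<dots> = \<beta> * cmod (klim k \<omega> - of_real \<kappa>) + m * \<bar>\<omega>\<bar>"
      using \<beta>_pos m_pos by (simp add: norm_mult abs_mult)
    also have "\<dots> \<le> \<beta> * (2 * M1 * \<bar>\<omega>\<bar>) + m * \<bar>\<omega>\<bar>"
      using klim_Hoelder[OF k tk _ _ that] \<beta>_pos that
      by (intro add_right_mono mult_left_mono) (auto simp: \<kappa>_def M1_def)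
    finally show ?thesis by (simp add: G_def algebra_simps)
  qed
  have Re_s: "\<bar>Re (u \<omega> - of_real v)\<bar> \<le> \<beta> * M2 * \<omega>\<^sup>2" if "\<omega> \<noteq> 0" for \<omega>
  proof -
    have "Re (u \<omega> - of_real v) = \<beta> * Re (klim k \<omega> - of_real \<kappa>)"
      unfolding s by simp
    then show ?thesis
      using mult_left_mono[OF Re_klim_quadratic[OF k ttk that], of \<beta>] \<beta>_pos
      by (simp add: abs_mult \<kappa>_def M2_def mult.assoc)
  qed
  define e where "e = min 1 (v / (2 * G))"
  have e: "0 < e" "e \<le> 1" using v G0 by (auto simp: e_def)
  \<comment> \<open>The first summand stems from \<open>Re (u - v) / v^2\<close>, the second from
    the remainder \<open>(u - v)^2 / (v^2 u)\<close> with \<open>|u| \<ge> v / 2\<close>.\<close>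
  define E1 where "E1 = (\<beta> * M2 / v\<^sup>2 + 2 * G\<^sup>2 / v ^ 3) / pi"
  have E10: "0 \<le> E1" using M \<beta>_pos v G0 by (simp add: E1_def)
  have near: "\<bar>r \<omega> - c\<bar> \<le> 2 * E1 * (\<omega>\<^sup>2 * inverse (1 + \<omega>\<^sup>2))" if w: "\<omega> \<noteq> 0" "\<bar>\<omega>\<bar> \<le> e" for \<omega>
  proof -
    let ?s = "u \<omega> - of_real v"
    have "G * \<bar>\<omega>\<bar> \<le> G * (v / (2 * G))"
      using w G0 by (intro mult_left_mono) (auto simp: e_def)
    then have small: "cmod ?s \<le> v / 2"
      using s_le[OF w(1)] G0 by simp
    have "v \<le> cmod (u \<omega>) + cmod ?s"
      using norm_triangle_sub[of "of_real v :: complex" "u \<omega>"] v by (simp add: norm_minus_commute)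
    then have u: "v / 2 \<le> cmod (u \<omega>)" using small by linarith
    then have nz: "u \<omega> \<noteq> 0" using v by auto
    \<comment> \<open>Two terms of the geometric series at the real point \<open>v\<close>, with
      exact remainder.\<close>
    have "inverse (u \<omega>) = of_real (1 / v) - of_real (1 / v\<^sup>2) * ?s + of_real (1 / v\<^sup>2) * (?s\<^sup>2 * inverse (u \<omega>))"
      using nz v by (simp add: field_simps power2_eq_square)
    then have "Re (inverse (u \<omega>)) = Re (of_real (1 / v) - of_real (1 / v\<^sup>2) * ?s + of_real (1 / v\<^sup>2) * (?s\<^sup>2 * inverse (u \<omega>)))"
      by (rule arg_cong)
    also have "\<dots> = 1 / v - 1 / v\<^sup>2 * Re ?s + 1 / v\<^sup>2 * Re (?s\<^sup>2 * inverse (u \<omega>))"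
      unfolding plus_complex.sel minus_complex.sel(1)[of "of_real (1 / v)"] scaleR_conv_of_real[symmetric] scaleR_complex.sel
      by (simp only: Re_complex_of_real)
    finally have "\<bar>Re (inverse (u \<omega>)) - 1 / v\<bar> \<le> \<bar>1 / v\<^sup>2 * Re ?s\<bar> + \<bar>1 / v\<^sup>2 * Re (?s\<^sup>2 * inverse (u \<omega>))\<bar>"
      by linarith
    also have "\<dots> = 1 / v\<^sup>2 * \<bar>Re ?s\<bar> + 1 / v\<^sup>2 * \<bar>Re (?s\<^sup>2 * inverse (u \<omega>))\<bar>"
      by (simp only: abs_mult abs_of_nonneg[of "1 / v\<^sup>2"] zero_le_divide_1_iff zero_le_power2)
    also have "\<dots> \<le> 1 / v\<^sup>2 * (\<beta> * M2 * \<omega>\<^sup>2) + 1 / v\<^sup>2 * ((G * \<bar>\<omega>\<bar>)\<^sup>2 * (2 / v))"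
    proof (intro add_mono mult_left_mono Re_s w(1))
      have "\<bar>Re (?s\<^sup>2 * inverse (u \<omega>))\<bar> \<le> (cmod ?s)\<^sup>2 * inverse (cmod (u \<omega>))"
        using abs_Re_le_cmod[of "?s\<^sup>2 * inverse (u \<omega>)"] by (simp add: norm_mult norm_power norm_inverse)
      also have "\<dots> \<le> (G * \<bar>\<omega>\<bar>)\<^sup>2 * inverse (v / 2)"
        using s_le[OF w(1)] u v by (intro mult_mono power_mono le_imp_inverse_le) auto
      finally show "\<bar>Re (?s\<^sup>2 * inverse (u \<omega>))\<bar> \<le> (G * \<bar>\<omega>\<bar>)\<^sup>2 * (2 / v)"
        by simp
    qed auto
    also have "\<dots> = pi * E1 * \<omega>\<^sup>2"
      using v by (simp add: E1_def power_mult_distrib field_simps power2_eq_square power3_eq_cube)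
    finally have 1: "\<bar>Re (inverse (u \<omega>)) - 1 / v\<bar> \<le> pi * E1 * \<omega>\<^sup>2" .
    define Q where "Q = Re (inverse (u \<omega>))"
    have "r \<omega> = Q / pi"
      unfolding Q_def u_def by (rule spectral_density_eq_inverse[OF w(1)])
    moreover have "c = (1 / v) / pi" by (simp add: c_def v_def)
    ultimately have "\<bar>r \<omega> - c\<bar> = \<bar>Q - 1 / v\<bar> / pi"
      by (simp only: diff_divide_distrib[symmetric] abs_divide) simp
    also have "\<dots> \<le> E1 * \<omega>\<^sup>2"
      using 1[folded Q_def] by (simp add: divide_le_eq mult_ac)
    also have "\<dots> \<le> E1 * (2 * (\<omega>\<^sup>2 * inverse (1 + \<omega>\<^sup>2)))"
    proof (intro mult_left_mono E10)
      have "\<omega>\<^sup>2 \<le> 1" using w e by (simp add: abs_square_le_1)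
      then have "1 \<le> 2 * inverse (1 + \<omega>\<^sup>2)"
        by (simp add: field_simps add_pos_nonneg)
      from mult_left_mono[OF this, of "\<omega>\<^sup>2"] show "\<omega>\<^sup>2 \<le> 2 * (\<omega>\<^sup>2 * inverse (1 + \<omega>\<^sup>2))"
        by simp
    qed
    finally show ?thesis by simp
  qed
  obtain b where b: "\<And>\<omega>. e \<le> \<bar>\<omega>\<bar> \<Longrightarrow> r \<omega> \<le> b"
    using spectral_density_bounded_away[OF e(1)] by blast
  have b0: "0 \<le> b" using order_trans[OF spectral_density_nonneg b[of e]] e by simp
  \<comment> \<open>For \<open>|\<omega>| \<ge> e\<close> the weight
    \<open>\<omega>^2 / (1 + \<omega>^2)\<close> is at least
    \<open>1 / (1 + 1 / e^2)\<close>.\<close>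
  define E2 where "E2 = (b + c) * (1 + 1 / e\<^sup>2)"
  have far: "\<bar>r \<omega> - c\<bar> \<le> E2 * (\<omega>\<^sup>2 * inverse (1 + \<omega>\<^sup>2))" if w: "e \<le> \<bar>\<omega>\<bar>" for \<omega>
  proof -
    have "e\<^sup>2 \<le> \<omega>\<^sup>2" using w e by (simp add: abs_le_square_iff[symmetric])
    moreover have "0 < e\<^sup>2" using e by simp
    ultimately have "1 + \<omega>\<^sup>2 \<le> (1 + 1 / e\<^sup>2) * \<omega>\<^sup>2"
      by (simp add: field_simps)
    then have 1: "1 \<le> (1 + 1 / e\<^sup>2) * (\<omega>\<^sup>2 * inverse (1 + \<omega>\<^sup>2))"
      using inverse_quad_pos[of \<omega>] by (simp add: field_simps add_pos_nonneg)
    have "\<bar>r \<omega> - c\<bar> \<le> b + c"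
      using b[OF w] spectral_density_nonneg[of \<omega>] c0 b0 by linarith
    also have "\<dots> \<le> (b + c) * ((1 + 1 / e\<^sup>2) * (\<omega>\<^sup>2 * inverse (1 + \<omega>\<^sup>2)))"
      using mult_left_mono[OF 1, of "b + c"] b0 c0 by simp
    finally show ?thesis by (simp add: E2_def mult.assoc)
  qed
  show thesis
  proof (rule that[of "max (2 * E1) E2"])
    fix \<omega> :: real assume "\<omega> \<noteq> 0"
    have q: "0 \<le> \<omega>\<^sup>2 * inverse (1 + \<omega>\<^sup>2)"
      using inverse_quad_pos[of \<omega>] by (intro mult_nonneg_nonneg) auto
    have "\<bar>r \<omega> - c\<bar> \<le> max (2 * E1) E2 * (\<omega>\<^sup>2 * inverse (1 + \<omega>\<^sup>2))"
    proof (cases "\<bar>\<omega>\<bar> \<le> e")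
      case True
      then show ?thesis
        using near[OF \<open>\<omega> \<noteq> 0\<close>] mult_right_mono[OF max.cobounded1 q] order_trans by blast
    next
      case False
      then show ?thesis
        using far[of \<omega>] mult_right_mono[OF max.cobounded2 q] order_trans by (meson linear)
    qed
    then show "\<bar>r \<omega> - 1 / (pi * \<beta> * (LINT t|lborel. k t))\<bar> \<le> max (2 * E1) E2 * (\<omega>\<^sup>2 * inverse (1 + \<omega>\<^sup>2))"
      by (simp only: c_def \<kappa>_def)
  qed
qed

section \<open>The Fourier transform of a power\<close>

text \<open>The factor \<open>exp (- \<epsilon> t)\<close> regularises the power as in Abel
  summation; \<open>\<epsilon> = 0\<close> is the pure power, \<open>\<epsilon> = 1\<close> the
  integrand of a Gamma integral.\<close>

definition damped_power :: "real \<Rightarrow> real \<Rightarrow> real \<Rightarrow> real" where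
  "damped_power a \<epsilon> t = (if t \<le> 0 then 0 else t powr (- a) * exp (- \<epsilon> * t))"

lemma damped_power_measurable [measurable]: "damped_power a \<epsilon> \<in> borel_measurable borel"
  unfolding damped_power_def by measurable

lemma integrable_powr_upto:
  fixes a T :: real
  assumes "a < 1"
  shows "integrable lborel (\<lambda>t. indicator {0<..T} t * t powr (- a))"
proof (cases "0 \<le> T")
  case True
  show ?thesis
    by (rule integrable_lborel_of_integrable_on) (use integrable_on_powr_from_0'[of "- a" T] True assms in auto)
next
  case False
  then have "(\<lambda>t. indicator {0<..T} t * t powr (- a)) = (\<lambda>t. 0)"
    by (auto simp: indicator_def)
  then show ?thesis by simp
qed

lemma integral_powr_upto:
  fixes a T :: real
  assumes "a < 1" "0 \<le> T"
  shows "(LINT t|lborel. indicator {0<..T} t * t powr (- a)) = T powr (1 - a) / (1 - a)"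
proof -
  have "set_integrable lborel {0<..T} (\<lambda>t. t powr (- a))"
    using integrable_powr_upto[OF assms(1), of T] by (simp add: set_integrable_def)
  from set_borel_integral_eq_integral(2)[OF this]
  have "(LINT t|lborel. indicator {0<..T} t * t powr (- a)) = integral {0<..T} (\<lambda>t. t powr (- a))"
    by (simp add: set_lebesgue_integral_def)
  also have "\<dots> = integral {0..T} (\<lambda>t. t powr (- a))"
    by (rule integral_spike_set) (auto intro!: negligible_subset[OF negligible_sing[of 0]])
  also have "\<dots> = T powr (1 - a) / (1 - a)"
    using has_integral_powr_from_0[of "- a" T] assms by (simp add: integral_unique)
  finally show ?thesis .
qed

lemma tail_kernel_damped_power:
  assumes a: "0 < a" "a < 1" and \<epsilon>: "0 \<le> \<epsilon>" and A: "0 < A"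
  shows "tail_kernel (damped_power a \<epsilon>) A"
proof
  show "integrable lborel (\<lambda>t. indicator {..T} t * damped_power a \<epsilon> t)" for T
  proof (rule Bochner_Integration.integrable_bound[OF integrable_powr_upto[OF a(2), of T]])
    show "AE t in lborel. norm (indicator {..T} t * damped_power a \<epsilon> t) \<le> norm (indicator {0<..T} t * t powr (- a))"
      using \<epsilon> by (intro AE_I2) (auto simp: indicator_def damped_power_def abs_mult mult_left_le)
  qed measurable
  show "damped_power a \<epsilon> t \<le> damped_power a \<epsilon> s" if "A \<le> s" "s \<le> t" for s t
    using that A a \<epsilon> unfolding damped_power_def
    by (auto intro!: mult_mono powr_mono2' mult_left_mono)
  show "(damped_power a \<epsilon> \<longlongrightarrow> 0) at_top"
  proof (rule Lim_null_comparison)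
    show "\<forall>\<^sub>F t in at_top. norm (damped_power a \<epsilon> t) \<le> t powr (- a)"
      using eventually_gt_at_top[of 0]
      by eventually_elim (use \<epsilon> in \<open>auto simp: damped_power_def abs_mult mult_left_le\<close>)
    show "((\<lambda>t. t powr (- a)) \<longlongrightarrow> 0) at_top"
      using a by real_asymp
  qed
qed (use A in \<open>auto simp: damped_power_def\<close>)

lemma integrable_Gamma_kernel:
  fixes b :: real
  assumes "b > -1"
  shows "integrable lborel (\<lambda>t. indicator {0<..} t * (t powr b * exp (- t)))"
proof -
  have "(\<integral>\<^sup>+t. ennreal (indicator {0..} t * (t::real) powr (b + 1 - 1) / exp t) \<partial>lborel) = ennreal (Gamma (b + 1))"
    using assms by (intro Gamma_conv_nn_integral_real[symmetric]) simp
  then have "integrable lborel (\<lambda>t. indicator {0..} t * (t::real) powr (b + 1 - 1) / exp t)"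
    using assms by (intro integrableI_nn_integral_finite[of _ _ "Gamma (b + 1)"])
      (auto intro!: AE_I2)
  moreover have "indicator {0..} t * t powr (b + 1 - 1) / exp t = indicator {0<..} t * (t powr b * exp (- t))" for t
    by (simp add: indicator_def exp_minus divide_inverse)
  ultimately show ?thesis
    by (simp only:)
qed

lemma damped_power_1: "damped_power a 1 t = indicator {0<..} t * (t powr (- a) * exp (- t))"
  by (simp add: damped_power_def indicator_def)

text \<open>By parts, the transform solves \<open>(1 - \<i> y) f' = \<i> (1 - a) f\<close>, as does
  \<open>(1 - \<i> y)^(a - 1)\<close>. Since \<open>1 - \<i> y\<close> has positive real part, the
  principal logarithm is smooth along the whole line.\<close>

lemma ft_damped_power_1:
  assumes a: "0 < a" "a < 1"
  shows "ft (\<lambda>t. of_real (damped_power a 1 t)) y = of_real (LINT t|lborel. damped_power a 1 t) * exp (of_real (a - 1) * Ln (1 - \<i> * of_real y))"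
proof -
  let ?f = "\<lambda>t. complex_of_real (damped_power a 1 t)"
  let ?h = "\<lambda>t. of_real t * ?f t"
  have f: "integrable lborel ?f"
    unfolding damped_power_1 using integrable_Gamma_kernel[of "- a"] a by (intro integrable_of_real) simp
  have h: "integrable lborel ?h"
  proof -
    have "t * damped_power a 1 t = indicator {0<..} t * (t powr (1 - a) * exp (- t))" for t
      using powr_add[of t 1 "- a"] by (auto simp: damped_power_1 indicator_def)
    then have "integrable lborel (\<lambda>t. t * damped_power a 1 t)"
      using integrable_Gamma_kernel[of "1 - a"] a by simp
    from integrable_of_real[OF this, where 'a=complex] show ?thesis by simp
  qed
  have parts: "of_real (1 - a) * ft ?f y = (1 - \<i> * of_real y) * ft ?h y" for y
  proof -
    let ?F = "\<lambda>t. complex_of_real (t powr (1 - a) * exp (- t)) * cis (y * t)"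
    let ?G = "\<lambda>t. of_real (1 - a) * (cis (t * y) * ?f t) - (1 - \<i> * of_real y) * (cis (t * y) * ?h t)"
    have G: "integrable lborel ?G"
      by (intro Bochner_Integration.integrable_diff integrable_mult_right integrable_cis_mult f h)
    have "(LBINT t=0..\<infinity>. ?G t) = 0 - 0"
    proof (rule interval_integral_FTC_integrable)
      fix t assume "ereal t < \<infinity>" "0 < ereal t"
      then have t: "0 < t" by simp
      have "((\<lambda>t. t powr (1 - a) * exp (- t)) has_real_derivative ((1 - a) * t powr (- a) * exp (- t) - t powr (1 - a) * exp (- t))) (at t)"
        using t by (auto intro!: derivative_eq_intros simp: algebra_simps)
      from has_vector_derivative_mult[OF has_vector_derivative_of_real[OF this] has_vector_derivative_cis[of y t]]
      have "(?F has_vector_derivative (of_real (t powr (1 - a) * exp (- t)) * (\<i> * of_real y * cis (y * t)) +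
          of_real ((1 - a) * t powr (- a) * exp (- t) - t powr (1 - a) * exp (- t)) * cis (y * t))) (at t)" .
      moreover have "t powr (1 - a) = t * t powr (- a)"
        using t powr_add[of t 1 "- a"] by simp
      ultimately show "(?F has_vector_derivative ?G t) (at t)"
        using t by (simp add: damped_power_def algebra_simps)
      have c: "isCont (\<lambda>t. cis (t * y)) t"
        using has_vector_derivative_continuous[OF has_vector_derivative_cis[of y t]] by (simp add: mult.commute)
      have "isCont (\<lambda>t. of_real (1 - a) * (cis (t * y) * of_real (t powr (- a) * exp (- t))) -
            (1 - \<i> * of_real y) * (cis (t * y) * (of_real t * of_real (t powr (- a) * exp (- t))))) t"
        using t by (auto intro!: continuous_intros c)
      moreover have "\<forall>\<^sub>F s in nhds t. of_real (1 - a) * (cis (s * y) * of_real (s powr (- a) * exp (- s))) -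
            (1 - \<i> * of_real y) * (cis (s * y) * (of_real s * of_real (s powr (- a) * exp (- s)))) = ?G s"
        using eventually_nhds_in_open[of "{0<..}" t] t
        by (auto elim!: eventually_mono simp: damped_power_def)
      ultimately show "isCont ?G t"
        by (simp add: isCont_cong)
    next
      show "set_integrable lborel (einterval 0 \<infinity>) ?G"
        unfolding set_integrable_def by (rule integrable_mult_indicator[OF _ G]) simp
      have n: "norm (?F t) \<le> t powr (1 - a) * exp (- t)" for t
        by (simp add: norm_mult abs_mult)
      have "((\<lambda>t. t powr (1 - a) * exp (- t)) \<longlongrightarrow> 0) (at_right 0)"
        using a by real_asymp
      then have "(?F \<longlongrightarrow> 0) (at_right 0)"
        by (rule Lim_null_comparison[OF always_eventually, rotated]) (use n in blast)
      then show "((?F \<circ> real_of_ereal) \<longlongrightarrow> 0) (at_right 0)"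
        by (simp add: ereal_tendsto_simps zero_ereal_def)
      have "((\<lambda>t. t powr (1 - a) * exp (- t)) \<longlongrightarrow> 0) at_top"
        using a by real_asymp
      then have "(?F \<longlongrightarrow> 0) at_top"
        by (rule Lim_null_comparison[OF always_eventually, rotated]) (use n in blast)
      then show "((?F \<circ> real_of_ereal) \<longlongrightarrow> 0) (at_left \<infinity>)"
        by (simp add: ereal_tendsto_simps)
    qed simp
    moreover have "(LBINT t=0..\<infinity>. ?G t) = (LINT t|lborel. ?G t)"
      unfolding interval_lebesgue_integral_def set_lebesgue_integral_def
      by (auto intro!: Bochner_Integration.integral_cong simp: indicator_def einterval_def damped_power_def)
    moreover have "(LINT t|lborel. ?G t) = of_real (1 - a) * ft ?f y - (1 - \<i> * of_real y) * ft ?h y"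
      unfolding ft_def
      by (subst Bochner_Integration.integral_diff)
         (simp_all only: Bochner_Integration.integral_mult_right_zero integrable_mult_right integrable_cis_mult f h)
    ultimately show ?thesis by simp
  qed
  \<comment> \<open>The quotient of the transform and the explicit solution, constant by the
    differential equation.\<close>
  define \<Psi> where "\<Psi> y = ft ?f y * exp (of_real (1 - a) * Ln (1 - \<i> * of_real y))" for y
  have "(\<Psi> has_vector_derivative 0) (at y within UNIV)" for y
  proof -
    have nz: "1 - \<i> * of_real y \<noteq> 0" by (simp add: complex_eq_iff)
    have ndom: "1 - \<i> * of_real y \<notin> \<real>\<^sub>\<le>\<^sub>0"
      by (simp add: complex_nonpos_Reals_iff)
    have "((\<lambda>z. of_real (1 - a) * Ln (1 - \<i> * z)) has_field_derivative
        of_real (1 - a) * (- \<i> / (1 - \<i> * of_real y))) (at (of_real y))"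
    proof -
      have "((\<lambda>z. 1 - \<i> * z) has_field_derivative - \<i>) (at (of_real y))"
        by (auto intro!: derivative_eq_intros)
      from DERIV_cmult[OF DERIV_chain2[OF has_field_derivative_Ln[OF ndom] this], of "of_real (1 - a)"]
      show ?thesis
        by (simp only: divide_inverse mult.commute)
    qed
    from has_vector_derivative_real_field[OF DERIV_fun_exp[OF this]]
    have e: "((\<lambda>y. exp (of_real (1 - a) * Ln (1 - \<i> * of_real y))) has_vector_derivative
        exp (of_real (1 - a) * Ln (1 - \<i> * of_real y)) * (of_real (1 - a) * (- \<i> / (1 - \<i> * of_real y)))) (at y)" .
    have g: "(ft ?f has_vector_derivative \<i> * ft ?h y) (at y)"
      using ft_has_vector_derivative[OF f h, of y] by (simp only: ft_cmult)
    have "ft ?h y = of_real (1 - a) * ft ?f y / (1 - \<i> * of_real y)"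
      unfolding parts using nz by simp
    then have "ft ?f y * (exp (of_real (1 - a) * Ln (1 - \<i> * of_real y)) * (of_real (1 - a) * (- \<i> / (1 - \<i> * of_real y)))) +
      \<i> * ft ?h y * exp (of_real (1 - a) * Ln (1 - \<i> * of_real y)) = 0"
      by (simp add: mult_ac)
    with has_vector_derivative_mult[OF g e] show ?thesis
      unfolding \<Psi>_def[abs_def] by simp
  qed
  from has_vector_derivative_zero_constant[OF convex_UNIV this]
  obtain c where "\<And>y. \<Psi> y = c" by auto
  then have "\<Psi> y = \<Psi> 0" by simp
  also have "\<Psi> 0 = of_real (LINT t|lborel. damped_power a 1 t)"
    by (simp add: \<Psi>_def ft_def)
  finally have "ft ?f y * exp (of_real (1 - a) * Ln (1 - \<i> * of_real y)) * exp (of_real (a - 1) * Ln (1 - \<i> * of_real y))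
      = of_real (LINT t|lborel. damped_power a 1 t) * exp (of_real (a - 1) * Ln (1 - \<i> * of_real y))"
    by (simp add: \<Psi>_def)
  moreover have "exp (of_real (1 - a) * Ln (1 - \<i> * of_real y)) * exp (of_real (a - 1) * Ln (1 - \<i> * of_real y)) = 1"
    unfolding exp_add[symmetric] distrib_right[symmetric] by simp
  ultimately show ?thesis
    by (simp only: mult.assoc mult_1_right)
qed

text \<open>The substitution \<open>t \<mapsto> t / \<epsilon>\<close> reduces to damping rate 1 at
  frequency \<open>1 / \<epsilon>\<close>. The positive factor \<open>\<epsilon>\<close> may be
  drawn into the logarithm without changing its branch.\<close>

lemma ft_damped_power:
  assumes a: "0 < a" "a < 1" and \<epsilon>: "0 < \<epsilon>"
  shows "ft (\<lambda>t. of_real (damped_power a \<epsilon> t)) 1 = of_real (LINT t|lborel. damped_power a 1 t) * exp (of_real (a - 1) * Ln (of_real \<epsilon> - \<i>))"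
    and "integrable lborel (damped_power a \<epsilon>)"
proof -
  have sc: "damped_power a \<epsilon> ((1 / \<epsilon>) * t) = \<epsilon> powr a * damped_power a 1 t" for t
    using \<epsilon> by (auto simp: damped_power_def powr_divide powr_minus field_simps)
  have sc': "damped_power a \<epsilon> t = \<epsilon> powr a * damped_power a 1 (\<epsilon> * t)" for t
    using sc[of "\<epsilon> * t"] \<epsilon> by simp
  have i1: "integrable lborel (damped_power a 1)"
    using integrable_Gamma_kernel[of "- a"] a by (simp add: damped_power_1[abs_def])
  show "integrable lborel (damped_power a \<epsilon>)"
    unfolding sc'[abs_def] using lborel_integrable_real_affine[OF i1, of \<epsilon> 0] \<epsilon> by (intro integrable_mult_right) simp
  have "ft (\<lambda>t. of_real (damped_power a \<epsilon> t)) 1 = (1 / \<epsilon>) *\<^sub>R (LINT t|lborel. cis ((0 + (1 / \<epsilon>) * t) * 1) * of_real (damped_power a \<epsilon> (0 + (1 / \<epsilon>) * t)))"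
    unfolding ft_def using \<epsilon> by (subst lborel_integral_real_affine[of "1 / \<epsilon>" _ 0]) auto
  also have "(LINT t|lborel. cis ((0 + (1 / \<epsilon>) * t) * 1) * of_real (damped_power a \<epsilon> (0 + (1 / \<epsilon>) * t)))
      = (LINT t|lborel. of_real (\<epsilon> powr a) * (cis (t * (1 / \<epsilon>)) * of_real (damped_power a 1 t)))"
    unfolding add_0 sc by (intro Bochner_Integration.integral_cong) (simp_all add: mult_ac)
  also have "\<dots> = of_real (\<epsilon> powr a) * ft (\<lambda>t. of_real (damped_power a 1 t)) (1 / \<epsilon>)"
    by (simp add: ft_def)
  also have "(1 / \<epsilon>) *\<^sub>R \<dots> = of_real (\<epsilon> powr (a - 1)) * ft (\<lambda>t. of_real (damped_power a 1 t)) (1 / \<epsilon>)"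
    using \<epsilon> by (simp add: scaleR_conv_of_real powr_diff)
  also have "\<dots> = of_real (LINT t|lborel. damped_power a 1 t) * (of_real (\<epsilon> powr (a - 1)) * exp (of_real (a - 1) * Ln (1 - \<i> * of_real (1 / \<epsilon>))))"
    unfolding ft_damped_power_1[OF a] by (simp only: mult_ac)
  also have "of_real (\<epsilon> powr (a - 1)) * exp (of_real (a - 1) * Ln (1 - \<i> * of_real (1 / \<epsilon>))) = exp (of_real (a - 1) * Ln (of_real \<epsilon> - \<i>))"
  proof -
    have nz: "1 - \<i> * of_real (1 / \<epsilon>) \<noteq> 0" by (simp add: complex_eq_iff)
    have "of_real \<epsilon> - \<i> = of_real \<epsilon> * (1 - \<i> * of_real (1 / \<epsilon>))"
      using \<epsilon> by (simp add: field_simps)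
    then have "Ln (of_real \<epsilon> - \<i>) = of_real (ln \<epsilon>) + Ln (1 - \<i> * of_real (1 / \<epsilon>))"
      using Ln_times_of_real[OF \<epsilon> nz] Ln_of_real[OF \<epsilon>] by simp
    moreover have "\<epsilon> powr (a - 1) = exp ((a - 1) * ln \<epsilon>)"
      using \<epsilon> by (simp add: powr_def)
    then have "complex_of_real (\<epsilon> powr (a - 1)) = exp (of_real (a - 1) * of_real (ln \<epsilon>))"
      by (simp only: exp_of_real[symmetric] of_real_mult)
    ultimately show ?thesis
      by (simp add: distrib_left exp_add)
  qed
  finally show "ft (\<lambda>t. of_real (damped_power a \<epsilon> t)) 1 = of_real (LINT t|lborel. damped_power a 1 t) * exp (of_real (a - 1) * Ln (of_real \<epsilon> - \<i>))" .
qed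

text \<open>
  Abel summation of \<open>\<integral> t^(-a) e^(i t) dt\<close>. Only the argument of the value is computed: the modulus
  cancels in the constant of the subdiffusive regime.
\<close>
lemma klim_power_direction:
  assumes a: "0 < a" "a < 1"
  obtains \<rho> where "0 < \<rho>" "klim (damped_power a 0) 1 = of_real \<rho> * cis (pi * (1 - a) / 2)"
proof -
  define \<rho> where "\<rho> = (LINT t|lborel. damped_power a 1 t)"
  define \<epsilon> where "\<epsilon> n = 1 / real (Suc n)" for n
  have \<epsilon>: "0 < \<epsilon> n" for n by (simp add: \<epsilon>_def)
  have \<epsilon>_lim: "\<epsilon> \<longlonglongrightarrow> 0"
    unfolding \<epsilon>_def[abs_def] by (rule lim_1_over_n[THEN LIMSEQ_Suc])
  let ?G = "\<lambda>n. klim (damped_power a (\<epsilon> n)) 1"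
  have "?G n = of_real \<rho> * exp (of_real (a - 1) * Ln (of_real (\<epsilon> n) - \<i>))" for n
  proof -
    interpret tail_kernel "damped_power a (\<epsilon> n)" 1
      using tail_kernel_damped_power[OF a less_imp_le[OF \<epsilon>]] by simp
    show ?thesis
      using klim_eq_ft[OF ft_damped_power(2)[OF a \<epsilon>], of 1] ft_damped_power(1)[OF a \<epsilon>] by (simp add: \<rho>_def)
  qed
  moreover have "(\<lambda>n. of_real \<rho> * exp (of_real (a - 1) * Ln (of_real (\<epsilon> n) - \<i>))) \<longlonglongrightarrow> of_real \<rho> * exp (of_real (a - 1) * Ln (of_real 0 - \<i>))"
    by (intro tendsto_intros \<epsilon>_lim) (simp add: complex_nonpos_Reals_iff)
  moreover have "exp (of_real (a - 1) * Ln (of_real 0 - \<i>)) = cis (pi * (1 - a) / 2)"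
  proof -
    \<comment> \<open>\<open>Ln (- \<i>) = - \<i> pi / 2\<close> fixes the argument.\<close>
    have "of_real (a - 1) * Ln (of_real 0 - \<i>) = \<i> * of_real (pi * (1 - a) / 2)"
      by (simp add: field_simps)
    then show ?thesis
      by (simp only: cis_conv_exp)
  qed
  ultimately have lim1: "?G \<longlonglongrightarrow> of_real \<rho> * cis (pi * (1 - a) / 2)"
    by simp
  \<comment> \<open>The limits in \<open>\<epsilon>\<close> and in the truncation are exchanged:
    beyond \<open>S\<close> the tail is at most \<open>8 S^(-a)\<close> for every
    \<open>\<epsilon> \<ge> 0\<close>, so two tails cost \<open>16 S^(-a)\<close>; the truncated
    transforms converge by domination.\<close>
  have lim2: "?G \<longlonglongrightarrow> klim (damped_power a 0) 1"
  proof (rule LIMSEQ_I)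
    fix e :: real assume "0 < e"
    have "((\<lambda>S. 16 * S powr (- a)) \<longlongrightarrow> 0) at_top"
      using a by real_asymp
    from order_tendstoD(2)[OF this, of "e / 2"] \<open>0 < e\<close>
    have "\<forall>\<^sub>F S in at_top. 1 \<le> S \<and> 16 * S powr (- a) < e / 2"
      by (intro eventually_conj eventually_ge_at_top) simp
    then obtain S where S: "1 \<le> S" "16 * S powr (- a) < e / 2"
      by (auto dest!: eventually_happens)
    have tail: "cmod (klim (damped_power a x) 1 - ktrans (damped_power a x) S 1) \<le> 8 * S powr (- a)" if "0 \<le> x" for x
    proof -
      interpret tail_kernel "damped_power a x" 1
        using tail_kernel_damped_power[OF a that] by simp
      have "damped_power a x S \<le> S powr (- a)"
        using S(1) that by (simp add: damped_power_def mult_left_le)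
      then show ?thesis
        using klim_diff_le[OF S(1), of 1] by simp
    qed
    have "(\<lambda>n. ktrans (damped_power a (\<epsilon> n)) S 1) \<longlonglongrightarrow> ktrans (damped_power a 0) S 1"
      unfolding ktrans_def ft_def
    proof (rule integral_dominated_convergence[OF _ _ integrable_powr_upto[OF a(2), of S]])
      show "AE t in lborel. (\<lambda>n. cis (t * 1) * trunc (damped_power a (\<epsilon> n)) S t) \<longlonglongrightarrow> cis (t * 1) * trunc (damped_power a 0) S t"
      proof (rule AE_I2)
        fix t
        have "(\<lambda>n. damped_power a (\<epsilon> n) t) \<longlonglongrightarrow> damped_power a 0 t"
          unfolding damped_power_def by (auto intro!: tendsto_eq_intros \<epsilon>_lim)
        then show "(\<lambda>n. cis (t * 1) * trunc (damped_power a (\<epsilon> n)) S t) \<longlonglongrightarrow> cis (t * 1) * trunc (damped_power a 0) S t"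
          unfolding trunc_def by (intro tendsto_intros)
      qed
      show "AE t in lborel. norm (cis (t * 1) * trunc (damped_power a (\<epsilon> n)) S t) \<le> indicator {0<..S} t * t powr (- a)" for n
        using less_imp_le[OF \<epsilon>[of n]]
        by (intro AE_I2) (auto simp: norm_mult trunc_def damped_power_def indicator_def abs_mult mult_left_le)
    qed (simp_all add: trunc_def[abs_def])
    from LIMSEQ_D[OF this, of "e / 2"] \<open>0 < e\<close>
    obtain N where N: "\<And>n. N \<le> n \<Longrightarrow> cmod (ktrans (damped_power a (\<epsilon> n)) S 1 - ktrans (damped_power a 0) S 1) < e / 2"
      by auto
    have eps: "x + y + z < e" if "x \<le> 8 * q" "y < e / 2" "z \<le> 8 * q" "16 * q < e / 2" for x y z q :: real
      using that by linarith
    show "\<exists>N. \<forall>n\<ge>N. cmod (?G n - klim (damped_power a 0) 1) < e"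
    proof (intro exI[of _ N] allI impI)
      fix n assume "N \<le> n"
      have tri: "cmod (x - z) \<le> cmod (x - y) + cmod (y - y') + cmod (z - y')" for x y y' z :: complex
        using norm_triangle_ineq4[of "(x - y) + (y - y')" "z - y'"] norm_triangle_ineq[of "x - y" "y - y'"] by simp
      show "cmod (?G n - klim (damped_power a 0) 1) < e"
        by (rule le_less_trans[OF tri eps[OF tail[OF less_imp_le[OF \<epsilon>[of n]]] N[OF \<open>N \<le> n\<close>] tail[OF order_refl] S(2)]])
    qed
  qed
  have "0 < \<rho>"
  proof -
    have i1: "integrable lborel (damped_power a 1)"
      using ft_damped_power(2)[OF a] by simp
    have nn: "0 \<le> damped_power a 1 t" for t by (simp add: damped_power_def)
    have "\<rho> \<noteq> 0"
    proof
      assume "\<rho> = 0"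
      then have "AE t in lborel. damped_power a 1 t = 0"
        using integral_nonneg_eq_0_iff_AE[OF i1] nn by (simp add: \<rho>_def)
      then have "AE t in lborel. t \<notin> {0<..<1::real}"
        by eventually_elim (auto simp: damped_power_def)
      then have "{0<..<1::real} \<in> null_sets lborel"
        by (subst AE_iff_null_sets) auto
      then have "emeasure lborel {0<..<1::real} = 0"
        by (rule null_setsD1)
      then show False by (simp only: emeasure_lborel_Ioo) simp
    qed
    moreover have "0 \<le> \<rho>"
      unfolding \<rho>_def by (rule Bochner_Integration.integral_nonneg) (rule nn)
    ultimately show ?thesis by simp
  qed
  then show thesis
    using LIMSEQ_unique[OF lim2 lim1] by (rule that)
qed

text \<open>Homogeneity of the power under \<open>t \<mapsto> t / \<omega>\<close>; the truncation
  is rescaled too, which does not affect the limit.\<close>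

lemma klim_power_scaling:
  assumes a: "0 < a" "a < 1" and w: "0 < \<omega>"
  shows "klim (damped_power a 0) \<omega> = of_real (\<omega> powr (a - 1)) * klim (damped_power a 0) 1"
proof -
  interpret tail_kernel "damped_power a 0" 1
    using tail_kernel_damped_power[OF a] by simp
  have sc: "trunc (damped_power a 0) T ((1 / \<omega>) * t) = of_real (\<omega> powr a) * trunc (damped_power a 0) (T * \<omega>) t" for T t
  proof -
    have "((1 / \<omega>) * t) powr (- a) = \<omega> powr a * t powr (- a)" if "0 < t"
      using w that by (simp add: powr_divide powr_minus field_simps)
    then have "damped_power a 0 ((1 / \<omega>) * t) = \<omega> powr a * damped_power a 0 t"
      using w by (simp add: damped_power_def field_simps)
    moreover have "indicator {..T} ((1 / \<omega>) * t) = (indicator {..T * \<omega>} t :: real)"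
      using w by (simp add: indicator_def field_simps)
    ultimately show ?thesis
      unfolding trunc_def by simp
  qed
  have "ktrans (damped_power a 0) T \<omega> = of_real (\<omega> powr (a - 1)) * ktrans (damped_power a 0) (T * \<omega>) 1" for T
  proof -
    have "ktrans (damped_power a 0) T \<omega> = (1 / \<omega>) *\<^sub>R (LINT t|lborel. cis ((0 + (1 / \<omega>) * t) * \<omega>) * trunc (damped_power a 0) T (0 + (1 / \<omega>) * t))"
      unfolding ktrans_def ft_def using w by (subst lborel_integral_real_affine[of "1 / \<omega>" _ 0]) auto
    also have "(LINT t|lborel. cis ((0 + (1 / \<omega>) * t) * \<omega>) * trunc (damped_power a 0) T (0 + (1 / \<omega>) * t))
        = (LINT t|lborel. of_real (\<omega> powr a) * (cis (t * 1) * trunc (damped_power a 0) (T * \<omega>) t))"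
      unfolding add_0 sc using w by (intro Bochner_Integration.integral_cong) (simp_all add: mult_ac)
    also have "\<dots> = of_real (\<omega> powr a) * ktrans (damped_power a 0) (T * \<omega>) 1"
      by (simp add: ktrans_def ft_def)
    finally show ?thesis
      using w by (simp add: scaleR_conv_of_real powr_diff)
  qed
  moreover have "((\<lambda>T. of_real (\<omega> powr (a - 1)) * ktrans (damped_power a 0) (T * \<omega>) 1) \<longlongrightarrow> of_real (\<omega> powr (a - 1)) * klim (damped_power a 0) 1) at_top"
  proof (intro tendsto_mult_left filterlim_compose[OF ktrans_tendsto])
    show "filterlim (\<lambda>T. T * \<omega>) at_top at_top"
      using w by real_asymp
  qed simp
  ultimately have "((\<lambda>T. ktrans (damped_power a 0) T \<omega>) \<longlongrightarrow> of_real (\<omega> powr (a - 1)) * klim (damped_power a 0) 1) at_top"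
    by simp
  then show ?thesis
    using tendsto_unique[OF _ ktrans_tendsto[of \<omega>]] w by simp
qed

text \<open>Provides the sine integral of \<open>cos_moment_eq\<close> through the same number that
  governs the expansion of \<open>klim k\<close>.\<close>

lemma Im_klim_power_tendsto:
  assumes a: "0 < a" "a < 1"
  shows "((\<lambda>T. integral {0..T} (\<lambda>x. sin x * x powr (- a))) \<longlongrightarrow> Im (klim (damped_power a 0) 1)) at_top"
proof -
  interpret tail_kernel "damped_power a 0" 1
    using tail_kernel_damped_power[OF a] by simp
  have "Im (ktrans (damped_power a 0) T 1) = integral {0..T} (\<lambda>x. sin x * x powr (- a))" for T
  proof -
    have eq: "indicator {..T} t * (damped_power a 0 t * sin (t * 1)) = indicator {0..T} t * (sin t * t powr (- a))" for t
      by (auto simp: damped_power_def indicator_def)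
    have "set_integrable lborel {0..T} (\<lambda>x. sin x * x powr (- a))"
      using integrable_trunc_mult[of "\<lambda>t. sin (t * 1)" T] unfolding eq by (simp add: set_integrable_def)
    from set_borel_integral_eq_integral(2)[OF this]
    show ?thesis
      unfolding Im_ktrans eq by (simp add: set_lebesgue_integral_def)
  qed
  then show ?thesis
    using tendsto_Im[OF ktrans_tendsto[of 1]] by simp
qed

section \<open>The subdiffusive regime\<close>

locale power_tail = tail_kernel +
  fixes a c b E T :: real
  assumes a: "0 < a" "a < 1" and c: "0 < c" and b: "0 < b" and T: "1 \<le> T" "A \<le> T"
    and tail: "\<And>t. T \<le> t \<Longrightarrow> \<bar>t powr a * k t - c\<bar> \<le> E * t powr (- b)"
begin

abbreviation "P \<equiv> damped_power a 0"

sublocale power: tail_kernel P 1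
  using tail_kernel_damped_power[OF a] by simp

lemma E_nonneg: "0 \<le> E"
proof -
  have "0 \<le> E * T powr (- b)"
    using order_trans[OF abs_ge_zero tail[of T]] by simp
  then show ?thesis
    using T by (simp add: zero_le_mult_iff)
qed

lemma k_le: "T \<le> t \<Longrightarrow> k t \<le> (c + E) * t powr (- a)"
proof -
  assume t: "T \<le> t"
  have "t powr (- b) \<le> 1"
    using t T b powr_mono[of "- b" 0 t] by simp
  then have "E * t powr (- b) \<le> E"
    using E_nonneg by (simp add: mult_left_le)
  then have "t powr a * k t \<le> c + E"
    using tail[OF t] by linarith
  then show ?thesis
    using t T by (simp add: powr_minus field_simps)
qed

text \<open>As \<open>t \<ge> 1\<close>, some of the decay exponent \<open>b\<close> can be given
  away; the comparison with the power needs an exponent with \<open>a + d < 1\<close>.\<close>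

lemma k_diff_le:
  assumes t: "T \<le> t" and d: "0 < d" "d \<le> b"
  shows "\<bar>k t - c * t powr (- a)\<bar> \<le> E * t powr (- a - d)"
proof -
  have t0: "0 < t" using t T by linarith
  have p: "t powr (- a) * t powr a = 1"
    using t0 by (simp add: powr_add[symmetric])
  have "k t - c * t powr (- a) = t powr (- a) * (t powr a * k t - c)"
    using p by (simp add: right_diff_distrib mult.assoc[symmetric])
  then have "\<bar>k t - c * t powr (- a)\<bar> = t powr (- a) * \<bar>t powr a * k t - c\<bar>"
    by (simp add: abs_mult)
  also have "\<dots> \<le> t powr (- a) * (E * t powr (- b))"
    by (intro mult_left_mono tail t) simp
  also have "\<dots> \<le> t powr (- a) * (E * t powr (- d))"
    using t T d E_nonneg by (intro mult_left_mono powr_mono) auto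
  also have "\<dots> = E * (t powr (- a) * t powr (- d))"
    by simp
  also have "t powr (- a) * t powr (- d) = t powr (- a - d)"
    unfolding powr_add[symmetric] by simp
  finally show ?thesis .
qed

lemma integral_k_le:
  assumes "T \<le> S"
  shows "(LINT t|lborel. indicator {..S} t * k t) \<le> (LINT t|lborel. indicator {..T} t * k t) + (c + E) * (S powr (1 - a) / (1 - a))"
proof -
  have le: "indicator {..S} t * k t \<le> indicator {..T} t * k t + (c + E) * (indicator {0<..S} t * t powr (- a))" for t
  proof (cases "T \<le> t \<and> t \<le> S")
    case True
    then have "indicator {..S} t * k t \<le> (c + E) * (indicator {0<..S} t * t powr (- a))"
      using k_le[of t] T by simp
    moreover have "0 \<le> indicator {..T} t * k t" using k_nonneg by simp
    ultimately show ?thesis by linarith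
  next
    case False
    then have "indicator {..S} t * k t \<le> indicator {..T} t * k t"
      using assms by (auto simp: indicator_def)
    moreover have "0 \<le> (c + E) * (indicator {0<..S} t * t powr (- a))"
      using c E_nonneg by simp
    ultimately show ?thesis by linarith
  qed
  have int: "integrable lborel (\<lambda>t. (c + E) * (indicator {0<..S} t * t powr (- a)))"
    by (intro integrable_mult_right integrable_powr_upto a)
  have "(LINT t|lborel. indicator {..S} t * k t) \<le> (LINT t|lborel. indicator {..T} t * k t + (c + E) * (indicator {0<..S} t * t powr (- a)))"
    by (intro integral_mono Bochner_Integration.integrable_add k_integrable int le)
  also have "\<dots> = (LINT t|lborel. indicator {..T} t * k t) + (c + E) * (LINT t|lborel. indicator {0<..S} t * t powr (- a))"
    by (subst Bochner_Integration.integral_add[OF k_integrable int]) simp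
  also have "(LINT t|lborel. indicator {0<..S} t * t powr (- a)) = S powr (1 - a) / (1 - a)"
    using a T assms by (intro integral_powr_upto) auto
  finally show ?thesis .
qed

text \<open>A cut \<open>S\<close> of order \<open>1 / |\<omega>|\<close> balances head and tail:
  apart from a constant, the mass below it and \<open>k S / |\<omega>|\<close> are both of order
  \<open>S^(1 - a)\<close>.\<close>

lemma bounded_kernel_power_tail: "\<exists>C. bounded_kernel k A C (1 - a)"
proof -
  let ?N = "LINT t|lborel. indicator {..T} t * k t"
  define D where "D = (c + E) / (1 - a) + 8 * (c + E)"
  have D0: "0 \<le> D" using a c E_nonneg by (simp add: D_def)
  have N0: "0 \<le> ?N" by (rule Bochner_Integration.integral_nonneg) (simp add: k_nonneg)
  have T1: "1 \<le> T powr (1 - a)" using T a by (simp add: ge_one_powr_ge_zero)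
  have "bounded_kernel k A (?N + D * T powr (1 - a)) (1 - a)"
  proof unfold_locales
    fix R \<omega> :: real assume w: "\<omega> \<noteq> 0"
    define S where "S = max T (1 / \<bar>\<omega>\<bar>)"
    have S: "T \<le> S" "A \<le> S" "1 / \<bar>\<omega>\<bar> \<le> S" "0 < S"
      using T by (auto simp: S_def)
    have p1: "S * S powr (- a) = S powr (1 - a)"
      using S powr_add[of S 1 "- a"] by simp
    have "8 * k S / \<bar>\<omega>\<bar> = 8 * k S * (1 / \<bar>\<omega>\<bar>)" by simp
    also have "\<dots> \<le> 8 * ((c + E) * S powr (- a)) * S"
      using k_le[OF S(1)] S k_nonneg[of S] by (intro mult_mono mult_left_mono) auto
    also have "\<dots> = 8 * (c + E) * (S * S powr (- a))" by simp
    finally have kS: "8 * k S / \<bar>\<omega>\<bar> \<le> 8 * (c + E) * S powr (1 - a)"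
      unfolding p1 .
    have S_le: "S powr (1 - a) \<le> T powr (1 - a) * (1 + \<bar>\<omega>\<bar> powr - (1 - a)) "
    proof -
      have *: "(1 / \<bar>\<omega>\<bar>) powr (1 - a) = \<bar>\<omega>\<bar> powr - (1 - a)"
    proof -
        have "(1 / \<bar>\<omega>\<bar>) powr (1 - a) = 1 / \<bar>\<omega>\<bar> powr (1 - a)"
          by (simp add: powr_divide)
        also have "\<dots> = \<bar>\<omega>\<bar> powr - (1 - a)"
          by (rule powr_minus_divide[symmetric])
        finally show ?thesis .
      qed
      have "S powr (1 - a) \<le> T powr (1 - a) + (1 / \<bar>\<omega>\<bar>) powr (1 - a)"
        by (cases "T \<le> 1 / \<bar>\<omega>\<bar>") (auto simp: S_def max_def)
      also have "\<dots> \<le> T powr (1 - a) + T powr (1 - a) * (1 / \<bar>\<omega>\<bar>) powr (1 - a)"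
        using mult_right_mono[OF T1, of "(1 / \<bar>\<omega>\<bar>) powr (1 - a)"] by simp
      finally show ?thesis
        unfolding * by (simp add: distrib_left)
    qed
    have "cmod (ktrans k R \<omega>) \<le> (LINT t|lborel. indicator {..S} t * k t) + 8 * k S / \<bar>\<omega>\<bar>"
      by (rule norm_ktrans_split[OF S(2) w])
    also have "\<dots> \<le> ?N + (c + E) * (S powr (1 - a) / (1 - a)) + 8 * (c + E) * S powr (1 - a)"
      by (intro add_mono integral_k_le S kS)
    also have "\<dots> = ?N + D * S powr (1 - a)"
      by (simp add: D_def algebra_simps)
    also have "\<dots> \<le> ?N * (1 + \<bar>\<omega>\<bar> powr - (1 - a)) + D * (T powr (1 - a) * (1 + \<bar>\<omega>\<bar> powr - (1 - a)))"
      using N0 D0 S_le by (intro add_mono mult_left_mono) (auto simp: distrib_left)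
    also have "\<dots> = (?N + D * T powr (1 - a)) * (1 + \<bar>\<omega>\<bar> powr - (1 - a))"
      by (simp add: algebra_simps)
    finally show "cmod (ktrans k R \<omega>) \<le> (?N + D * T powr (1 - a)) * (1 + \<bar>\<omega>\<bar> powr - (1 - a))" .
  qed (use a in auto)
  then show ?thesis by blast
qed

text \<open>Between \<open>T\<close> and \<open>R\<close> the kernels differ by at most
  \<open>E t^(- a - d)\<close>, whose integral may be extended down to 0 since
  \<open>a + d < 1\<close>. Up to \<open>T\<close> the two masses are simply added.\<close>

lemma ktrans_diff_power:
  assumes R: "T \<le> R" and d: "0 < d" "d \<le> b" "a + d < 1"
  shows "cmod (ktrans k R \<omega> - of_real c * ktrans P R \<omega>)
    \<le> (LINT t|lborel. indicator {..T} t * k t) + c * (LINT t|lborel. indicator {..T} t * P t) + E * (R powr (1 - a - d) / (1 - a - d))"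
proof -
  have i1: "integrable lborel (\<lambda>t. cis (t * \<omega>) * trunc k R t)"
    by (intro integrable_cis_mult trunc_integrable)
  have i2: "integrable lborel (\<lambda>t. of_real c * (cis (t * \<omega>) * trunc P R t))"
    by (intro integrable_mult_right integrable_cis_mult power.trunc_integrable)
  have eq: "ktrans k R \<omega> - of_real c * ktrans P R \<omega> = (LINT t|lborel. cis (t * \<omega>) * trunc k R t - of_real c * (cis (t * \<omega>) * trunc P R t))"
    unfolding ktrans_def ft_def by (subst Bochner_Integration.integral_diff[OF i1 i2]) simp
  have i3: "integrable lborel (\<lambda>t. indicator {..T} t * k t + c * (indicator {..T} t * P t))"
    by (intro Bochner_Integration.integrable_add integrable_mult_right k_integrable power.k_integrable)
  have i4: "integrable lborel (\<lambda>t. E * (indicator {0<..R} t * t powr (- (a + d))))"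
    using d by (intro integrable_mult_right integrable_powr_upto)
  have P0: "0 \<le> P t" for t by (rule power.k_nonneg)
  have le: "cmod (cis (t * \<omega>) * trunc k R t - of_real c * (cis (t * \<omega>) * trunc P R t))
      \<le> indicator {..T} t * k t + c * (indicator {..T} t * P t) + E * (indicator {0<..R} t * t powr (- (a + d)))" for t
  proof -
    have h: "cis (t * \<omega>) * trunc k R t - of_real c * (cis (t * \<omega>) * trunc P R t) = cis (t * \<omega>) * of_real (indicator {..R} t * (k t - c * P t))"
      by (simp add: trunc_def algebra_simps)
    have n: "cmod (cis (t * \<omega>) * trunc k R t - of_real c * (cis (t * \<omega>) * trunc P R t)) = indicator {..R} t * \<bar>k t - c * P t\<bar>"
      unfolding h norm_mult norm_cis norm_of_real by (simp add: abs_mult)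
    have nn: "0 \<le> E * (indicator {0<..R} t * t powr (- (a + d)))" "0 \<le> indicator {..T} t * k t" "0 \<le> c * (indicator {..T} t * P t)"
      using E_nonneg c P0[of t] k_nonneg[of t] by simp_all
    consider "t \<le> T" | "T < t" "t \<le> R" | "R < t" by linarith
    then show ?thesis
    proof cases
      case 1
      then have i: "indicator {..T} t = (1::real)" "indicator {..R} t = (1::real)" using R by auto
      have "\<bar>k t - c * P t\<bar> \<le> k t + c * P t"
        using k_nonneg[of t] mult_nonneg_nonneg[OF less_imp_le[OF c] P0[of t]] by linarith
      then show ?thesis
        using nn(1) unfolding n i mult_1 by linarith
    next
      case 2
      then have "0 < t" using T by linarith
      have i: "indicator {0<..R} t = (1::real)" "indicator {..R} t = (1::real)" using 2 \<open>0 < t\<close> by auto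
      have "\<bar>k t - c * P t\<bar> \<le> E * t powr (- (a + d))"
        using k_diff_le[OF less_imp_le[OF 2(1)] d(1,2)] \<open>0 < t\<close> by (simp add: damped_power_def)
      then show ?thesis
        using nn(2,3) unfolding n i mult_1 by linarith
    next
      case 3
      then have i: "indicator {..R} t = (0::real)" by auto
      show ?thesis
        using nn unfolding n i mult_zero_left by linarith
    qed
  qed
  have "cmod (ktrans k R \<omega> - of_real c * ktrans P R \<omega>) \<le> (LINT t|lborel. (indicator {..T} t * k t + c * (indicator {..T} t * P t)) + E * (indicator {0<..R} t * t powr (- (a + d))))"
    unfolding eq by (intro order_trans[OF integral_norm_bound] integral_mono integrable_norm
        Bochner_Integration.integrable_diff i1 i2 Bochner_Integration.integrable_add[OF i3 i4] le)
  also have "\<dots> = ((LINT t|lborel. indicator {..T} t * k t) + c * (LINT t|lborel. indicator {..T} t * P t)) + E * (LINT t|lborel. indicator {0<..R} t * t powr (- (a + d)))"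
    using k_integrable power.k_integrable by (subst Bochner_Integration.integral_add[OF i3 i4]) simp
  also have "(LINT t|lborel. indicator {0<..R} t * t powr (- (a + d))) = R powr (1 - (a + d)) / (1 - (a + d))"
    using d R T by (intro integral_powr_upto) auto
  finally show ?thesis
    by (simp only: diff_diff_eq)
qed

text \<open>
  The cut-off \<open>R = T \<omega>^(-(a + d) / a)\<close> balances the tails of both kernels beyond \<open>R\<close> against the
  integral of their difference up to \<open>R\<close>, if of the decay exponent \<open>b\<close> only the part
  \<open>d' = d / (a + d)\<close> is used.
\<close>
lemma klim_power_tail_expansion:
  assumes d: "0 < d" "d \<le> a * b" "2 * d \<le> 1 - a"
  obtains E' where "\<And>\<omega>. 0 < \<omega> \<Longrightarrow> \<omega> \<le> 1 \<Longrightarrow>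
    cmod (klim k \<omega> - (of_real c * klim P 1) * of_real (\<omega> powr (a - 1))) \<le> E' * \<omega> powr (a - 1 + d)"
proof -
  define d' where "d' = d / (a + d)"
  let ?q = "1 - a - d'"
  have ad: "0 < a + d" using a d by simp
  have d': "0 < d'" "d' \<le> b" "a + d' < 1"
  proof -
    show "0 < d'" using a d by (simp add: d'_def)
    have "d' \<le> d / a" unfolding d'_def using a d by (intro divide_left_mono) auto
    also have "\<dots> \<le> b" using a d by (simp add: divide_le_eq mult.commute)
    finally show "d' \<le> b" .
    \<comment> \<open>Equivalent to \<open>d a < (1 - a) a\<close>, and \<open>d < 1 - a\<close>
      follows from \<open>2 d \<le> 1 - a\<close>.\<close>
    have "d < (1 - a) * (a + d)"
    proof -
      have "d * a < (1 - a) * a" using a d by (intro mult_strict_right_mono) auto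
      then show ?thesis by (simp add: algebra_simps)
    qed
    then show "a + d' < 1" unfolding d'_def using ad by (simp add: field_simps)
  qed
  let ?N = "(LINT t|lborel. indicator {..T} t * k t) + c * (LINT t|lborel. indicator {..T} t * P t)"
  have N0: "0 \<le> ?N"
    using c by (intro add_nonneg_nonneg mult_nonneg_nonneg Bochner_Integration.integral_nonneg) (auto simp: k_nonneg power.k_nonneg)
  \<comment> \<open>The summands belong to the tail of \<open>k\<close> beyond \<open>R\<close>, the
    masses up to \<open>T\<close>, the difference between \<open>T\<close> and \<open>R\<close>, and
    the tail of the power.\<close>
  define E' where "E' = 8 * (c + E) + ?N + E * (T powr ?q / ?q) + 8 * c"
  show thesis
  proof (rule that[of E'])
    fix \<omega> :: real assume w: "0 < \<omega>" "\<omega> \<le> 1"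
    define R where "R = T * \<omega> powr (- ((a + d) / a))"
    have R1: "1 \<le> \<omega> powr (- ((a + d) / a))"
      using w a ad powr_mono'[of "- ((a + d) / a)" 0 \<omega>] by simp
    have "T \<le> R"
      using T mult_left_mono[OF R1, of T] by (simp add: R_def)
    then have R: "T \<le> R" "A \<le> R" "1 \<le> R" "0 < R"
      using T by linarith+
    have Ra: "R powr (- a) / \<omega> \<le> \<omega> powr (a - 1 + d)"
    proof -
      have "R powr (- a) = T powr (- a) * \<omega> powr (a + d)"
        using T w a by (simp add: R_def powr_mult powr_powr add.commute)
      also have "\<dots> \<le> 1 * \<omega> powr (a + d)"
        using T a powr_mono[of "- a" 0 T] by (intro mult_right_mono) auto
      finally have "R powr (- a) / \<omega> \<le> \<omega> powr (a + d) / \<omega> powr 1"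
        using w by (simp add: divide_right_mono)
      moreover have "\<omega> powr (a + d) / \<omega> powr 1 = \<omega> powr (a - 1 + d)"
        unfolding powr_diff[symmetric] by (simp add: algebra_simps)
      ultimately show ?thesis
        by (simp only:)
    qed
    have Rq: "R powr ?q = T powr ?q * \<omega> powr (a - 1 + d)"
    proof -
      \<comment> \<open>With this \<open>d'\<close> the difference up to \<open>R\<close> has
        exactly the order \<open>\<omega>^(a - 1 + d)\<close> of the two tails.\<close>
      have "(a + d) / a * ?q = 1 - a - d"
      proof -
        have "(a + d) * d' = d"
          using ad by (simp add: d'_def)
        then have "(a + d) * ?q = a * (1 - a - d)"
          by (simp add: algebra_simps)
        then show ?thesis
          using a by simp
      qed
      then have "- ((a + d) / a) * ?q = a - 1 + d" by simp
      then show ?thesis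
        using T w by (simp add: R_def powr_mult powr_powr)
    qed
    \<comment> \<open>As \<open>a - 1 + d \<le> 0\<close>, constants are absorbed into the error
      term.\<close>
    have w1: "1 \<le> \<omega> powr (a - 1 + d)"
      using w a d powr_mono'[of "a - 1 + d" 0 \<omega>] by simp
    have "cmod (klim k \<omega> - ktrans k R \<omega>) \<le> 8 * k R / \<bar>\<omega>\<bar>"
      using w by (intro klim_diff_le R) auto
    also have "\<dots> \<le> 8 * ((c + E) * R powr (- a)) / \<omega>"
      using w k_le[OF R(1)] by (simp add: divide_right_mono)
    also have "\<dots> = 8 * (c + E) * (R powr (- a) / \<omega>)" by simp
    also have "\<dots> \<le> 8 * (c + E) * \<omega> powr (a - 1 + d)"
      using c E_nonneg by (intro mult_left_mono Ra) auto
    finally have 1: "cmod (klim k \<omega> - ktrans k R \<omega>) \<le> 8 * (c + E) * \<omega> powr (a - 1 + d)" .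
    have "cmod (ktrans k R \<omega> - of_real c * ktrans P R \<omega>) \<le> ?N + E * (R powr ?q / ?q)"
      by (rule ktrans_diff_power[OF R(1) d'])
    also have "\<dots> \<le> ?N * \<omega> powr (a - 1 + d) + E * (T powr ?q / ?q) * \<omega> powr (a - 1 + d)"
      using mult_left_mono[OF w1 N0] by (simp add: Rq)
    finally have 2: "cmod (ktrans k R \<omega> - of_real c * ktrans P R \<omega>) \<le> ?N * \<omega> powr (a - 1 + d) + E * (T powr ?q / ?q) * \<omega> powr (a - 1 + d)" .
    have "cmod (of_real c * klim P \<omega> - of_real c * ktrans P R \<omega>) = c * cmod (klim P \<omega> - ktrans P R \<omega>)"
      using c by (simp flip: right_diff_distrib add: norm_mult)
    also have "\<dots> \<le> c * (8 * P R / \<bar>\<omega>\<bar>)"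
      using c w R by (intro mult_left_mono power.klim_diff_le) auto
    also have "\<dots> = 8 * c * (R powr (- a) / \<omega>)"
      using w R by (simp add: damped_power_def)
    also have "\<dots> \<le> 8 * c * \<omega> powr (a - 1 + d)"
      using c by (intro mult_left_mono Ra) auto
    finally have 3: "cmod (of_real c * klim P \<omega> - of_real c * ktrans P R \<omega>) \<le> 8 * c * \<omega> powr (a - 1 + d)" .
    have tri: "cmod (x - z) \<le> cmod (x - y) + cmod (y - y') + cmod (z - y')" for x y y' z :: complex
      using norm_triangle_ineq4[of "(x - y) + (y - y')" "z - y'"] norm_triangle_ineq[of "x - y" "y - y'"] by simp
    have "cmod (klim k \<omega> - of_real c * klim P \<omega>) \<le> E' * \<omega> powr (a - 1 + d)"
      using order_trans[OF tri add_mono[OF add_mono[OF 1 2] 3]] by (simp add: E'_def distrib_right)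
    then show "cmod (klim k \<omega> - (of_real c * klim P 1) * of_real (\<omega> powr (a - 1))) \<le> E' * \<omega> powr (a - 1 + d)"
      unfolding klim_power_scaling[OF a w(1)] by (simp add: mult_ac)
  qed
qed

text \<open>With \<open>c klim P 1 = c \<rho> e^(i \<theta>)\<close> the inverse contributes
  \<open>cos \<theta> / (c \<rho>)\<close> and the moment \<open>4 \<rho> sin \<theta> / a\<close>.
  The modulus cancels, and \<open>2 \<theta> = pi - a pi\<close>.\<close>

lemma subdiffusive_constant:
  assumes \<beta>: "0 < \<beta>"
  shows "0 < Re (of_real c * klim P 1)"
    and "Re (inverse (of_real c * klim P 1)) / (pi * \<beta>) * cos_moment a = 2 * sin (a * pi) / (a * pi * \<beta> * c)"
proof -
  define \<theta> where "\<theta> = pi * (1 - a) / 2"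
  obtain \<rho> where \<rho>: "0 < \<rho>" "klim P 1 = of_real \<rho> * cis \<theta>"
    using klim_power_direction[OF a] unfolding \<theta>_def .
  have \<theta>: "0 < \<theta>" "\<theta> < pi / 2"
    using a by (auto simp: \<theta>_def)
  have z: "of_real c * klim P 1 = of_real (c * \<rho>) * cis \<theta>"
    by (simp add: \<rho>(2))
  show "0 < Re (of_real c * klim P 1)"
    unfolding z using c \<rho>(1) \<theta> cos_gt_zero[of \<theta>] by simp
  have "inverse (of_real c * klim P 1) = of_real (1 / (c * \<rho>)) * cis (- \<theta>)"
    unfolding z by (simp add: cis_inverse divide_inverse)
  then have inv: "Re (inverse (of_real c * klim P 1)) = cos \<theta> / (c * \<rho>)"
    by simp
  have "cos_moment a = 4 / a * Im (klim P 1)"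
    using a by (intro cos_moment_eq Im_klim_power_tendsto) auto
  then have mom: "cos_moment a = 4 / a * (\<rho> * sin \<theta>)"
    by (simp add: \<rho>(2))
  have "2 * sin \<theta> * cos \<theta> = sin (2 * \<theta>)"
    by (simp add: sin_double)
  also have "2 * \<theta> = pi - a * pi"
    by (simp add: \<theta>_def) (simp add: algebra_simps)
  finally have s: "sin (a * pi) = 2 * sin \<theta> * cos \<theta>"
    by simp
  show "Re (inverse (of_real c * klim P 1)) / (pi * \<beta>) * cos_moment a = 2 * sin (a * pi) / (a * pi * \<beta> * c)"
    unfolding inv mom s using \<rho>(1) c a \<beta> by (simp add: field_simps)
qed

end

section \<open>The mean squared displacement\<close>

lemma integrable_lborel_AE:
  fixes f g :: "real \<Rightarrow> real"
  assumes f: "integrable lebesgue f" and g: "g \<in> borel_measurable borel" and ae: "AE t in lborel. f t = g t"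
  shows "integrable lborel g"
proof -
  have "AE t in lebesgue. f t = g t"
    unfolding AE_completion_iff by (rule ae)
  then have "integrable lebesgue g"
    by (rule integrable_cong_AE_imp[OF f, rotated]) (use g in \<open>auto intro: measurable_completion\<close>)
  then show ?thesis
    using g by (simp add: integrable_completion)
qed

lemma improper_integral_eqI:
  assumes "has_improper_integral f I"
  shows "improper_integral f = I"
  unfolding improper_integral_def
proof (rule the_equality[of "has_improper_integral f", OF assms])
  fix J assume "has_improper_integral f J"
  then show "J = I"
    using assms tendsto_unique[of at_top "\<lambda>T. integral {0..T} f"] by (simp add: has_improper_integral_def)
qed

context tail_kernel
begin

text \<open>Dominated convergence turns the improper integral of the original kernel into the mass
  of its Borel version.\<close>

lemma Kcos_0:
  assumes loc: "locally_integrable r" and ae: "AE t in lborel. r t = k \<bar>t\<bar>" and k: "integrable lborel k"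
  shows "Kcos r 0 = (LINT t|lborel. k t)"
proof -
  have int: "r absolutely_integrable_on {0..T}" for T
    using loc by (simp add: locally_integrable_def)
  have "integral {0..T} r = (LINT t|lborel. indicator {..T} t * k t)" for T
  proof -
    have "integral {0..T} r = (LINT t|lebesgue. indicator {0..T} t * r t)"
      using set_lebesgue_integral_eq_integral(2)[OF int[of T]] by (simp add: set_lebesgue_integral_def)
    also have "\<dots> = (LINT t|lborel. indicator {..T} t * k t)"
    proof (rule integral_lebesgue_AE_eq)
      show "AE t in lborel. indicator {0..T} t * r t = indicator {..T} t * k t"
        using ae by eventually_elim (use k_causal in \<open>auto simp: indicator_def\<close>)
    qed measurable
    finally show ?thesis .
  qed
  moreover have "((\<lambda>T. LINT t|lborel. indicator {..T} t * k t) \<longlongrightarrow> (LINT t|lborel. k t)) at_top"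
  proof (rule integral_dominated_convergence_at_top[OF _ _ k])
    have "\<forall>\<^sub>F T in at_top. indicator {..T} t * k t = k t" for t
      using eventually_ge_at_top[of t] by eventually_elim simp
    then show "AE t in lborel. ((\<lambda>T. indicator {..T} t * k t) \<longlongrightarrow> k t) at_top"
      by (intro AE_I2 tendsto_eventually)
    show "\<forall>\<^sub>F T in at_top. AE t in lborel. norm (indicator {..T} t * k t) \<le> k t"
      by (intro always_eventually allI AE_I2) (auto simp: indicator_def k_nonneg)
  qed auto
  ultimately have "has_improper_integral (\<lambda>t. r t * cos (t * 0)) (LINT t|lborel. k t)"
    using int[THEN set_lebesgue_integral_eq_integral(1)] by (simp add: has_improper_integral_def)
  then show ?thesis
    unfolding Kcos_def by (rule improper_integral_eqI)
qed

text \<open>Monotonicity beyond \<open>A\<close> keeps \<open>k\<close> above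
  \<open>k (A + 1) > 0\<close> on an interval of length 1.\<close>

lemma integral_kernel_pos:
  assumes k: "integrable lborel k" and pos: "\<And>t. A \<le> t \<Longrightarrow> 0 < k t"
  shows "0 < (LINT t|lborel. k t)"
proof -
  have int: "integrable lborel (\<lambda>t. indicator {A..A + 1} t * k (A + 1))"
    by (intro integrable_mult_left integrable_real_indicator) auto
  have "0 < k (A + 1)" by (rule pos) simp
  also have "k (A + 1) = (LINT t|lborel. indicator {A..A + 1} t * k (A + 1))"
    by simp
  also have "\<dots> \<le> (LINT t|lborel. k t)"
    by (intro integral_mono int k) (auto simp: indicator_def k_nonneg intro!: k_antimono)
  finally show ?thesis .
qed

end

theorem theorem2p5:
  fixes K :: "real \<Rightarrow> ereal" and m \<beta> :: real
    and M :: "'w measure"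
    and F :: "(real \<Rightarrow> complex) \<Rightarrow> 'w \<Rightarrow> complex"
    and V :: "((real \<Rightarrow> complex) \<Rightarrow> complex) \<Rightarrow> 'w \<Rightarrow> complex"
  assumes "gle_kernel K"
    and "0 < m" and "0 < \<beta>"
    and "prob_space M"
    and "gle_noise M (real_kernel K) F"
    and "gle_weak_solution M m \<beta> (real_kernel K) F V"
  shows
    "(\<forall>\<beta>\<^sub>0 > 0.
        real_kernel K absolutely_integrable_on {0<..} \<and>
        (\<lambda>t. t powr \<beta>\<^sub>0 * real_kernel K t) absolutely_integrable_on {0<..} \<longrightarrow>
        (\<lambda>t. \<bar>(LINT w|M. (cmod (position_process V t w))\<^sup>2) / t
               - 2 / (\<beta> * Kcos (real_kernel K) 0)\<bar>)
          \<in> O(\<lambda>t. t powr (- (min \<beta>\<^sub>0 2) / 2)))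
     \<and>
     (\<forall>\<alpha> C\<^sub>\<alpha> \<beta>\<^sub>\<alpha>.
        0 < \<alpha> \<and> \<alpha> < 1 \<and> 0 < C\<^sub>\<alpha> \<and> 0 < \<beta>\<^sub>\<alpha> \<and>
        asymp_proportional (real_kernel K) (\<lambda>t. t powr (- \<alpha>)) \<and>
        (\<lambda>t. \<bar>t powr \<alpha> * real_kernel K t - C\<^sub>\<alpha>\<bar>) \<in> O(\<lambda>t. t powr (- \<beta>\<^sub>\<alpha>)) \<longrightarrow>
        (\<lambda>t. \<bar>(LINT w|M. (cmod (position_process V t w))\<^sup>2) / t powr \<alpha>
               - 2 * sin (\<alpha> * pi) / (\<alpha> * pi * \<beta> * C\<^sub>\<alpha>)\<bar>)
          \<in> O(\<lambda>t. t powr (- (min \<alpha> (min (1 - \<alpha>) (\<alpha> * \<beta>\<^sub>\<alpha>))) / 2)))"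
proof -
  obtain k A where k: "tail_kernel k A" and K_eq: "AE t in lborel. real_kernel K t = k \<bar>t\<bar>"
    and k_eq: "\<And>t. A \<le> t \<Longrightarrow> k t = real_kernel K t" and k_pos: "\<And>t. A \<le> t \<Longrightarrow> 0 < k t"
    and klim_pos: "\<And>\<omega>. \<omega> \<noteq> 0 \<Longrightarrow> 0 < Re (klim k \<omega>)"
    using gle_kernel_borel_version[OF assms(1)] by blast
  interpret positive_kernel k A m \<beta>
    unfolding positive_kernel_def positive_kernel_axioms_def using k klim_pos assms(2,3) by blast
  let ?x = "\<lambda>t. LINT w|M. (cmod (position_process V t w))\<^sup>2"
  \<comment> \<open>The bound on the truncated transforms differs between the regimes, so
    \<open>C\<close> and \<open>s\<close> are left open.\<close>
  have second_moment: "?x t = (LINT \<omega>|lborel. (cmod (ft (indicator {0..t}) \<omega>))\<^sup>2 * r \<omega>)"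
    if "bounded_kernel k A C s" "\<And>\<omega>. \<omega> \<noteq> 0 \<Longrightarrow> r \<omega> \<le> b" "0 \<le> t" for C s b t
  proof -
    interpret gle_solution k A C s "real_kernel K" m \<beta> M F V
      unfolding gle_solution_def gle_solution_axioms_def using that(1) K_eq klim_pos assms by blast
    show ?thesis
      using position_second_moment[OF that(2,3)] .
  qed
  have r_measurable [measurable]: "r \<in> borel_measurable borel"
    unfolding spectral_density_def spectral_denominator_def by measurable
  show ?thesis
  proof (intro conjI allI impI)
    fix \<beta>\<^sub>0 :: real
    assume \<beta>\<^sub>0: "0 < \<beta>\<^sub>0" and int: "real_kernel K absolutely_integrable_on {0<..} \<and>
        (\<lambda>t. t powr \<beta>\<^sub>0 * real_kernel K t) absolutely_integrable_on {0<..}"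
    define \<kappa> where "\<kappa> = (LINT t|lborel. k t)"
    have k_int: "integrable lborel k"
    proof (rule integrable_lborel_AE)
      show "integrable lebesgue (\<lambda>t. indicator {0<..} t * real_kernel K t)"
        using int by (simp add: set_integrable_def)
      show "AE t in lborel. indicator {0<..} t * real_kernel K t = k t"
        using K_eq by eventually_elim (use k_causal in \<open>auto simp: indicator_def\<close>)
    qed measurable
    have tk_int: "integrable lborel (\<lambda>t. \<bar>t\<bar> powr \<beta>\<^sub>0 * k t)"
    proof (rule integrable_lborel_AE)
      show "integrable lebesgue (\<lambda>t. indicator {0<..} t * (t powr \<beta>\<^sub>0 * real_kernel K t))"
        using int by (simp add: set_integrable_def)
      show "AE t in lborel. indicator {0<..} t * (t powr \<beta>\<^sub>0 * real_kernel K t) = \<bar>t\<bar> powr \<beta>\<^sub>0 * k t"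
        using K_eq by eventually_elim (use k_causal in \<open>auto simp: indicator_def\<close>)
    qed measurable
    have \<kappa>: "0 < \<kappa>"
      unfolding \<kappa>_def by (rule integral_kernel_pos[OF k_int k_pos])
    have Kcos: "Kcos (real_kernel K) 0 = \<kappa>"
      unfolding \<kappa>_def using assms(1) by (intro Kcos_0 K_eq k_int) (simp add: gle_kernel_def)
    note bk = bounded_kernel_integrable[OF k_int]
    \<comment> \<open>\<open>d \<le> \<beta>\<^sub>0\<close> makes the moment of order
      \<open>d\<close> finite, and \<open>d = 1\<close> exactly if
      \<open>\<beta>\<^sub>0 \<ge> 2\<close>.\<close>
    define d where "d = min \<beta>\<^sub>0 2 / 2"
    have d: "0 < d" "d \<le> 1" "d \<le> \<beta>\<^sub>0"
      using \<beta>\<^sub>0 by (auto simp: d_def)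
    have limit: "Re (inverse (of_real \<kappa>)) / (pi * \<beta>) * cos_moment 1 = 2 / (\<beta> * \<kappa>)"
      by (simp add: cos_moment_1 flip: of_real_inverse) (simp add: divide_inverse)
    have expansion: "cmod (klim k \<omega> - of_real \<kappa> * of_real (\<omega> powr (1 - 1)))
        \<le> 2 * (LINT t|lborel. \<bar>t\<bar> powr d * k t) * \<omega> powr (1 - 1 + d)" if "0 < \<omega>" "\<omega> \<le> 1" for \<omega>
      using klim_Hoelder[OF k_int klim_power_moment[OF k_int tk_int, of d], of \<omega>] that d by (simp add: \<kappa>_def)
    \<comment> \<open>The global bound \<open>b\<close> enters the second moment formula for every
      \<open>\<beta>\<^sub>0\<close>, the estimate \<open>E\<close> the case
      \<open>d < 1\<close>.\<close>
    obtain E b where E: "\<And>\<omega>. \<omega> \<noteq> 0 \<Longrightarrow> \<bar>r \<omega> - Re (inverse (of_real \<kappa>)) / (pi * \<beta>) * \<bar>\<omega>\<bar> powr (1 - 1)\<bar> \<le> E * \<bar>\<omega>\<bar> powr (1 - 1 + d)"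
      and b: "\<And>\<omega>. \<omega> \<noteq> 0 \<Longrightarrow> r \<omega> \<le> b"
      using spectral_density_expansion[of 1 d "of_real \<kappa>", OF _ _ d(1,2) _ expansion] \<kappa> by auto
    have x: "?x t = (LINT \<omega>|lborel. (cmod (ft (indicator {0..t}) \<omega>))\<^sup>2 * r \<omega>)" if "0 < t" for t
      by (rule second_moment[OF bk]) (use b that in auto)
    have "\<exists>B. \<forall>t>0. \<bar>?x t / t - 2 / (\<beta> * \<kappa>)\<bar> \<le> B * t powr (- d)"
    proof (cases "\<beta>\<^sub>0 < 2")
      case True
      then have d1: "d < 1" by (simp add: d_def)
      have "\<bar>?x t / t - 2 / (\<beta> * \<kappa>)\<bar> \<le> E * cos_moment (1 - d) * t powr (- d)" if t: "0 < t" for t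
        using frequency_integral_rate[OF r_measurable t _ _ d(1) d1 E] t
        unfolding x[OF t] limit by simp
      then show ?thesis by blast
    next
      case False
      then have d1: "d = 1" by (simp add: d_def)
      have "(\<lambda>t. t\<^sup>2 * k t) = (\<lambda>t. \<bar>t\<bar> powr 2 * k t)"
        by (auto simp: k_causal)
      then have m2: "integrable lborel (\<lambda>t. t\<^sup>2 * k t)"
        using klim_power_moment[OF k_int tk_int, of 2] False by simp
      have m1: "integrable lborel (\<lambda>t. \<bar>t\<bar> powr 1 * k t)"
        using klim_power_moment[OF k_int tk_int, of 1] False by simp
      obtain E where E: "\<And>\<omega>. \<omega> \<noteq> 0 \<Longrightarrow> \<bar>r \<omega> - 1 / (pi * \<beta> * \<kappa>)\<bar> \<le> E * (\<omega>\<^sup>2 * inverse (1 + \<omega>\<^sup>2))"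
        using spectral_density_quadratic[OF k_int m1 m2] \<kappa> unfolding \<kappa>_def by blast
      have limit': "1 / (pi * \<beta> * \<kappa>) * cos_moment 1 = 2 / (\<beta> * \<kappa>)"
        by (simp add: cos_moment_1)
      have "\<bar>?x t / t - 2 / (\<beta> * \<kappa>)\<bar> \<le> 4 * E * (LINT \<omega>::real|lborel. inverse (1 + \<omega>\<^sup>2)) * t powr (- d)" if t: "0 < t" for t
        using frequency_integral_rate_quadratic[OF r_measurable t E] t
        unfolding limit' x[OF t]
        by (simp add: d1 powr_minus_divide)
      then show ?thesis by blast
    qed
    then obtain B where B: "\<And>t. 0 < t \<Longrightarrow> \<bar>?x t / t - 2 / (\<beta> * \<kappa>)\<bar> \<le> B * t powr (- d)"
      by blast
    have "- (min \<beta>\<^sub>0 2) / 2 = - d" by (simp add: d_def)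
    then show "(\<lambda>t. \<bar>?x t / t - 2 / (\<beta> * Kcos (real_kernel K) 0)\<bar>) \<in> O(\<lambda>t. t powr (- (min \<beta>\<^sub>0 2) / 2))"
      unfolding Kcos
      by (intro bigoI[of _ B]) (use B in \<open>auto intro!: eventually_mono[OF eventually_gt_at_top[of 0]]\<close>)
  next
    fix \<alpha> C\<^sub>\<alpha> \<beta>\<^sub>\<alpha> :: real
    assume asm: "0 < \<alpha> \<and> \<alpha> < 1 \<and> 0 < C\<^sub>\<alpha> \<and> 0 < \<beta>\<^sub>\<alpha> \<and>
        asymp_proportional (real_kernel K) (\<lambda>t. t powr (- \<alpha>)) \<and>
        (\<lambda>t. \<bar>t powr \<alpha> * real_kernel K t - C\<^sub>\<alpha>\<bar>) \<in> O(\<lambda>t. t powr (- \<beta>\<^sub>\<alpha>))"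
    then obtain E where "\<forall>\<^sub>F t in at_top. norm \<bar>t powr \<alpha> * real_kernel K t - C\<^sub>\<alpha>\<bar> \<le> E * norm (t powr (- \<beta>\<^sub>\<alpha>))"
      by (auto elim!: landau_o.bigE)
    then obtain T0 where T0: "\<And>t. T0 \<le> t \<Longrightarrow> \<bar>t powr \<alpha> * real_kernel K t - C\<^sub>\<alpha>\<bar> \<le> E * t powr (- \<beta>\<^sub>\<alpha>)"
      by (auto simp: eventually_at_top_linorder)
    \<comment> \<open>Beyond \<open>T\<close> the assumed estimate holds, \<open>k\<close> agrees
      with the original kernel, and \<open>t \<ge> 1\<close>.\<close>
    define T where "T = max T0 (max A 1)"
    interpret power_tail k A \<alpha> C\<^sub>\<alpha> \<beta>\<^sub>\<alpha> E T
    proof unfold_locales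
      show "\<bar>t powr \<alpha> * k t - C\<^sub>\<alpha>\<bar> \<le> E * t powr (- \<beta>\<^sub>\<alpha>)" if "T \<le> t" for t
        using T0[of t] k_eq[of t] that by (simp add: T_def)
    qed (use asm in \<open>auto simp: T_def\<close>)
    \<comment> \<open>The halving yields \<open>d < \<alpha>\<close>, which keeps the error moment
      finite, and \<open>2 d \<le> 1 - \<alpha>\<close>, which the expansion of \<open>klim\<close>
      requires.\<close>
    define d where "d = min \<alpha> (min (1 - \<alpha>) (\<alpha> * \<beta>\<^sub>\<alpha>)) / 2"
    \<comment> \<open>With \<open>\<alpha> * \<beta>\<^sub>\<alpha>\<close> replaced by a single
      unknown \<open>y\<close>, all four conditions are linear.\<close>
    have min_bounds: "0 < min \<alpha> (min (1 - \<alpha>) y) / 2 \<and> min \<alpha> (min (1 - \<alpha>) y) / 2 < \<alpha> \<and>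
        min \<alpha> (min (1 - \<alpha>) y) / 2 \<le> y \<and> 2 * (min \<alpha> (min (1 - \<alpha>) y) / 2) \<le> 1 - \<alpha>" if "0 < y" for y
      using asm that by (auto simp: min_def)
    have "0 < \<alpha> * \<beta>\<^sub>\<alpha>" using asm by simp
    from min_bounds[OF this] have d: "0 < d" "d < \<alpha>" "d \<le> \<alpha> * \<beta>\<^sub>\<alpha>" "2 * d \<le> 1 - \<alpha>"
      unfolding d_def by blast+
    let ?z = "of_real C\<^sub>\<alpha> * klim (damped_power \<alpha> 0) 1"
    obtain E1 where E1: "\<And>\<omega>. 0 < \<omega> \<Longrightarrow> \<omega> \<le> 1 \<Longrightarrow>
        cmod (klim k \<omega> - ?z * of_real (\<omega> powr (\<alpha> - 1))) \<le> E1 * \<omega> powr (\<alpha> - 1 + d)"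
      using klim_power_tail_expansion[OF d(1,3,4)] by blast
    note const = subdiffusive_constant[OF assms(3)]
    obtain E2 b where E2: "\<And>\<omega>. \<omega> \<noteq> 0 \<Longrightarrow> \<bar>r \<omega> - Re (inverse ?z) / (pi * \<beta>) * \<bar>\<omega>\<bar> powr (1 - \<alpha>)\<bar> \<le> E2 * \<bar>\<omega>\<bar> powr (1 - \<alpha> + d)"
      and b: "\<And>\<omega>. \<omega> \<noteq> 0 \<Longrightarrow> r \<omega> \<le> b"
      using spectral_density_expansion[OF _ _ d(1) less_imp_le[OF d(2)] const(1) E1] asm by auto
    obtain C where bk: "bounded_kernel k A C (1 - \<alpha>)"
      using bounded_kernel_power_tail by blast
    have x: "?x t = (LINT \<omega>|lborel. (cmod (ft (indicator {0..t}) \<omega>))\<^sup>2 * r \<omega>)" if "0 < t" for t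
      by (rule second_moment[OF bk]) (use b that in auto)
    have B: "\<bar>?x t / t powr \<alpha> - 2 * sin (\<alpha> * pi) / (\<alpha> * pi * \<beta> * C\<^sub>\<alpha>)\<bar> \<le> E2 * cos_moment (\<alpha> - d) * t powr (- d)"
      if t: "0 < t" for t
      using frequency_integral_rate[OF r_measurable t _ _ d(1,2) E2] asm
      unfolding const(2) x[OF t] by simp
    have "- (min \<alpha> (min (1 - \<alpha>) (\<alpha> * \<beta>\<^sub>\<alpha>))) / 2 = - d" by (simp add: d_def)
    then show "(\<lambda>t. \<bar>?x t / t powr \<alpha> - 2 * sin (\<alpha> * pi) / (\<alpha> * pi * \<beta> * C\<^sub>\<alpha>)\<bar>)
          \<in> O(\<lambda>t. t powr (- (min \<alpha> (min (1 - \<alpha>) (\<alpha> * \<beta>\<^sub>\<alpha>))) / 2))"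
      by (intro bigoI[of _ "E2 * cos_moment (\<alpha> - d)"])
         (use B in \<open>auto intro!: eventually_mono[OF eventually_gt_at_top[of 0]]\<close>)
  qed
qed

end
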